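(* Let $(M^6,g,J)$ be a complete hermitian manifold of type $\mathcal W_3$ whose characteristic connection $\nabla^c$ and characteristic torsion $T^c$ satisfy $$\nabla^cT^c=0,\qquad \dim\mathrm{Hol}(\nabla^c)=0.$$ Then $M^6$ is a flat Kähler manifold, i.e. $T^c=0$.
   Context: For an almost hermitian manifold $(M^6,g,J)$ put $\Omega(X,Y)=g(JX,Y)$. Type $\mathcal W_3$ means: $J$ is integrable and $\delta\Omega=0$. The characteristic connection $\nabla^c$ is the unique linear connection with $\nabla^cg=0$, $\nabla^cJ=0$ and totally skew-symmetric torsion; its torsion $T^c$ is regarded as a $3$-form, $\nabla^c_XY=\nabla^{LC}_XY+\frac12T^c(X,Y,-)$. For type $\mathcal W_3$ one has $T^c=J(d\Omega)$, where $(JT)(X,Y,Z)=T(JX,JY,JZ)$. $\mathrm{Hol}(\nabla^c)$ is the holonomy group of $\nabla^c$. *)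

theory Defs
  imports "HOL-Analysis.Analysis"
begin

section \<open>Smooth manifolds\<close>

abbreviation dir_deriv ::
  "('b::real_normed_vector \<Rightarrow> 'd::real_normed_vector) \<Rightarrow> 'b \<Rightarrow> 'b \<Rightarrow> 'd"
  where "dir_deriv f x u \<equiv> frechet_derivative f (at x) u"

primrec Ck_on ::
  "nat \<Rightarrow> ('b::real_normed_vector \<Rightarrow> 'd::real_normed_vector) \<Rightarrow> 'b set \<Rightarrow> bool" where
  "Ck_on 0 f S \<longleftrightarrow> continuous_on S f"
| "Ck_on (Suc k) f S \<longleftrightarrow>
     (\<forall>x\<in>S. f differentiable (at x)) \<and> (\<forall>u. Ck_on k (\<lambda>x. dir_deriv f x u) S)"

text \<open>\<open>C\<close>-infinity on \<open>S\<close>; only used for open \<open>S\<close>.\<close>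

definition smooth_on ::
  "('b::real_normed_vector \<Rightarrow> 'd::real_normed_vector) \<Rightarrow> 'b set \<Rightarrow> bool" where
  "smooth_on f S \<longleftrightarrow> (\<forall>k. Ck_on k f S)"

text \<open>The manifold is a whole type \<open>'a\<close>. A chart is a pair of its domain and its coordinate map,
  whose values outside the domain are irrelevant. The dimension is \<open>CARD('n)\<close>.\<close>

type_synonym ('a, 'n) chart = "'a set \<times> ('a \<Rightarrow> real ^ 'n)"

definition codom :: "('a, 'n::finite) chart \<Rightarrow> (real ^ 'n) set" where
  "codom c = snd c ` fst c"

definition overlap :: "('a, 'n::finite) chart \<Rightarrow> ('a, 'n) chart \<Rightarrow> (real ^ 'n) set" where
  "overlap c d = snd c ` (fst c \<inter> fst d)"

definition transition ::
  "('a, 'n::finite) chart \<Rightarrow> ('a, 'n) chart \<Rightarrow> real ^ 'n \<Rightarrow> real ^ 'n" where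
  "transition c d = snd d \<circ> inv_into (fst c) (snd c)"

definition smooth_atlas :: "('a::topological_space, 'n::finite) chart set \<Rightarrow> bool" where
  "smooth_atlas A \<longleftrightarrow>
     (\<Union>c\<in>A. fst c) = UNIV \<and>
     (\<forall>c\<in>A. open (fst c) \<and> open (codom c) \<and>
        homeomorphism (fst c) (codom c) (snd c) (inv_into (fst c) (snd c))) \<and>
     (\<forall>c\<in>A. \<forall>d\<in>A. smooth_on (transition c d) (overlap c d))"

section \<open>Tensor fields and linear connections\<close>

text \<open>A geometric object is the family of its coordinate representations in the charts \<open>c\<close> of
  the atlas, subject to the transformation law under changes of charts: \<open>\<beta> c x u v\<close> is the value
  at the coordinate point \<open>x \<in> codom c\<close> on the tangent vectors with components \<open>u\<close> and \<open>v\<close>.\<close>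

type_synonym ('a, 'n) form2 =
  "('a, 'n) chart \<Rightarrow> real ^ 'n \<Rightarrow> real ^ 'n \<Rightarrow> real ^ 'n \<Rightarrow> real"

type_synonym ('a, 'n) endo =
  "('a, 'n) chart \<Rightarrow> real ^ 'n \<Rightarrow> real ^ 'n \<Rightarrow> real ^ 'n"

type_synonym ('a, 'n) conn =
  "('a, 'n) chart \<Rightarrow> real ^ 'n \<Rightarrow> real ^ 'n \<Rightarrow> real ^ 'n \<Rightarrow> real ^ 'n"

definition bilinear_form_field ::
  "('a, 'n::finite) chart set \<Rightarrow> ('a, 'n) form2 \<Rightarrow> bool" where
  "bilinear_form_field A \<beta> \<longleftrightarrow>
     (\<forall>c\<in>A. \<forall>x\<in>codom c. bilinear (\<beta> c x)) \<and>
     (\<forall>c\<in>A. \<forall>u v. smooth_on (\<lambda>x. \<beta> c x u v) (codom c)) \<and>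
     (\<forall>c\<in>A. \<forall>d\<in>A. \<forall>x\<in>overlap c d. \<forall>u v.
        \<beta> c x u v = \<beta> d (transition c d x)
          (dir_deriv (transition c d) x u) (dir_deriv (transition c d) x v))"

definition endomorphism_field ::
  "('a, 'n::finite) chart set \<Rightarrow> ('a, 'n) endo \<Rightarrow> bool" where
  "endomorphism_field A J \<longleftrightarrow>
     (\<forall>c\<in>A. \<forall>x\<in>codom c. linear (J c x)) \<and>
     (\<forall>c\<in>A. \<forall>u. smooth_on (\<lambda>x. J c x u) (codom c)) \<and>
     (\<forall>c\<in>A. \<forall>d\<in>A. \<forall>x\<in>overlap c d. \<forall>u.
        dir_deriv (transition c d) x (J c x u) =
        J d (transition c d x) (dir_deriv (transition c d) x u))"

text \<open>A linear connection is given by its Christoffel symbols \<open>\<Gamma> c x\<close>: in the chart \<open>c\<close>, the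
  covariant derivative of the vector field \<open>V\<close> along \<open>u\<close> is \<open>dir_deriv V x u + \<Gamma> c x u (V x)\<close>.
  The law below says that this expression transforms as a tangent vector.\<close>

definition linear_connection ::
  "('a, 'n::finite) chart set \<Rightarrow> ('a, 'n) conn \<Rightarrow> bool" where
  "linear_connection A \<Gamma> \<longleftrightarrow>
     (\<forall>c\<in>A. \<forall>x\<in>codom c. bilinear (\<Gamma> c x)) \<and>
     (\<forall>c\<in>A. \<forall>u v. smooth_on (\<lambda>x. \<Gamma> c x u v) (codom c)) \<and>
     (\<forall>c\<in>A. \<forall>d\<in>A. \<forall>x\<in>overlap c d. \<forall>u v.
        dir_deriv (transition c d) x (\<Gamma> c x u v) =
        \<Gamma> d (transition c d x) (dir_deriv (transition c d) x u) (dir_deriv (transition c d) x v)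
        + dir_deriv (\<lambda>y. dir_deriv (transition c d) y v) x u)"

text \<open>\<open>nabla_form \<Gamma> \<beta> c x u v w\<close> is \<open>(\<nabla>\<^sub>u \<beta>)(v, w)\<close>, and \<open>nabla_endo \<Gamma> J c x u v\<close> is
  \<open>(\<nabla>\<^sub>u J) v\<close>.\<close>

definition nabla_form :: "('a, 'n::finite) conn \<Rightarrow> ('a, 'n) form2 \<Rightarrow>
    ('a, 'n) chart \<Rightarrow> real ^ 'n \<Rightarrow> real ^ 'n \<Rightarrow> real ^ 'n \<Rightarrow> real ^ 'n \<Rightarrow> real" where
  "nabla_form \<Gamma> \<beta> c x u v w =
     dir_deriv (\<lambda>y. \<beta> c y v w) x u - \<beta> c x (\<Gamma> c x u v) w - \<beta> c x v (\<Gamma> c x u w)"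

definition nabla_endo :: "('a, 'n::finite) conn \<Rightarrow> ('a, 'n) endo \<Rightarrow>
    ('a, 'n) chart \<Rightarrow> real ^ 'n \<Rightarrow> real ^ 'n \<Rightarrow> real ^ 'n \<Rightarrow> real ^ 'n" where
  "nabla_endo \<Gamma> J c x u v =
     dir_deriv (\<lambda>y. J c y v) x u + \<Gamma> c x u (J c x v) - J c x (\<Gamma> c x u v)"

definition parallel_form ::
  "('a, 'n::finite) chart set \<Rightarrow> ('a, 'n) conn \<Rightarrow> ('a, 'n) form2 \<Rightarrow> bool" where
  "parallel_form A \<Gamma> \<beta> \<longleftrightarrow> (\<forall>c\<in>A. \<forall>x\<in>codom c. \<forall>u v w. nabla_form \<Gamma> \<beta> c x u v w = 0)"

definition parallel_endo ::
  "('a, 'n::finite) chart set \<Rightarrow> ('a, 'n) conn \<Rightarrow> ('a, 'n) endo \<Rightarrow> bool" where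
  "parallel_endo A \<Gamma> J \<longleftrightarrow> (\<forall>c\<in>A. \<forall>x\<in>codom c. \<forall>u v. nabla_endo \<Gamma> J c x u v = 0)"

text \<open>The torsion \<open>\<nabla>\<^sub>X Y - \<nabla>\<^sub>Y X - [X,Y]\<close> and the curvature
  \<open>\<nabla>\<^sub>X \<nabla>\<^sub>Y Z - \<nabla>\<^sub>Y \<nabla>\<^sub>X Z - \<nabla>\<^sub>[\<^sub>X\<^sub>,\<^sub>Y\<^sub>] Z\<close>, evaluated on fields with constant components \<open>u\<close>,
  \<open>v\<close>, \<open>w\<close> in the chart \<open>c\<close>.\<close>

definition torsion :: "('a, 'n::finite) conn \<Rightarrow> ('a, 'n) conn" where
  "torsion \<Gamma> c x u v = \<Gamma> c x u v - \<Gamma> c x v u"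

definition curvature :: "('a, 'n::finite) conn \<Rightarrow>
    ('a, 'n) chart \<Rightarrow> real ^ 'n \<Rightarrow> real ^ 'n \<Rightarrow> real ^ 'n \<Rightarrow> real ^ 'n \<Rightarrow> real ^ 'n" where
  "curvature \<Gamma> c x u v w =
     dir_deriv (\<lambda>y. \<Gamma> c y v w) x u - dir_deriv (\<lambda>y. \<Gamma> c y u w) x v
     + \<Gamma> c x u (\<Gamma> c x v w) - \<Gamma> c x v (\<Gamma> c x u w)"

definition torsion_form :: "('a, 'n::finite) form2 \<Rightarrow> ('a, 'n) conn \<Rightarrow>
    ('a, 'n) chart \<Rightarrow> real ^ 'n \<Rightarrow> real ^ 'n \<Rightarrow> real ^ 'n \<Rightarrow> real ^ 'n \<Rightarrow> real" where
  "torsion_form g \<Gamma> c x u v w = g c x (torsion \<Gamma> c x u v) w"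

definition skew_torsion ::
  "('a, 'n::finite) chart set \<Rightarrow> ('a, 'n) form2 \<Rightarrow> ('a, 'n) conn \<Rightarrow> bool" where
  "skew_torsion A g \<Gamma> \<longleftrightarrow> (\<forall>c\<in>A. \<forall>x\<in>codom c. \<forall>u v w.
     torsion_form g \<Gamma> c x u v w = - torsion_form g \<Gamma> c x v u w \<and>
     torsion_form g \<Gamma> c x u v w = - torsion_form g \<Gamma> c x u w v)"

definition parallel_torsion ::
  "('a, 'n::finite) chart set \<Rightarrow> ('a, 'n) form2 \<Rightarrow> ('a, 'n) conn \<Rightarrow> bool" where
  "parallel_torsion A g \<Gamma> \<longleftrightarrow> (\<forall>c\<in>A. \<forall>x\<in>codom c. \<forall>u v w z.
     dir_deriv (\<lambda>y. torsion_form g \<Gamma> c y v w z) x u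
     - torsion_form g \<Gamma> c x (\<Gamma> c x u v) w z
     - torsion_form g \<Gamma> c x v (\<Gamma> c x u w) z
     - torsion_form g \<Gamma> c x v w (\<Gamma> c x u z) = 0)"

definition zero_torsion ::
  "('a, 'n::finite) chart set \<Rightarrow> ('a, 'n) form2 \<Rightarrow> ('a, 'n) conn \<Rightarrow> bool" where
  "zero_torsion A g \<Gamma> \<longleftrightarrow>
     (\<forall>c\<in>A. \<forall>x\<in>codom c. \<forall>u v w. torsion_form g \<Gamma> c x u v w = 0)"

definition flat_connection ::
  "('a, 'n::finite) chart set \<Rightarrow> ('a, 'n) conn \<Rightarrow> bool" where
  "flat_connection A \<Gamma> \<longleftrightarrow> (\<forall>c\<in>A. \<forall>x\<in>codom c. \<forall>u v w. curvature \<Gamma> c x u v w = 0)"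

section \<open>Almost hermitian geometry\<close>

definition riemannian_metric ::
  "('a, 'n::finite) chart set \<Rightarrow> ('a, 'n) form2 \<Rightarrow> bool" where
  "riemannian_metric A g \<longleftrightarrow> bilinear_form_field A g \<and>
     (\<forall>c\<in>A. \<forall>x\<in>codom c. (\<forall>u v. g c x u v = g c x v u) \<and> (\<forall>u. u \<noteq> 0 \<longrightarrow> g c x u u > 0))"

definition almost_hermitian ::
  "('a, 'n::finite) chart set \<Rightarrow> ('a, 'n) form2 \<Rightarrow> ('a, 'n) endo \<Rightarrow> bool" where
  "almost_hermitian A g J \<longleftrightarrow> riemannian_metric A g \<and> endomorphism_field A J \<and>
     (\<forall>c\<in>A. \<forall>x\<in>codom c. (\<forall>u. J c x (J c x u) = - u) \<and>
        (\<forall>u v. g c x (J c x u) (J c x v) = g c x u v))"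

definition levi_civita ::
  "('a, 'n::finite) chart set \<Rightarrow> ('a, 'n) form2 \<Rightarrow> ('a, 'n) conn \<Rightarrow> bool" where
  "levi_civita A g \<Gamma> \<longleftrightarrow> linear_connection A \<Gamma> \<and> parallel_form A \<Gamma> g \<and>
     (\<forall>c\<in>A. \<forall>x\<in>codom c. \<forall>u v. torsion \<Gamma> c x u v = 0)"

definition characteristic_connection ::
  "('a, 'n::finite) chart set \<Rightarrow> ('a, 'n) form2 \<Rightarrow> ('a, 'n) endo \<Rightarrow> ('a, 'n) conn \<Rightarrow> bool" where
  "characteristic_connection A g J \<Gamma> \<longleftrightarrow> linear_connection A \<Gamma> \<and>
     parallel_form A \<Gamma> g \<and> parallel_endo A \<Gamma> J \<and> skew_torsion A g \<Gamma>"

definition fundamental_form ::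
  "('a, 'n::finite) form2 \<Rightarrow> ('a, 'n) endo \<Rightarrow> ('a, 'n) form2" where
  "fundamental_form g J c x u v = g c x (J c x u) v"

text \<open>Bracket \<open>[X,Y]\<close> of vector fields on an open subset of a coordinate space.\<close>

definition lie_bracket ::
  "(real ^ 'n::finite \<Rightarrow> real ^ 'n) \<Rightarrow> (real ^ 'n \<Rightarrow> real ^ 'n) \<Rightarrow> real ^ 'n \<Rightarrow> real ^ 'n" where
  "lie_bracket X Y x = dir_deriv Y x (X x) - dir_deriv X x (Y x)"

text \<open>\<open>[JX,JY] - J[JX,Y] - J[X,JY] - [X,Y]\<close> on fields with constant components \<open>u\<close>, \<open>v\<close>.\<close>

definition nijenhuis :: "('a, 'n::finite) endo \<Rightarrow>
    ('a, 'n) chart \<Rightarrow> real ^ 'n \<Rightarrow> real ^ 'n \<Rightarrow> real ^ 'n \<Rightarrow> real ^ 'n" where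
  "nijenhuis J c x u v =
     lie_bracket (\<lambda>y. J c y u) (\<lambda>y. J c y v) x
     - J c x (lie_bracket (\<lambda>y. J c y u) (\<lambda>_. v) x)
     - J c x (lie_bracket (\<lambda>_. u) (\<lambda>y. J c y v) x)
     - lie_bracket (\<lambda>_. u) (\<lambda>_. v) x"

definition integrable_structure ::
  "('a, 'n::finite) chart set \<Rightarrow> ('a, 'n) endo \<Rightarrow> bool" where
  "integrable_structure A J \<longleftrightarrow> (\<forall>c\<in>A. \<forall>x\<in>codom c. \<forall>u v. nijenhuis J c x u v = 0)"

definition ext_deriv2 :: "('a, 'n::finite) form2 \<Rightarrow>
    ('a, 'n) chart \<Rightarrow> real ^ 'n \<Rightarrow> real ^ 'n \<Rightarrow> real ^ 'n \<Rightarrow> real ^ 'n \<Rightarrow> real" where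
  "ext_deriv2 \<omega> c x u v w =
     dir_deriv (\<lambda>y. \<omega> c y v w) x u + dir_deriv (\<lambda>y. \<omega> c y w u) x v
     + dir_deriv (\<lambda>y. \<omega> c y u v) x w"

text \<open>\<open>(\<delta>\<omega>)(v)\<close> is minus the \<open>g\<close>-trace of \<open>(\<nabla>\<^sub>e \<omega>)(e, v)\<close> over \<open>e\<close>, with \<open>\<nabla>\<close> the Levi-Civita
  connection \<open>L\<close>; the trace is taken with the inverse of the Gram matrix of the coordinate
  basis.\<close>

definition inverse_metric ::
  "('a, 'n::finite) form2 \<Rightarrow> ('a, 'n) chart \<Rightarrow> real ^ 'n \<Rightarrow> real ^ 'n ^ 'n" where
  "inverse_metric g c x = matrix_inv (\<chi> i j. g c x (axis i 1) (axis j 1))"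

definition codifferential2 :: "('a, 'n::finite) form2 \<Rightarrow> ('a, 'n) conn \<Rightarrow> ('a, 'n) form2 \<Rightarrow>
    ('a, 'n) chart \<Rightarrow> real ^ 'n \<Rightarrow> real ^ 'n \<Rightarrow> real" where
  "codifferential2 g L \<omega> c x v =
     - (\<Sum>i\<in>UNIV. \<Sum>j\<in>UNIV.
          inverse_metric g c x $ i $ j * nabla_form L \<omega> c x (axis i 1) (axis j 1) v)"

definition type_W3 :: "('a, 'n::finite) chart set \<Rightarrow> ('a, 'n) form2 \<Rightarrow> ('a, 'n) endo \<Rightarrow>
    ('a, 'n) conn \<Rightarrow> bool" where
  "type_W3 A g J L \<longleftrightarrow> integrable_structure A J \<and>
     (\<forall>c\<in>A. \<forall>x\<in>codom c. \<forall>v. codifferential2 g L (fundamental_form g J) c x v = 0)"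

definition kaehler ::
  "('a, 'n::finite) chart set \<Rightarrow> ('a, 'n) form2 \<Rightarrow> ('a, 'n) endo \<Rightarrow> bool" where
  "kaehler A g J \<longleftrightarrow> almost_hermitian A g J \<and> integrable_structure A J \<and>
     (\<forall>c\<in>A. \<forall>x\<in>codom c. \<forall>u v w. ext_deriv2 (fundamental_form g J) c x u v w = 0)"

section \<open>Paths, completeness and holonomy\<close>

text \<open>Continuously differentiable on the closed interval, with one-sided derivatives at the end
  points.\<close>

definition C1_path_on :: "('a::topological_space, 'n::finite) chart set \<Rightarrow> (real \<Rightarrow> 'a) \<Rightarrow>
    real \<Rightarrow> real \<Rightarrow> bool" where
  "C1_path_on A \<gamma> a b \<longleftrightarrow> continuous_on {a..b} \<gamma> \<and>
     (\<forall>c\<in>A. \<exists>D. continuous_on {t \<in> {a..b}. \<gamma> t \<in> fst c} D \<and>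
        (\<forall>t\<in>{a..b}. \<gamma> t \<in> fst c \<longrightarrow>
           ((snd c \<circ> \<gamma>) has_vector_derivative D t) (at t within {a..b})))"

definition piecewise_C1_path ::
  "('a::topological_space, 'n::finite) chart set \<Rightarrow> (real \<Rightarrow> 'a) \<Rightarrow> bool" where
  "piecewise_C1_path A \<gamma> \<longleftrightarrow>
     (\<exists>F. finite F \<and> {0, 1} \<subseteq> F \<and> F \<subseteq> {0..1} \<and>
        (\<forall>a\<in>F. \<forall>b\<in>F. a < b \<and> F \<inter> {a<..<b} = {} \<longrightarrow> C1_path_on A \<gamma> a b))"

text \<open>The speed does not depend on the chart chosen; its values at the finitely many break points
  do not matter.\<close>

definition speed :: "('a, 'n::finite) chart set \<Rightarrow> ('a, 'n) form2 \<Rightarrow> (real \<Rightarrow> 'a) \<Rightarrow>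
    real \<Rightarrow> real" where
  "speed A g \<gamma> t =
     (let c = (SOME c. c \<in> A \<and> \<gamma> t \<in> fst c);
          \<gamma>' = vector_derivative (snd c \<circ> \<gamma>) (at t)
      in sqrt (g c (snd c (\<gamma> t)) \<gamma>' \<gamma>'))"

definition path_length :: "('a, 'n::finite) chart set \<Rightarrow> ('a, 'n) form2 \<Rightarrow> (real \<Rightarrow> 'a) \<Rightarrow> real"
  where "path_length A g \<gamma> = integral {0..1} (speed A g \<gamma>)"

definition riemannian_dist :: "('a::topological_space, 'n::finite) chart set \<Rightarrow> ('a, 'n) form2 \<Rightarrow>
    'a \<Rightarrow> 'a \<Rightarrow> real" where
  "riemannian_dist A g p q =
     Inf {path_length A g \<gamma> | \<gamma>. piecewise_C1_path A \<gamma> \<and> \<gamma> 0 = p \<and> \<gamma> 1 = q}"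

definition complete_metric ::
  "('a::topological_space, 'n::finite) chart set \<Rightarrow> ('a, 'n) form2 \<Rightarrow> bool" where
  "complete_metric A g \<longleftrightarrow>
     (\<forall>\<sigma> :: nat \<Rightarrow> 'a.
        (\<forall>\<epsilon>>0. \<exists>N. \<forall>m\<ge>N. \<forall>n\<ge>N. riemannian_dist A g (\<sigma> m) (\<sigma> n) < \<epsilon>)
        \<longrightarrow> (\<exists>q. (\<lambda>n. riemannian_dist A g (\<sigma> n) q) \<longlonglongrightarrow> 0))"

text \<open>\<open>V c t\<close> is the component vector, in the chart \<open>c\<close>, of a tangent vector at \<open>\<gamma> t\<close>.\<close>

definition parallel_along :: "('a, 'n::finite) chart set \<Rightarrow> ('a, 'n) conn \<Rightarrow> (real \<Rightarrow> 'a) \<Rightarrow>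
    (('a, 'n) chart \<Rightarrow> real \<Rightarrow> real ^ 'n) \<Rightarrow> bool" where
  "parallel_along A \<Gamma> \<gamma> V \<longleftrightarrow>
     (\<forall>c\<in>A. \<forall>d\<in>A. \<forall>t\<in>{0..1}. \<gamma> t \<in> fst c \<inter> fst d \<longrightarrow>
        V d t = dir_deriv (transition c d) (snd c (\<gamma> t)) (V c t)) \<and>
     (\<forall>c\<in>A. continuous_on {t \<in> {0..1}. \<gamma> t \<in> fst c} (V c)) \<and>
     (\<exists>F. finite F \<and> (\<forall>c\<in>A. \<forall>t\<in>{0<..<1} - F. \<gamma> t \<in> fst c \<longrightarrow>
        (V c has_vector_derivative
           - \<Gamma> c (snd c (\<gamma> t)) (vector_derivative (snd c \<circ> \<gamma>) (at t)) (V c t)) (at t)))"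

text \<open>The holonomy group at \<open>p\<close>, as matrices acting on the tangent space at \<open>p\<close> by means of the
  basis given by a chart \<open>c\<close> around \<open>p\<close>.\<close>

definition holonomy_group :: "('a::topological_space, 'n::finite) chart set \<Rightarrow> ('a, 'n) conn \<Rightarrow>
    'a \<Rightarrow> ('a, 'n) chart \<Rightarrow> (real ^ 'n ^ 'n) set" where
  "holonomy_group A \<Gamma> p c =
     {P. \<exists>\<gamma>. piecewise_C1_path A \<gamma> \<and> \<gamma> 0 = p \<and> \<gamma> 1 = p \<and>
        (\<forall>v. \<exists>V. parallel_along A \<Gamma> \<gamma> V \<and> V c 0 = v \<and> V c 1 = P *v v)}"

text \<open>The tangent space at the identity of a matrix Lie group \<open>G\<close>, and the dimension of \<open>G\<close>. As
  \<open>G\<close> is only an immersed Lie subgroup, not necessarily closed, the curves must be continuously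
  differentiable: curves differentiable just at \<open>0\<close> would yield the Lie algebra of the closure.\<close>

definition lie_algebra :: "(real ^ 'n::finite ^ 'n) set \<Rightarrow> (real ^ 'n ^ 'n) set" where
  "lie_algebra G =
     {vector_derivative \<alpha> (at 0) | \<alpha>. \<exists>\<epsilon>>0. \<alpha> C1_differentiable_on {-\<epsilon><..<\<epsilon>} \<and>
        \<alpha> ` {-\<epsilon><..<\<epsilon>} \<subseteq> G \<and> \<alpha> 0 = mat 1}"

definition lie_group_dim :: "(real ^ 'n::finite ^ 'n) set \<Rightarrow> nat" where
  "lie_group_dim G = dim (lie_algebra G)"

end

theory Submission
  imports Defs
begin

text \<open>
The theorem separates into a global statement about holonomy and a pointwise statement about
tensors on one tangent space.

Holonomy. Let \<open>\<Gamma>\<close> be any linear connection on a connected manifold. If the holonomy group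
is zero-dimensional, every continuously differentiable curve in it has velocity zero at the identity.
Such curves arise from small coordinate rectangles: the transport around the rectangle with sides
\<open>s u\<close> and \<open>t v\<close> is, for fixed \<open>s\<close>, a continuously differentiable function of \<open>t\<close>, and it is the identity
at \<open>t = 0\<close>. Hence its derivative at \<open>t = 0\<close> vanishes for every small \<open>s\<close>, and differentiating this
identity once more at \<open>s = 0\<close> gives \<open>R(u, v) = 0\<close> (\<open>curvature_zero_of_trivial_loops\<close>). What makes the
curve admissible is that solutions of a linear differential equation depend on a parameter in a
continuously differentiable way (\<open>linear_ode_C1_in_parameter\<close>). Rectangles based at other points are
carried to the base point by conjugating with the transport along a connecting path; such a path
exists because the set of points that can be joined to the base point with invertible transport is
open and closed (\<open>reachable_everywhere\<close>). So the characteristic connection is flat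
(\<open>flat_of_discrete_holonomy\<close>).

Algebra. Write \<open>[u, v]\<close> for the torsion at a point. Flatness and \<open>\<nabla>T = 0\<close> turn the first Bianchi
identity into the Jacobi identity for this bracket (\<open>torsion_jacobi\<close>), integrability of \<open>J\<close> says that
\<open>[u, v] = [Ju, Jv] - J[Ju, v] - J[u, Jv]\<close> (\<open>torsion_type\<close>), and \<open>\<delta>\<Omega> = 0\<close> says that the vector
\<open>\<Sum>\<^sub>i [e\<^sub>i, J e\<^sub>i]\<close> vanishes (\<open>torsion_trace\<close>). Inserting \<open>e\<^sub>i, J e\<^sub>i, w\<close> into the Jacobi identity and
summing gives \<open>\<Sum>\<^sub>i g([e\<^sub>i, z], [J e\<^sub>i, w]) = 0\<close>. Expand \<open>\<Sum>\<^sub>i\<^sub>j |[e\<^sub>i, e\<^sub>j]|\<^sup>2\<close> by the type condition in one of its two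
factors: each of the three resulting sums can be brought to this form, so all of them vanish and
\<open>T = 0\<close> (\<open>lie_bracket_vanishes\<close>).

With \<open>T = 0\<close> the characteristic connection is the Levi-Civita connection, which is therefore flat and
leaves \<open>\<Omega>\<close> parallel, so that \<open>d\<Omega> = 0\<close>.
\<close>

section \<open>Linear differential equations depending on a parameter\<close>

text \<open>The integration interval becomes fixed, so that the dependence on the upper limit is a dependence of
the integrand on a parameter.\<close>

lemma integral_rescale_to_unit:
  fixes f :: "real \<Rightarrow> 'e::banach"
  assumes "0 \<le> s"
  shows "integral {0..s} f = s *\<^sub>R integral {0..1} (\<lambda>r. f (s * r))"
proof (cases "s = 0")
  case False
  with assms have s: "s > 0" by simp
  have "(\<lambda>x. x / s) ` {0..s} = {0..1}"
  proof
    show "{0..1} \<subseteq> (\<lambda>x. x / s) ` {0..s}"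
    proof
      fix r :: real assume "r \<in> {0..1}"
      then have "r = (s * r) / s" "s * r \<in> {0..s}" using s by (auto simp: mult_left_le)
      then show "r \<in> (\<lambda>x. x / s) ` {0..s}" by blast
    qed
  qed (use s in auto)
  with integral_stretch_real[OF False, of 0 s f] s show ?thesis by simp
qed auto

lemma continuous_on_integral_upper_limit:
  fixes f :: "real \<Rightarrow> 'p::topological_space \<Rightarrow> 'e::banach"
  assumes f: "continuous_on ({0..l} \<times> T) (\<lambda>(s, t). f s t)"
  shows "continuous_on ({0..l} \<times> T) (\<lambda>(s, t). integral {0..s} (\<lambda>r. f r t))"
proof -
  have "continuous_on (({0..l} \<times> T) \<times> cbox 0 1) (\<lambda>(p, r). f (fst p * r) (snd p))"
  proof -
    have "continuous_on (({0..l} \<times> T) \<times> cbox 0 1)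
        (\<lambda>z. case (fst (fst z) * snd z, snd (fst z)) of (s, t) \<Rightarrow> f s t)"
    proof (rule continuous_on_compose2[OF f])
      show "(\<lambda>z. (fst (fst z) * snd z, snd (fst z))) ` (({0..l} \<times> T) \<times> cbox 0 1) \<subseteq> {0..l} \<times> T"
      proof clarsimp
        fix a r :: real assume "0 \<le> a" "a \<le> l" "0 \<le> r" "r \<le> 1"
        then show "a * r \<le> l" using mult_left_le[of r a] by linarith
      qed
    qed (intro continuous_intros)
    then show ?thesis by (simp add: case_prod_beta)
  qed
  from integral_continuous_on_param[OF this]
  have "continuous_on ({0..l} \<times> T) (\<lambda>p. fst p *\<^sub>R integral {0..1} (\<lambda>r. f (fst p * r) (snd p)))"
    by (intro continuous_intros) simp
  then show ?thesis
    by (rule continuous_on_eq) (clarsimp simp del: scaleR_conv_of_real, rule integral_rescale_to_unit[symmetric])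
qed

text \<open>Picard iteration for \<open>y' = pr A y\<close>, with \<open>t\<close> a parameter. The product \<open>pr\<close> is kept abstract because it
is used in three ways: multiplication by a matrix from the left, multiplication from the right,
and the tangent product of \<open>bounded_bilinear_tangent\<close>.\<close>

primrec picard :: "('m \<Rightarrow> 'e \<Rightarrow> 'e::banach) \<Rightarrow> (real \<Rightarrow> 'p \<Rightarrow> 'm) \<Rightarrow> 'e \<Rightarrow> nat \<Rightarrow>
    real \<Rightarrow> 'p \<Rightarrow> 'e" where
  "picard pr A y0 0 = (\<lambda>s t. y0)"
| "picard pr A y0 (Suc n) =
     (\<lambda>s t. y0 + integral {0..s} (\<lambda>r. pr (A r t) (picard pr A y0 n r t)))"

lemma continuous_on_picard:
  fixes A :: "real \<Rightarrow> 'p::topological_space \<Rightarrow> 'm::real_normed_vector" and y0 :: "'e::banach"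
  assumes pr: "bounded_bilinear pr" and A: "continuous_on ({0..l} \<times> T) (\<lambda>(s, t). A s t)"
  shows "continuous_on ({0..l} \<times> T) (\<lambda>(s, t). picard pr A y0 n s t)"
proof (induction n)
  case (Suc n)
  have "continuous_on ({0..l} \<times> T) (\<lambda>(s, t). pr (A s t) (picard pr A y0 n s t))"
    using bounded_bilinear.continuous_on[OF pr A Suc] by (simp add: case_prod_beta)
  from continuous_on_integral_upper_limit[OF this]
  show ?case by (auto simp: case_prod_beta intro!: continuous_intros)
qed (auto simp: case_prod_beta)

lemma continuous_on_section1:
  assumes "continuous_on (S \<times> T) (\<lambda>(s, t). f s t)" "t \<in> T"
  shows "continuous_on S (\<lambda>s. f s t)"
proof -
  have "continuous_on S (\<lambda>s. case (s, t) of (s, t) \<Rightarrow> f s t)"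
    by (rule continuous_on_compose2[OF assms(1)]) (use assms(2) in \<open>auto intro!: continuous_on_Pair\<close>)
  then show ?thesis by simp
qed

lemma continuous_on_section2:
  assumes "continuous_on (S \<times> T) (\<lambda>(s, t). f s t)" "s \<in> S"
  shows "continuous_on T (\<lambda>t. f s t)"
proof -
  have "continuous_on T (\<lambda>t. case (s, t) of (s, t) \<Rightarrow> f s t)"
    by (rule continuous_on_compose2[OF assms(1)]) (use assms(2) in \<open>auto intro!: continuous_on_Pair\<close>)
  then show ?thesis by simp
qed

text \<open>The factorial makes the iteration converge on an interval of any length, however large the
coefficients are.\<close>

lemma picard_step_bound:
  fixes A :: "real \<Rightarrow> 'p::topological_space \<Rightarrow> 'm::real_normed_vector" and y0 :: "'e::banach"
  assumes pr: "bounded_bilinear pr" and A: "continuous_on ({0..l} \<times> T) (\<lambda>(s, t). A s t)"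
    and K: "\<And>s t y. s \<in> {0..l} \<Longrightarrow> t \<in> T \<Longrightarrow> norm (pr (A s t) y) \<le> K * norm y" and "0 \<le> K"
    and "s \<in> {0..l}" "t \<in> T"
  shows "norm (picard pr A y0 (Suc n) s t - picard pr A y0 n s t)
         \<le> norm y0 * ((K * s) ^ Suc n / fact (Suc n))"
  using assms(5)
proof (induction n arbitrary: s)
  case 0
  have "norm (integral {0..s} (\<lambda>r. pr (A r t) y0)) \<le> (K * norm y0) * (s - 0)"
  proof (rule integral_bound)
    show "continuous_on {0..s} (\<lambda>r. pr (A r t) y0)"
      by (rule bounded_bilinear.continuous_on[OF pr])
        (use continuous_on_subset[OF continuous_on_section1[OF A \<open>t \<in> T\<close>]] 0 in auto)
  qed (use 0 K \<open>t \<in> T\<close> in auto)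
  then show ?case by (simp add: mult_ac)
next
  case (Suc n)
  let ?Y = "picard pr A y0"
  have At: "continuous_on {0..s} (\<lambda>r. A r t)"
    using continuous_on_subset[OF continuous_on_section1[OF A \<open>t \<in> T\<close>]] Suc.prems by auto
  have Yt: "continuous_on {0..s} (\<lambda>r. ?Y k r t)" for k
    using continuous_on_subset[OF continuous_on_section1[OF continuous_on_picard[OF pr A] \<open>t \<in> T\<close>]]
      Suc.prems by auto
  note c = bounded_bilinear.continuous_on[OF pr At Yt]
  have "?Y (Suc (Suc n)) s t - ?Y (Suc n) s t
      = integral {0..s} (\<lambda>r. pr (A r t) (?Y (Suc n) r t)) - integral {0..s} (\<lambda>r. pr (A r t) (?Y n r t))"
    by simp
  also have "\<dots> = integral {0..s} (\<lambda>r. pr (A r t) (?Y (Suc n) r t) - pr (A r t) (?Y n r t))"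
    by (rule integral_diff[symmetric]) (intro integrable_continuous_interval c)+
  also have "\<dots> = integral {0..s} (\<lambda>r. pr (A r t) (?Y (Suc n) r t - ?Y n r t))"
    by (simp only: bounded_bilinear.diff_right[OF pr])
  finally have eq: "?Y (Suc (Suc n)) s t - ?Y (Suc n) s t
      = integral {0..s} (\<lambda>r. pr (A r t) (?Y (Suc n) r t - ?Y n r t))" .
  let ?G = "\<lambda>r. norm y0 * ((K * r) ^ Suc (Suc n) / fact (Suc (Suc n)))"
  let ?g = "\<lambda>r. K * (norm y0 * ((K * r) ^ Suc n / fact (Suc n)))"
  have G: "(?g has_integral ?G s - ?G 0) {0..s}"
  proof (rule fundamental_theorem_of_calculus)
    fix r assume "r \<in> {0..s}"
    have "(?G has_real_derivative
        norm y0 * (real (Suc (Suc n)) * (K * r) ^ Suc n * K / fact (Suc (Suc n)))) (at r within {0..s})"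
      by (auto intro!: derivative_eq_intros simp del: fact_Suc power_Suc)
    moreover have "norm y0 * (real (Suc (Suc n)) * (K * r) ^ Suc n * K / fact (Suc (Suc n))) = ?g r"
      unfolding fact_Suc[of "Suc n"] by (simp add: field_simps del: of_nat_Suc fact_Suc power_Suc)
    ultimately have "(?G has_real_derivative ?g r) (at r within {0..s})"
      by (simp only:)
    then show "(?G has_vector_derivative ?g r) (at r within {0..s})"
      by (simp only: has_real_derivative_iff_has_vector_derivative)
  qed (use Suc.prems in auto)
  have "norm (integral {0..s} (\<lambda>r. pr (A r t) (?Y (Suc n) r t - ?Y n r t))) \<le> integral {0..s} ?g"
  proof (rule integral_norm_bound_integral)
    show "(\<lambda>r. pr (A r t) (?Y (Suc n) r t - ?Y n r t)) integrable_on {0..s}"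
      by (intro integrable_continuous_interval bounded_bilinear.continuous_on[OF pr At] continuous_on_diff Yt)
    show "?g integrable_on {0..s}" using G by blast
    fix r assume r: "r \<in> {0..s}"
    with Suc.prems have "r \<in> {0..l}" by auto
    have "norm (pr (A r t) (?Y (Suc n) r t - ?Y n r t)) \<le> K * norm (?Y (Suc n) r t - ?Y n r t)"
      using K \<open>r \<in> {0..l}\<close> \<open>t \<in> T\<close> by blast
    also have "\<dots> \<le> ?g r"
      by (rule mult_left_mono[OF Suc.IH[OF \<open>r \<in> {0..l}\<close>] \<open>0 \<le> K\<close>])
    finally show "norm (pr (A r t) (?Y (Suc n) r t - ?Y n r t)) \<le> ?g r" .
  qed
  also have "\<dots> = ?G s - ?G 0" using G by (rule integral_unique)
  also have "\<dots> = ?G s" by simp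
  finally show ?case unfolding eq .
qed

lemma picard_uniform_limit:
  fixes A :: "real \<Rightarrow> 'p::topological_space \<Rightarrow> 'm::real_normed_vector" and y0 :: "'e::banach"
  assumes pr: "bounded_bilinear pr" and T: "compact T"
    and A: "continuous_on ({0..l} \<times> T) (\<lambda>(s, t). A s t)"
  shows "\<exists>y. uniform_limit ({0..l} \<times> T) (\<lambda>n (s, t). picard pr A y0 n s t) (\<lambda>(s, t). y s t) sequentially"
proof -
  let ?Y = "picard pr A y0"
  have "compact ((\<lambda>(s, t). A s t) ` ({0..l} \<times> T))"
    by (intro compact_continuous_image A compact_Times T compact_Icc)
  then obtain C where C: "\<And>s t. s \<in> {0..l} \<Longrightarrow> t \<in> T \<Longrightarrow> norm (A s t) \<le> C" and "C > 0"
    by (force dest!: compact_imp_bounded simp: bounded_pos)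
  obtain D where D: "\<And>a b. norm (pr a b) \<le> norm a * norm b * D" and "D > 0"
    using bounded_bilinear.pos_bounded[OF pr] by blast
  define K where "K = C * D"
  have "0 \<le> K" using \<open>C > 0\<close> \<open>D > 0\<close> by (simp add: K_def)
  have K: "norm (pr (A s t) y) \<le> K * norm y" if "s \<in> {0..l}" "t \<in> T" for s t y
  proof -
    have "norm (pr (A s t) y) \<le> norm (A s t) * norm y * D" by (rule D)
    also have "\<dots> \<le> C * norm y * D"
      using C[OF that] \<open>D > 0\<close> by (intro mult_right_mono) auto
    finally show ?thesis by (simp add: K_def mult_ac)
  qed
  let ?M = "\<lambda>n. norm y0 * ((K * l) ^ Suc n / fact (Suc n))"
  let ?f = "\<lambda>n (s, t). ?Y (Suc n) s t - ?Y n s t"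
  have "uniform_limit ({0..l} \<times> T) (\<lambda>n x. \<Sum>i<n. ?f i x) (\<lambda>x. suminf (\<lambda>i. ?f i x)) sequentially"
  proof (rule Weierstrass_m_test)
    fix n x assume x: "x \<in> {0..l} \<times> T"
    then obtain s t where st: "x = (s, t)" "s \<in> {0..l}" "t \<in> T" by auto
    have "norm (?f n x) \<le> norm y0 * ((K * s) ^ Suc n / fact (Suc n))"
      using picard_step_bound[OF pr A K \<open>0 \<le> K\<close> st(2,3), of y0 n] st(1) by simp
    also have "\<dots> \<le> ?M n"
      using st \<open>0 \<le> K\<close>
      by (intro mult_left_mono divide_right_mono power_mono) auto
    finally show "norm (?f n x) \<le> ?M n" .
  next
    have "summable (\<lambda>n. (K * l) ^ n / fact n)"
      using summable_exp_generic[of "K * l"] by (simp add: divide_inverse mult.commute)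
    then show "summable ?M" by (intro summable_mult) (subst summable_Suc_iff)
  qed
  then have "uniform_limit ({0..l} \<times> T) (\<lambda>n x. y0 + (\<Sum>i<n. ?f i x)) (\<lambda>x. y0 + suminf (\<lambda>i. ?f i x)) sequentially"
    by (intro uniform_limit_add uniform_limit_const)
  moreover have "y0 + (\<Sum>i<n. ?f i x) = (case x of (s, t) \<Rightarrow> ?Y n s t)" for n x
    by (cases x, simp only: prod.case, subst sum_lessThan_telescope) simp
  ultimately have "uniform_limit ({0..l} \<times> T) (\<lambda>n (s, t). ?Y n s t)
      (\<lambda>(s, t). y0 + suminf (\<lambda>i. ?f i (s, t))) sequentially"
    by (simp only: case_prod_unfold fst_conv snd_conv)
  then show ?thesis by (intro exI[of _ "\<lambda>s t. y0 + suminf (\<lambda>i. ?f i (s, t))"])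
qed

lemma picard_limit_solves:
  fixes A :: "real \<Rightarrow> 'p::topological_space \<Rightarrow> 'm::real_normed_vector" and y0 :: "'e::banach"
  assumes pr: "bounded_bilinear pr" and T: "compact T"
    and A: "continuous_on ({0..l} \<times> T) (\<lambda>(s, t). A s t)" and l: "0 \<le> l"
    and lim: "uniform_limit ({0..l} \<times> T) (\<lambda>n (s, t). picard pr A y0 n s t) (\<lambda>(s, t). y s t) sequentially"
  shows "continuous_on ({0..l} \<times> T) (\<lambda>(s, t). y s t)"
    and "t \<in> T \<Longrightarrow> y 0 t = y0"
    and "t \<in> T \<Longrightarrow> s \<in> {0..l} \<Longrightarrow>
      ((\<lambda>s. y s t) has_vector_derivative pr (A s t) (y s t)) (at s within {0..l})"
proof -
  let ?Y = "picard pr A y0"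
  show c: "continuous_on ({0..l} \<times> T) (\<lambda>(s, t). y s t)"
    by (rule uniform_limit_theorem[OF _ lim])
      (use continuous_on_picard[OF pr A] in \<open>auto intro: always_eventually\<close>)
  have pt: "(\<lambda>n. ?Y n s t) \<longlonglongrightarrow> y s t" if "s \<in> {0..l}" "t \<in> T" for s t
    using tendsto_uniform_limitI[OF lim, of "(s, t)"] that by simp
  have int: "y s t = y0 + integral {0..s} (\<lambda>r. pr (A r t) (y r t))" if s: "s \<in> {0..l}" and t: "t \<in> T" for s t
  proof -
    have At: "continuous_on {0..s} (\<lambda>r. A r t)"
      using continuous_on_subset[OF continuous_on_section1[OF A t]] s by auto
    have Yt: "continuous_on {0..s} (\<lambda>r. ?Y k r t)" for k
      using continuous_on_subset[OF continuous_on_section1[OF continuous_on_picard[OF pr A] t]]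
        s by auto
    have yt: "continuous_on {0..s} (\<lambda>r. y r t)"
      using continuous_on_subset[OF continuous_on_section1[OF c t]] s by auto
    have "uniform_limit {0..s} (\<lambda>n r. ?Y n r t) (\<lambda>r. y r t) sequentially"
      using uniform_limit_compose'[OF lim, of "\<lambda>r. (r, t)" "{0..s}"] s t by auto
    then have ul: "uniform_limit (cbox 0 s) (\<lambda>n r. pr (A r t) (?Y n r t)) (\<lambda>r. pr (A r t) (y r t)) sequentially"
      by (intro bounded_bilinear.bounded_uniform_limit[OF pr] uniform_limit_const)
        (use At yt in \<open>auto intro!: compact_imp_bounded compact_continuous_image\<close>)
    obtain I J where I: "\<And>n. ((\<lambda>r. pr (A r t) (?Y n r t)) has_integral I n) (cbox 0 s)"
      and J: "((\<lambda>r. pr (A r t) (y r t)) has_integral J) (cbox 0 s)" and IJ: "I \<longlonglongrightarrow> J"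
      by (rule uniform_limit_integral_cbox[OF ul])
        (use bounded_bilinear.continuous_on[OF pr At Yt] in auto)
    have "I n = ?Y (Suc n) s t - y0" for n
      using I[of n] by (simp add: integral_unique)
    then have "(\<lambda>n. ?Y (Suc n) s t) \<longlonglongrightarrow> y0 + J"
      using tendsto_add[OF tendsto_const[of y0] IJ] by simp
    moreover have "(\<lambda>n. ?Y (Suc n) s t) \<longlonglongrightarrow> y s t"
      using LIMSEQ_Suc[OF pt[OF s t]] .
    ultimately show ?thesis using LIMSEQ_unique J by (metis cbox_interval integral_unique)
  qed
  show "y 0 t = y0" if "t \<in> T" using int[of 0 t] that l by simp
  show "((\<lambda>s. y s t) has_vector_derivative pr (A s t) (y s t)) (at s within {0..l})"
    if t: "t \<in> T" and s: "s \<in> {0..l}"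
  proof -
    have "continuous_on {0..l} (\<lambda>r. pr (A r t) (y r t))"
      by (rule bounded_bilinear.continuous_on[OF pr continuous_on_section1[OF A t] continuous_on_section1[OF c t]])
    from integral_has_vector_derivative[OF this s]
    have "((\<lambda>s. y0 + integral {0..s} (\<lambda>r. pr (A r t) (y r t))) has_vector_derivative pr (A s t) (y s t)) (at s within {0..l})"
      by (auto intro!: derivative_eq_intros)
    then show ?thesis
      by (rule has_vector_derivative_transform[OF s, rotated]) (use int t in auto)
  qed
qed


text \<open>The product of the tangent bundle, that is, multiplication in dual numbers: if \<open>A'\<close> and \<open>w\<close> are the
\<open>t\<close>-derivatives of \<open>A\<close> and \<open>y\<close>, the second component is the \<open>t\<close>-derivative of \<open>pr A y\<close>. The equation
for \<open>(y, w)\<close> is therefore again linear, with coefficient \<open>(A, A')\<close>.\<close>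

lemma bounded_bilinear_tangent:
  fixes pr :: "'m::real_normed_vector \<Rightarrow> 'e::real_normed_vector \<Rightarrow> 'e"
  assumes "bounded_bilinear pr"
  shows "bounded_bilinear (\<lambda>p q. (pr (fst p) (fst q), pr (snd p) (fst q) + pr (fst p) (snd q)))"
proof -
  interpret pr: bounded_bilinear pr by fact
  obtain D where D: "\<And>a b. norm (pr a b) \<le> norm a * norm b * D" and "D > 0"
    using pr.pos_bounded by blast
  show ?thesis
  proof
    show "\<exists>K. \<forall>a b. norm (pr (fst a) (fst b), pr (snd a) (fst b) + pr (fst a) (snd b))
        \<le> norm a * norm b * K"
    proof (intro exI[of _ "3 * D"] allI)
      fix a :: "'m \<times> 'm" and b :: "'e \<times> 'e"
      have n: "norm (pr u v) \<le> norm a * norm b * D" if "norm u \<le> norm a" "norm v \<le> norm b" for u v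
      proof -
        have "norm u * norm v * D \<le> norm a * norm b * D"
          using that \<open>D > 0\<close> by (intro mult_right_mono mult_mono) auto
        with D[of u v] show ?thesis by (rule order_trans)
      qed
      have "norm (pr (fst a) (fst b), pr (snd a) (fst b) + pr (fst a) (snd b))
          \<le> norm (pr (fst a) (fst b)) + (norm (pr (snd a) (fst b)) + norm (pr (fst a) (snd b)))"
        by (rule order_trans[OF norm_Pair_le add_left_mono[OF norm_triangle_ineq]])
      also have "\<dots> \<le> norm a * norm b * D + (norm a * norm b * D + norm a * norm b * D)"
        by (intro add_mono n) (metis norm_fst_le norm_snd_le prod.collapse)+
      finally show "norm (pr (fst a) (fst b), pr (snd a) (fst b) + pr (fst a) (snd b))
        \<le> norm a * norm b * (3 * D)" by (simp add: algebra_simps)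
    qed
  qed (auto simp: pr.add_left pr.add_right pr.scaleR_left pr.scaleR_right scaleR_add_right)
qed

text \<open>The Picard iterates of the tangent equation are pairs of an iterate of the original equation and its
\<open>t\<close>-derivative. Both components converge uniformly, so differentiation passes to the limit.\<close>

proposition linear_ode_C1_in_parameter:
  fixes A A' :: "real \<Rightarrow> real \<Rightarrow> 'm::real_normed_vector" and y0 :: "'e::banach"
  assumes pr: "bounded_bilinear pr" and l: "0 \<le> l"
    and A: "continuous_on ({0..l} \<times> {a..b}) (\<lambda>(s, t). A s t)"
    and A': "continuous_on ({0..l} \<times> {a..b}) (\<lambda>(s, t). A' s t)"
    and der: "\<And>s t. s \<in> {0..l} \<Longrightarrow> t \<in> {a..b} \<Longrightarrow>
      ((\<lambda>t. A s t) has_vector_derivative A' s t) (at t within {a..b})"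
  obtains y w where "continuous_on ({0..l} \<times> {a..b}) (\<lambda>(s, t). y s t)"
    and "continuous_on ({0..l} \<times> {a..b}) (\<lambda>(s, t). w s t)"
    and "\<And>t. t \<in> {a..b} \<Longrightarrow> y 0 t = y0" and "\<And>t. t \<in> {a..b} \<Longrightarrow> w 0 t = 0"
    and "\<And>s t. s \<in> {0..l} \<Longrightarrow> t \<in> {a..b} \<Longrightarrow>
      ((\<lambda>s. y s t) has_vector_derivative pr (A s t) (y s t)) (at s within {0..l})"
    and "\<And>s t. s \<in> {0..l} \<Longrightarrow> t \<in> {a..b} \<Longrightarrow>
      ((\<lambda>s. w s t) has_vector_derivative pr (A' s t) (y s t) + pr (A s t) (w s t)) (at s within {0..l})"
    and "\<And>s t. s \<in> {0..l} \<Longrightarrow> t \<in> {a..b} \<Longrightarrow>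
      ((\<lambda>t. y s t) has_vector_derivative w s t) (at t within {a..b})"
proof -
  let ?T = "{a..b}" and ?S = "{0..l}"
  define pr2 where "pr2 = (\<lambda>p q. (pr (fst p) (fst q), pr (snd p) (fst q) + pr (fst p) (snd q)))"
  define B where "B = (\<lambda>s t. (A s t, A' s t))"
  have pr2: "bounded_bilinear pr2"
    unfolding pr2_def by (rule bounded_bilinear_tangent[OF pr])
  have B: "continuous_on (?S \<times> ?T) (\<lambda>(s, t). B s t)"
    using continuous_on_Pair[OF A A'] by (simp add: B_def case_prod_unfold)
  define P where "P = picard pr2 B (y0, 0)"
  obtain z where z: "uniform_limit (?S \<times> ?T) (\<lambda>n (s, t). P n s t) (\<lambda>(s, t). z s t) sequentially"
    using picard_uniform_limit[OF pr2 compact_Icc B] unfolding P_def by blast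
  note sol = picard_limit_solves[OF pr2 compact_Icc B l z[unfolded P_def]]
  have P_cont: "continuous_on (?S \<times> ?T) (\<lambda>(s, t). P n s t)" for n
    unfolding P_def by (rule continuous_on_picard[OF pr2 B])
  have P_Suc: "fst (P (Suc n) s t) = y0 + integral {0..s} (\<lambda>r. pr (A r t) (fst (P n r t)))"
    "snd (P (Suc n) s t) = integral {0..s} (\<lambda>r. pr (A' r t) (fst (P n r t)) + pr (A r t) (snd (P n r t)))"
    if s: "s \<in> ?S" and t: "t \<in> ?T" for n s t
  proof -
    have "continuous_on {0..s} (\<lambda>r. pr2 (B r t) (P n r t))"
      using bounded_bilinear.continuous_on[OF pr2 continuous_on_section1[OF B t]
          continuous_on_section1[OF P_cont t]]
      by (rule continuous_on_subset) (use s in auto)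
    note i = integrable_continuous_interval[OF this]
    have "P (Suc n) s t = (y0, 0) + integral {0..s} (\<lambda>r. pr2 (B r t) (P n r t))"
      by (simp add: P_def)
    then show "fst (P (Suc n) s t) = y0 + integral {0..s} (\<lambda>r. pr (A r t) (fst (P n r t)))"
      "snd (P (Suc n) s t) = integral {0..s} (\<lambda>r. pr (A' r t) (fst (P n r t)) + pr (A r t) (snd (P n r t)))"
      using integral_linear[OF i bounded_linear_fst] integral_linear[OF i bounded_linear_snd]
      by (simp_all add: o_def pr2_def B_def)
  qed
  have P_der: "((\<lambda>t. fst (P n s t)) has_vector_derivative snd (P n s t)) (at t within ?T)"
    if "s \<in> ?S" "t \<in> ?T" for n s t
    using that
  proof (induction n arbitrary: s t)
    case 0
    then show ?case by (simp add: P_def)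
  next
    case (Suc n)
    let ?f = "\<lambda>t r. pr (A r t) (fst (P n r t))"
    let ?fx = "\<lambda>t r. pr (A r t) (snd (P n r t)) + pr (A' r t) (fst (P n r t))"
    have swap: "continuous_on (?T \<times> cbox 0 s) (\<lambda>(t, r). h r t)"
      if "continuous_on (?S \<times> ?T) (\<lambda>(r, t). h r t)" for h :: "real \<Rightarrow> real \<Rightarrow> 'c::topological_space"
    proof -
      have "continuous_on (?T \<times> cbox 0 s) (\<lambda>x. case (snd x, fst x) of (r, t) \<Rightarrow> h r t)"
        by (rule continuous_on_compose2[OF that]) (use Suc.prems in \<open>auto intro!: continuous_intros\<close>)
      then show ?thesis by (simp add: case_prod_unfold)
    qed
    have cP: "continuous_on (?S \<times> ?T) (\<lambda>(s, t). fst (P n s t))"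
      "continuous_on (?S \<times> ?T) (\<lambda>(s, t). snd (P n s t))"
      using continuous_on_fst[OF P_cont] continuous_on_snd[OF P_cont] by (simp_all add: case_prod_unfold)
    have f_cont: "continuous_on (?T \<times> cbox 0 s) (\<lambda>(t, r). ?f t r)"
      using bounded_bilinear.continuous_on[OF pr swap[OF A] swap[OF cP(1)]] by (simp add: case_prod_unfold)
    have fx_cont: "continuous_on (?T \<times> cbox 0 s) (\<lambda>(t, r). ?fx t r)"
      using continuous_on_add[OF bounded_bilinear.continuous_on[OF pr swap[OF A] swap[OF cP(2)]]
          bounded_bilinear.continuous_on[OF pr swap[OF A'] swap[OF cP(1)]]]
      by (simp add: case_prod_unfold)
    have "((\<lambda>t. integral (cbox 0 s) (?f t)) has_vector_derivative integral (cbox 0 s) (?fx t)) (at t within ?T)"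
    proof (rule leibniz_rule_vector_derivative[OF _ _ fx_cont Suc.prems(2)])
      fix t r assume "t \<in> ?T" "r \<in> cbox 0 s"
      with Suc.prems have "r \<in> ?S" by auto
      from bounded_bilinear.has_vector_derivative[OF pr der[OF this \<open>t \<in> ?T\<close>] Suc.IH[OF this \<open>t \<in> ?T\<close>]]
      show "((\<lambda>t. ?f t r) has_vector_derivative ?fx t r) (at t within ?T)" .
    next
      fix t assume "t \<in> ?T"
      show "?f t integrable_on cbox 0 s"
        by (rule integrable_continuous[OF continuous_on_section2[OF f_cont \<open>t \<in> ?T\<close>]])
    qed simp
    then have "((\<lambda>t. y0 + integral {0..s} (?f t)) has_vector_derivative integral {0..s} (?fx t)) (at t within ?T)"
      by (auto intro!: derivative_eq_intros)
    moreover have "integral {0..s} (?fx t) = snd (P (Suc n) s t)"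
      using P_Suc(2)[OF Suc.prems] by (simp add: add.commute)
    ultimately have "((\<lambda>t. y0 + integral {0..s} (?f t)) has_vector_derivative snd (P (Suc n) s t)) (at t within ?T)"
      by simp
    then show ?case
      by (rule has_vector_derivative_transform[OF Suc.prems(2), rotated])
        (use P_Suc(1)[OF Suc.prems(1)] in simp)
  qed
  show ?thesis
  proof (rule that[of "\<lambda>s t. fst (z s t)" "\<lambda>s t. snd (z s t)"])
    show "continuous_on (?S \<times> ?T) (\<lambda>(s, t). fst (z s t))"
      "continuous_on (?S \<times> ?T) (\<lambda>(s, t). snd (z s t))"
      using continuous_on_fst[OF sol(1)] continuous_on_snd[OF sol(1)] by (simp_all add: case_prod_unfold)
    show "fst (z 0 t) = y0" "snd (z 0 t) = 0" if "t \<in> ?T" for t using sol(2)[OF that] by simp_all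
    fix s t assume st: "s \<in> ?S" "t \<in> ?T"
    have d: "((\<lambda>s. z s t) has_derivative (\<lambda>x. x *\<^sub>R pr2 (B s t) (z s t))) (at s within ?S)"
      using sol(3)[OF st(2,1)] by (simp add: has_vector_derivative_def)
    show "((\<lambda>s. fst (z s t)) has_vector_derivative pr (A s t) (fst (z s t))) (at s within ?S)"
      using has_derivative_fst[OF d] by (simp add: has_vector_derivative_def pr2_def B_def)
    show "((\<lambda>s. snd (z s t)) has_vector_derivative
        pr (A' s t) (fst (z s t)) + pr (A s t) (snd (z s t))) (at s within ?S)"
      using has_derivative_snd[OF d] by (simp add: has_vector_derivative_def pr2_def B_def)
    have lim: "(\<lambda>n. P n s t) \<longlonglongrightarrow> z s t" if "t \<in> ?T" for t
      using tendsto_uniform_limitI[OF z, of "(s, t)"] st that by simp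
    have "\<exists>g. \<forall>t\<in>?T. (\<lambda>n. fst (P n s t)) \<longlonglongrightarrow> g t \<and>
        (g has_derivative (\<lambda>h. h *\<^sub>R snd (z s t))) (at t within ?T)"
    proof (rule has_derivative_sequence[of ?T _ "\<lambda>n t h. h *\<^sub>R snd (P n s t)"])
      show "((\<lambda>t. fst (P n s t)) has_derivative (\<lambda>h. h *\<^sub>R snd (P n s t))) (at t within ?T)"
        if "t \<in> ?T" for n t
        using P_der[OF st(1) that] by (simp add: has_vector_derivative_def)
      fix e :: real assume "e > 0"
      from uniform_limitD[OF z this]
      have "\<forall>\<^sub>F n in sequentially. \<forall>t\<in>?T. dist (P n s t) (z s t) < e"
        by (rule eventually_mono) (use st in auto)
      then show "\<forall>\<^sub>F n in sequentially. \<forall>t\<in>?T. \<forall>h.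
          norm (h *\<^sub>R snd (P n s t) - h *\<^sub>R snd (z s t)) \<le> e * norm h"
      proof (rule eventually_mono, intro ballI allI)
        fix n t and h :: real assume "\<forall>t\<in>?T. dist (P n s t) (z s t) < e" "t \<in> ?T"
        then have "norm (snd (P n s t) - snd (z s t)) \<le> e"
          by (metis dist_norm dist_snd_le less_imp_le order_trans)
        then have "\<bar>h\<bar> * norm (snd (P n s t) - snd (z s t)) \<le> \<bar>h\<bar> * e"
          by (rule mult_left_mono) simp
        then show "norm (h *\<^sub>R snd (P n s t) - h *\<^sub>R snd (z s t)) \<le> e * norm h"
          by (simp add: scaleR_diff_right[symmetric] mult.commute)
      qed
    next
      show "(\<lambda>n. fst (P n s t)) \<longlonglongrightarrow> fst (z s t)" by (intro tendsto_fst lim st)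
    qed (use st in auto)
    then obtain g where g: "\<And>t. t \<in> ?T \<Longrightarrow> (\<lambda>n. fst (P n s t)) \<longlonglongrightarrow> g t"
      "\<And>t. t \<in> ?T \<Longrightarrow> (g has_derivative (\<lambda>h. h *\<^sub>R snd (z s t))) (at t within ?T)" by blast
    have eq: "fst (z s t) = g t" if "t \<in> ?T" for t
      using LIMSEQ_unique[OF tendsto_fst[OF lim[OF that]] g(1)[OF that]] .
    have "(g has_vector_derivative snd (z s t)) (at t within ?T)"
      using g(2)[OF st(2)] by (simp add: has_vector_derivative_def)
    then show "((\<lambda>t. fst (z s t)) has_vector_derivative snd (z s t)) (at t within ?T)"
      by (rule has_vector_derivative_transform[OF st(2), rotated]) (use eq in auto)
  qed
qed

section \<open>Families of linear maps\<close>

lemma linear_basis_expansion: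
  fixes f :: "'a::euclidean_space \<Rightarrow> 'b::real_vector"
  assumes "linear f"
  shows "f v = (\<Sum>b\<in>Basis. (v \<bullet> b) *\<^sub>R f b)"
proof -
  have "f v = f (\<Sum>b\<in>Basis. (v \<bullet> b) *\<^sub>R b)" by (simp add: euclidean_representation)
  also have "\<dots> = (\<Sum>b\<in>Basis. (v \<bullet> b) *\<^sub>R f b)"
    using assms by (simp add: linear_sum linear_scale)
  finally show ?thesis .
qed

lemma continuous_on_linear_family:
  fixes L :: "'x::topological_space \<Rightarrow> 'a::euclidean_space \<Rightarrow> 'b::real_normed_vector"
  assumes "\<And>x. x \<in> S \<Longrightarrow> linear (L x)" "\<And>u. continuous_on S (\<lambda>x. L x u)" "continuous_on S V"
  shows "continuous_on S (\<lambda>x. L x (V x))"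
proof -
  have "continuous_on S (\<lambda>x. \<Sum>b\<in>Basis. (V x \<bullet> b) *\<^sub>R L x b)"
    by (intro continuous_intros assms)
  then show ?thesis
    by (rule continuous_on_eq) (rule linear_basis_expansion[symmetric, OF assms(1)])
qed

lemma has_derivative_linear_family:
  fixes L :: "'x::real_normed_vector \<Rightarrow> 'a::euclidean_space \<Rightarrow> 'b::real_normed_vector"
  assumes L: "\<And>y. y \<in> S \<Longrightarrow> linear (L y)" and x: "x \<in> S"
    and L': "\<And>u. ((\<lambda>y. L y u) has_derivative L' u) (at x within S)"
    and lin: "\<And>h. linear (\<lambda>u. L' u h)"
    and V: "(V has_derivative V') (at x within S)"
  shows "((\<lambda>y. L y (V y)) has_derivative (\<lambda>h. L' (V x) h + L x (V' h))) (at x within S)"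
proof -
  have "((\<lambda>y. \<Sum>b\<in>Basis. (V y \<bullet> b) *\<^sub>R L y b) has_derivative
      (\<lambda>h. \<Sum>b\<in>Basis. (V x \<bullet> b) *\<^sub>R L' b h + (V' h \<bullet> b) *\<^sub>R L x b)) (at x within S)"
    by (intro has_derivative_sum has_derivative_scaleR has_derivative_inner_left V L')
  moreover have "(\<lambda>h. \<Sum>b\<in>Basis. (V x \<bullet> b) *\<^sub>R L' b h + (V' h \<bullet> b) *\<^sub>R L x b)
      = (\<lambda>h. L' (V x) h + L x (V' h))"
    by (simp add: sum.distrib linear_basis_expansion[OF lin, of "V x"] 
        linear_basis_expansion[OF L[OF x], symmetric])
  ultimately have "((\<lambda>y. \<Sum>b\<in>Basis. (V y \<bullet> b) *\<^sub>R L y b) has_derivative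
      (\<lambda>h. L' (V x) h + L x (V' h))) (at x within S)" by simp
  then show ?thesis
    by (rule has_derivative_transform[OF x, rotated]) (rule linear_basis_expansion[OF L])
qed

lemma dir_deriv_eq:
  assumes "(f has_derivative f') (at x)"
  shows "dir_deriv f x u = f' u"
  using frechet_derivative_at[OF assms] by simp

lemma linear_dir_deriv:
  assumes "f differentiable (at x)"
  shows "linear (dir_deriv f x)"
  using assms by (rule linear_frechet_derivative)

text \<open>Linearity in \<open>u\<close> holds at all points near \<open>x\<close>, so it may be differentiated in \<open>y\<close>.\<close>

lemma linear_dir_deriv_family:
  fixes L :: "'x::real_normed_vector \<Rightarrow> 'a::real_vector \<Rightarrow> 'b::real_normed_vector"
  assumes S: "open S" "x \<in> S" and L: "\<And>y. y \<in> S \<Longrightarrow> linear (L y)"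
    and d: "\<And>u. (\<lambda>y. L y u) differentiable (at x)"
  shows "linear (\<lambda>u. dir_deriv (\<lambda>y. L y u) x h)"
proof (rule linearI)
  note D = frechet_derivative_works[THEN iffD1, OF d]
  fix u v r
  have "((\<lambda>y. L y (u + v)) has_derivative (\<lambda>h. dir_deriv (\<lambda>y. L y u) x h + dir_deriv (\<lambda>y. L y v) x h)) (at x)"
    by (rule has_derivative_transform_within_open[OF has_derivative_add[OF D D] S])
      (simp add: L linear_add)
  then show "dir_deriv (\<lambda>y. L y (u + v)) x h = dir_deriv (\<lambda>y. L y u) x h + dir_deriv (\<lambda>y. L y v) x h"
    by (rule dir_deriv_eq)
  have "((\<lambda>y. L y (r *\<^sub>R u)) has_derivative (\<lambda>h. r *\<^sub>R dir_deriv (\<lambda>y. L y u) x h)) (at x)"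
    by (rule has_derivative_transform_within_open[OF has_derivative_scaleR_right[OF D] S])
      (simp add: L linear_scale)
  then show "dir_deriv (\<lambda>y. L y (r *\<^sub>R u)) x h = r *\<^sub>R dir_deriv (\<lambda>y. L y u) x h"
    by (rule dir_deriv_eq)
qed

section \<open>Smooth maps and charts\<close>

lemma smooth_onD:
  assumes "smooth_on f S"
  shows "continuous_on S f" "\<And>x. x \<in> S \<Longrightarrow> f differentiable (at x)"
    "\<And>u. smooth_on (\<lambda>x. dir_deriv f x u) S"
proof -
  have k: "Ck_on k f S" for k using assms by (simp add: smooth_on_def)
  show "continuous_on S f" using k[of 0] by simp
  show "f differentiable (at x)" if "x \<in> S" for x using k[of 1] that by simp
  show "smooth_on (\<lambda>x. dir_deriv f x u) S" for u
    unfolding smooth_on_def using k[of "Suc j" for j] by simp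
qed

locale atlas =
  fixes A :: "('a::topological_space, 'n::finite) chart set"
  assumes smooth_atlas: "smooth_atlas A"
begin

definition point :: "('a, 'n) chart \<Rightarrow> real ^ 'n \<Rightarrow> 'a" where
  "point c = inv_into (fst c) (snd c)"

lemma covered: "\<exists>c\<in>A. p \<in> fst c"
  using smooth_atlas unfolding smooth_atlas_def by blast

lemma open_chart: "c \<in> A \<Longrightarrow> open (fst c)" and open_codom: "c \<in> A \<Longrightarrow> open (codom c)"
  and homeo: "c \<in> A \<Longrightarrow> homeomorphism (fst c) (codom c) (snd c) (point c)"
  and smooth_transition: "c \<in> A \<Longrightarrow> d \<in> A \<Longrightarrow> smooth_on (transition c d) (overlap c d)"
  using smooth_atlas unfolding smooth_atlas_def point_def by blast+

lemma chart_point: "c \<in> A \<Longrightarrow> x \<in> codom c \<Longrightarrow> snd c (point c x) = x"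
  and point_chart: "c \<in> A \<Longrightarrow> p \<in> fst c \<Longrightarrow> point c (snd c p) = p"
  and point_in: "c \<in> A \<Longrightarrow> x \<in> codom c \<Longrightarrow> point c x \<in> fst c"
  and chart_in: "p \<in> fst c \<Longrightarrow> snd c p \<in> codom c"
  using homeo unfolding homeomorphism_def codom_def by blast+

lemma overlap_iff: "c \<in> A \<Longrightarrow> x \<in> overlap c d \<longleftrightarrow> x \<in> codom c \<and> point c x \<in> fst d"
  unfolding overlap_def codom_def using point_chart by fastforce

lemma overlap_chart: "p \<in> fst c \<Longrightarrow> p \<in> fst d \<Longrightarrow> snd c p \<in> overlap c d"
  by (auto simp: overlap_def)

lemma continuous_on_point: "c \<in> A \<Longrightarrow> continuous_on (codom c) (point c)"
  using homeo by (auto simp: homeomorphism_def)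

lemma open_overlap:
  assumes "c \<in> A" "d \<in> A" shows "open (overlap c d)"
proof -
  have "overlap c d = codom c \<inter> point c -` fst d"
    using overlap_iff[OF assms(1)] by blast
  moreover have "open (codom c \<inter> point c -` fst d)"
    by (rule continuous_open_preimage[OF continuous_on_point open_codom open_chart]) fact+
  ultimately show ?thesis by simp
qed

lemma transition_eq: "transition c d x = snd d (point c x)"
  by (simp add: transition_def point_def)

lemma transition_chart: "c \<in> A \<Longrightarrow> p \<in> fst c \<Longrightarrow> transition c d (snd c p) = snd d p"
  by (simp add: transition_eq point_chart)

lemma differentiable_transition:
  "c \<in> A \<Longrightarrow> d \<in> A \<Longrightarrow> x \<in> overlap c d \<Longrightarrow> transition c d differentiable (at x)"
  using smooth_onD(2)[OF smooth_transition] .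

text \<open>The chain rule for \<open>transition c e = transition d e \<circ> transition c d\<close>, valid near the coordinate of \<open>p\<close>.\<close>

lemma transition_cocycle:
  assumes c: "c \<in> A" and d: "d \<in> A" and e: "e \<in> A"
    and p: "p \<in> fst c" "p \<in> fst d" "p \<in> fst e"
  shows "dir_deriv (transition c e) (snd c p) v =
    dir_deriv (transition d e) (snd d p) (dir_deriv (transition c d) (snd c p) v)"
proof -
  let ?x = "snd c p"
  have x: "?x \<in> overlap c d \<inter> overlap c e" using p by (auto simp: overlap_def)
  have D: "(transition c d has_derivative dir_deriv (transition c d) ?x) (at ?x)"
    using differentiable_transition[OF c d] x frechet_derivative_works by blast
  have E: "(transition d e has_derivative dir_deriv (transition d e) (snd d p)) (at (transition c d ?x))"
    using differentiable_transition[OF d e overlap_chart] p frechet_derivative_works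
    by (metis c transition_chart)
  have "(transition c e has_derivative (dir_deriv (transition d e) (snd d p) \<circ> dir_deriv (transition c d) ?x)) (at ?x)"
  proof (rule has_derivative_transform_within_open[OF diff_chain_at[OF D E] _ x])
    show "open (overlap c d \<inter> overlap c e)" by (intro open_Int open_overlap c d e)
    fix y assume "y \<in> overlap c d \<inter> overlap c e"
    then have "point c y \<in> fst d" using overlap_iff[OF c] by blast
    then show "(transition d e \<circ> transition c d) y = transition c e y"
      by (simp add: transition_eq point_chart[OF d])
  qed
  then show ?thesis by (simp add: dir_deriv_eq)
qed

lemma dir_deriv_transition_self:
  assumes c: "c \<in> A" and p: "p \<in> fst c"
  shows "dir_deriv (transition c c) (snd c p) v = v"
proof (rule dir_deriv_eq[of _ "\<lambda>v. v"])
  show "(transition c c has_derivative (\<lambda>v. v)) (at (snd c p))"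
    by (rule has_derivative_transform_within_open[OF has_derivative_ident open_codom[OF c] chart_in[OF p]])
      (simp add: transition_eq chart_point[OF c])
qed

end

section \<open>Paths\<close>

text \<open>Paths on arbitrary parameter intervals, so that pieces can be rescaled, reversed and glued; on
\<open>[0, 1]\<close> this is \<open>piecewise_C1_path\<close>.\<close>

definition pw_C1_on :: "('a::topological_space, 'n::finite) chart set \<Rightarrow> (real \<Rightarrow> 'a) \<Rightarrow>
    real \<Rightarrow> real \<Rightarrow> bool" where
  "pw_C1_on A \<gamma> a b \<longleftrightarrow>
     (\<exists>F. finite F \<and> {a, b} \<subseteq> F \<and> F \<subseteq> {a..b} \<and>
        (\<forall>x\<in>F. \<forall>y\<in>F. x < y \<and> F \<inter> {x<..<y} = {} \<longrightarrow> C1_path_on A \<gamma> x y))"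

text \<open>A parallel field along \<open>\<gamma>\<close>, in a form that survives reparametrisation: it demands a velocity \<open>D\<close> of the
path off the exceptional set, where \<open>parallel_along\<close> takes the value of \<open>vector_derivative\<close>, whether or
not the path is differentiable.\<close>

definition transports_on :: "('a::topological_space, 'n::finite) chart set \<Rightarrow> ('a, 'n) conn \<Rightarrow>
    (real \<Rightarrow> 'a) \<Rightarrow> (('a, 'n) chart \<Rightarrow> real \<Rightarrow> real ^ 'n) \<Rightarrow> real \<Rightarrow> real \<Rightarrow> bool" where
  "transports_on A \<Gamma> \<gamma> V a b \<longleftrightarrow>
     (\<forall>e\<in>A. \<forall>f\<in>A. \<forall>t\<in>{a..b}. \<gamma> t \<in> fst e \<inter> fst f \<longrightarrow>
        V f t = dir_deriv (transition e f) (snd e (\<gamma> t)) (V e t)) \<and>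
     (\<forall>e\<in>A. continuous_on {t \<in> {a..b}. \<gamma> t \<in> fst e} (V e)) \<and>
     (\<exists>F. finite F \<and> (\<forall>e\<in>A. \<forall>t\<in>{a<..<b} - F. \<gamma> t \<in> fst e \<longrightarrow>
        (\<exists>D. (snd e \<circ> \<gamma> has_vector_derivative D) (at t) \<and>
           (V e has_vector_derivative - \<Gamma> e (snd e (\<gamma> t)) D (V e t)) (at t))))"

lemma C1_path_on_cong:
  assumes "C1_path_on A \<gamma> a b" "\<And>t. t \<in> {a..b} \<Longrightarrow> \<gamma>' t = \<gamma> t"
  shows "C1_path_on A \<gamma>' a b"
  unfolding C1_path_on_def
proof (intro conjI ballI)
  show "continuous_on {a..b} \<gamma>'"
    using assms(1) unfolding C1_path_on_def by (auto intro: continuous_on_eq assms(2)[symmetric])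
  fix c assume "c \<in> A"
  then obtain D where D: "continuous_on {t \<in> {a..b}. \<gamma> t \<in> fst c} D"
    "\<And>t. t \<in> {a..b} \<Longrightarrow> \<gamma> t \<in> fst c \<Longrightarrow> ((snd c \<circ> \<gamma>) has_vector_derivative D t) (at t within {a..b})"
    using assms(1) unfolding C1_path_on_def by blast
  have "{t \<in> {a..b}. \<gamma>' t \<in> fst c} = {t \<in> {a..b}. \<gamma> t \<in> fst c}" using assms(2) by auto
  moreover have "((snd c \<circ> \<gamma>') has_vector_derivative D t) (at t within {a..b})"
    if "t \<in> {a..b}" "\<gamma>' t \<in> fst c" for t
    by (rule has_vector_derivative_transform[OF that(1) _ D(2)]) (use that assms(2) in auto)
  ultimately show "\<exists>D. continuous_on {t \<in> {a..b}. \<gamma>' t \<in> fst c} D \<and>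
      (\<forall>t\<in>{a..b}. \<gamma>' t \<in> fst c \<longrightarrow> ((snd c \<circ> \<gamma>') has_vector_derivative D t) (at t within {a..b}))"
    using D(1) by (intro exI[of _ D]) auto
qed

lemma has_vector_derivative_affine:
  assumes "(f has_vector_derivative D) (at (m * t + k) within S)" "(\<lambda>t. m * t + k) ` T \<subseteq> S"
  shows "((\<lambda>t. f (m * t + k)) has_vector_derivative m *\<^sub>R D) (at t within T)"
proof -
  have "((\<lambda>t. m * t + k) has_vector_derivative m) (at t within T)"
    by (auto intro!: derivative_eq_intros simp: has_real_derivative_iff_has_vector_derivative[symmetric])
  from vector_diff_chain_within[OF this has_vector_derivative_within_subset[OF assms]]
  show ?thesis by (simp add: o_def)
qed

lemma C1_path_on_affine:
  assumes "C1_path_on A \<gamma> a b" and sub: "\<And>t. t \<in> {a'..b'} \<Longrightarrow> m * t + k \<in> {a..b}"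
  shows "C1_path_on A (\<lambda>t. \<gamma> (m * t + k)) a' b'"
  unfolding C1_path_on_def
proof (intro conjI ballI)
  have "continuous_on {a..b} \<gamma>" using assms(1) by (simp add: C1_path_on_def)
  then show "continuous_on {a'..b'} (\<lambda>t. \<gamma> (m * t + k))"
    by (rule continuous_on_compose2) (use sub in \<open>auto intro!: continuous_intros\<close>)
  fix c assume "c \<in> A"
  then obtain D where D: "continuous_on {t \<in> {a..b}. \<gamma> t \<in> fst c} D"
    "\<And>t. t \<in> {a..b} \<Longrightarrow> \<gamma> t \<in> fst c \<Longrightarrow> ((snd c \<circ> \<gamma>) has_vector_derivative D t) (at t within {a..b})"
    using assms(1) unfolding C1_path_on_def by blast
  show "\<exists>D. continuous_on {t \<in> {a'..b'}. \<gamma> (m * t + k) \<in> fst c} D \<and>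
      (\<forall>t\<in>{a'..b'}. \<gamma> (m * t + k) \<in> fst c \<longrightarrow>
        ((snd c \<circ> (\<lambda>t. \<gamma> (m * t + k))) has_vector_derivative D t) (at t within {a'..b'}))"
  proof (intro exI[of _ "\<lambda>t. m *\<^sub>R D (m * t + k)"] conjI ballI impI)
    show "continuous_on {t \<in> {a'..b'}. \<gamma> (m * t + k) \<in> fst c} (\<lambda>t. m *\<^sub>R D (m * t + k))"
      by (intro continuous_intros continuous_on_compose2[OF D(1)]) (use sub in auto)
    fix t assume t: "t \<in> {a'..b'}" "\<gamma> (m * t + k) \<in> fst c"
    show "((snd c \<circ> (\<lambda>t. \<gamma> (m * t + k))) has_vector_derivative m *\<^sub>R D (m * t + k)) (at t within {a'..b'})"
      using has_vector_derivative_affine[OF D(2)[OF sub[OF t(1)] t(2)], of "{a'..b'}"] sub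
      by (simp add: o_def image_subset_iff)
  qed
qed

lemma pw_C1_onE:
  assumes "pw_C1_on A \<gamma> a b"
  obtains F where "finite F" "{a, b} \<subseteq> F" "F \<subseteq> {a..b}"
    "\<And>x y. x \<in> F \<Longrightarrow> y \<in> F \<Longrightarrow> x < y \<Longrightarrow> F \<inter> {x<..<y} = {} \<Longrightarrow> C1_path_on A \<gamma> x y"
proof -
  from assms obtain F where F: "finite F \<and> {a, b} \<subseteq> F \<and> F \<subseteq> {a..b} \<and>
        (\<forall>x\<in>F. \<forall>y\<in>F. x < y \<and> F \<inter> {x<..<y} = {} \<longrightarrow> C1_path_on A \<gamma> x y)"
    unfolding pw_C1_on_def ..
  show ?thesis
    using F by (intro that[of F]) simp_all
qed

lemma pw_C1_on_cong:
  assumes "pw_C1_on A \<gamma> a b" "\<And>t. t \<in> {a..b} \<Longrightarrow> \<gamma>' t = \<gamma> t"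
  shows "pw_C1_on A \<gamma>' a b"
proof -
  obtain F where F: "finite F" "{a, b} \<subseteq> F" "F \<subseteq> {a..b}"
    "\<And>x y. x \<in> F \<Longrightarrow> y \<in> F \<Longrightarrow> x < y \<Longrightarrow> F \<inter> {x<..<y} = {} \<Longrightarrow> C1_path_on A \<gamma> x y"
    using assms(1) by (rule pw_C1_onE) (rule that)
  have "C1_path_on A \<gamma>' x y" if "x \<in> F" "y \<in> F" "x < y" "F \<inter> {x<..<y} = {}" for x y
  proof (rule C1_path_on_cong[OF F(4)[OF that]])
    have "x \<in> {a..b}" "y \<in> {a..b}" using F(3) that by auto
    then show "\<gamma>' t = \<gamma> t" if "t \<in> {x..y}" for t using that by (intro assms(2)) auto
  qed
  then show ?thesis unfolding pw_C1_on_def using F(1-3) by (intro exI[of _ F]) simp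
qed

lemma pw_C1_on_affine:
  assumes "pw_C1_on A \<gamma> a b" and m: "m \<noteq> 0"
    and iff: "\<And>t. m * t + k \<in> {a..b} \<longleftrightarrow> t \<in> {a'..b'}" and ends: "{m * a' + k, m * b' + k} = {a, b}"
  shows "pw_C1_on A (\<lambda>t. \<gamma> (m * t + k)) a' b'"
proof -
  obtain F where F: "finite F" "{a, b} \<subseteq> F" "F \<subseteq> {a..b}"
    "\<And>x y. x \<in> F \<Longrightarrow> y \<in> F \<Longrightarrow> x < y \<Longrightarrow> F \<inter> {x<..<y} = {} \<Longrightarrow> C1_path_on A \<gamma> x y"
    using assms(1) by (rule pw_C1_onE) (rule that)
  let ?\<phi> = "\<lambda>t. m * t + k"
  have inj: "inj ?\<phi>" using m by (auto simp: inj_on_def)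
  have surj: "?\<phi> ((z - k) / m) = z" for z using m by simp
  show ?thesis unfolding pw_C1_on_def
  proof (intro exI[of _ "?\<phi> -` F"] conjI ballI impI)
    show "finite (?\<phi> -` F)" using F(1) inj by (rule finite_vimageI)
    show "{a', b'} \<subseteq> ?\<phi> -` F" using ends F(2) by auto
    show "?\<phi> -` F \<subseteq> {a'..b'}" using iff F(3) by blast
    fix x y assume xy: "x \<in> ?\<phi> -` F" "y \<in> ?\<phi> -` F" "x < y \<and> ?\<phi> -` F \<inter> {x<..<y} = {}"
    show "C1_path_on A (\<lambda>t. \<gamma> (m * t + k)) x y"
    proof (cases "m > 0")
      case True
      have "F \<inter> {?\<phi> x<..<?\<phi> y} = {}"
      proof (rule ccontr)
        assume "F \<inter> {?\<phi> x<..<?\<phi> y} \<noteq> {}"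
        then obtain z where z: "z \<in> F" "?\<phi> x < z" "z < ?\<phi> y" by auto
        then have "(z - k) / m \<in> ?\<phi> -` F \<inter> {x<..<y}" using True surj[of z] by (auto simp: field_simps)
        with xy show False by blast
      qed
      with F(4)[of "?\<phi> x" "?\<phi> y"] xy True have "C1_path_on A \<gamma> (?\<phi> x) (?\<phi> y)" by simp
      then show ?thesis by (rule C1_path_on_affine) (use True in \<open>auto intro: mult_left_mono\<close>)
    next
      case False
      \<comment> \<open>A reversed path runs through each piece of the subdivision from its right end to its left end.\<close>
      with m have neg: "m < 0" by simp
      have "F \<inter> {?\<phi> y<..<?\<phi> x} = {}"
      proof (rule ccontr)
        assume "F \<inter> {?\<phi> y<..<?\<phi> x} \<noteq> {}"
        then obtain z where z: "z \<in> F" "?\<phi> y < z" "z < ?\<phi> x" by auto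
        then have "(z - k) / m \<in> ?\<phi> -` F \<inter> {x<..<y}" using neg surj[of z] by (auto simp: field_simps)
        with xy show False by blast
      qed
      with F(4)[of "?\<phi> y" "?\<phi> x"] xy neg have "C1_path_on A \<gamma> (?\<phi> y) (?\<phi> x)" by simp
      then show ?thesis by (rule C1_path_on_affine) (use neg in \<open>auto intro: mult_left_mono_neg\<close>)
    qed
  qed
qed

lemma pw_C1_on_glue:
  assumes "pw_C1_on A \<gamma> a m" "pw_C1_on A \<gamma> m b"
  shows "pw_C1_on A \<gamma> a b"
proof -
  obtain F where F: "finite F" "{a, m} \<subseteq> F" "F \<subseteq> {a..m}"
    "\<And>x y. x \<in> F \<Longrightarrow> y \<in> F \<Longrightarrow> x < y \<Longrightarrow> F \<inter> {x<..<y} = {} \<Longrightarrow> C1_path_on A \<gamma> x y"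
    using assms(1) by (rule pw_C1_onE) (rule that)
  obtain G where G: "finite G" "{m, b} \<subseteq> G" "G \<subseteq> {m..b}"
    "\<And>x y. x \<in> G \<Longrightarrow> y \<in> G \<Longrightarrow> x < y \<Longrightarrow> G \<inter> {x<..<y} = {} \<Longrightarrow> C1_path_on A \<gamma> x y"
    using assms(2) by (rule pw_C1_onE) (rule that)
  show ?thesis unfolding pw_C1_on_def
  proof (intro exI[of _ "F \<union> G"] conjI ballI impI)
    show "F \<union> G \<subseteq> {a..b}" using F(2,3) G(2,3) by fastforce
    fix x y assume xy: "x \<in> F \<union> G" "y \<in> F \<union> G" "x < y \<and> (F \<union> G) \<inter> {x<..<y} = {}"
    then have "m \<notin> {x<..<y}" using F(2) by auto
    then consider "y \<le> m" | "m \<le> x" using xy by fastforce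
    then show "C1_path_on A \<gamma> x y"
    proof cases
      case 1
      have "x \<in> F" "y \<in> F"
        using 1 xy F(2) G(3) by (metis Un_iff atLeastAtMost_iff insert_subset linorder_not_le order_antisym subsetD order_less_le_trans)+
      then show ?thesis using F(4) xy by blast
    next
      case 2
      have "x \<in> G" "y \<in> G"
        using 2 xy F(3) G(2) by (metis Un_iff atLeastAtMost_iff insert_subset linorder_not_le order_antisym subsetD order_le_less_trans)+
      then show ?thesis using G(4) xy by blast
    qed
  qed (use F G in auto)
qed

section \<open>Parallel transport along paths\<close>

lemma transports_onD:
  assumes "transports_on A \<Gamma> \<gamma> V a b"
  shows "\<And>e f t. e \<in> A \<Longrightarrow> f \<in> A \<Longrightarrow> t \<in> {a..b} \<Longrightarrow> \<gamma> t \<in> fst e \<Longrightarrow> \<gamma> t \<in> fst f \<Longrightarrow>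
      V f t = dir_deriv (transition e f) (snd e (\<gamma> t)) (V e t)"
    and "\<And>e. e \<in> A \<Longrightarrow> continuous_on {t \<in> {a..b}. \<gamma> t \<in> fst e} (V e)"
  using assms unfolding transports_on_def by (elim conjE, blast)+

lemma transports_onE:
  assumes "transports_on A \<Gamma> \<gamma> V a b"
  obtains F where "finite F" "\<And>e t. e \<in> A \<Longrightarrow> t \<in> {a<..<b} - F \<Longrightarrow> \<gamma> t \<in> fst e \<Longrightarrow>
      \<exists>D. (snd e \<circ> \<gamma> has_vector_derivative D) (at t) \<and>
        (V e has_vector_derivative - \<Gamma> e (snd e (\<gamma> t)) D (V e t)) (at t)"
proof -
  from assms obtain F where "finite F \<and> (\<forall>e\<in>A. \<forall>t\<in>{a<..<b} - F. \<gamma> t \<in> fst e \<longrightarrow>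
        (\<exists>D. (snd e \<circ> \<gamma> has_vector_derivative D) (at t) \<and>
           (V e has_vector_derivative - \<Gamma> e (snd e (\<gamma> t)) D (V e t)) (at t)))"
    unfolding transports_on_def by (elim conjE exE) (rule that, intro conjI)
  then show ?thesis by (intro that[of F]) simp_all
qed

lemma transports_on_imp_parallel_along:
  assumes "transports_on A \<Gamma> \<gamma> V 0 1"
  shows "parallel_along A \<Gamma> \<gamma> V"
proof -
  obtain F where F: "finite F" "\<And>e t. e \<in> A \<Longrightarrow> t \<in> {0<..<1} - F \<Longrightarrow> \<gamma> t \<in> fst e \<Longrightarrow>
      \<exists>D. (snd e \<circ> \<gamma> has_vector_derivative D) (at t) \<and>
        (V e has_vector_derivative - \<Gamma> e (snd e (\<gamma> t)) D (V e t)) (at t)"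
    using assms by (rule transports_onE) (rule that)
  have "(V e has_vector_derivative
      - \<Gamma> e (snd e (\<gamma> t)) (vector_derivative (snd e \<circ> \<gamma>) (at t)) (V e t)) (at t)"
    if "e \<in> A" "t \<in> {0<..<1} - F" "\<gamma> t \<in> fst e" for e t
    using F(2)[OF that] vector_derivative_at by metis
  then show ?thesis
    unfolding parallel_along_def
    by (intro conjI exI[of _ F] ballI impI F(1))
      (erule IntE, erule (4) transports_onD(1)[OF assms], erule transports_onD(2)[OF assms], assumption)
qed

text \<open>Where \<open>\<gamma> t\<close> is outside the chart \<open>e\<close>, the value \<open>V e t\<close> is meaningless; at the end points two fields need
to agree only inside the chart. This is what allows fields to be glued at a common end point.\<close>

lemma transports_on_cong:
  assumes V: "transports_on A \<Gamma> \<gamma> V a b"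
    and \<gamma>: "\<And>t. t \<in> {a..b} \<Longrightarrow> \<gamma>' t = \<gamma> t"
    and eq: "\<And>e t. e \<in> A \<Longrightarrow> t \<in> {a..b} \<Longrightarrow> t \<in> {a<..<b} \<or> \<gamma> t \<in> fst e \<Longrightarrow> V' e t = V e t"
  shows "transports_on A \<Gamma> \<gamma>' V' a b"
proof -
  obtain F where F: "finite F" "\<And>e t. e \<in> A \<Longrightarrow> t \<in> {a<..<b} - F \<Longrightarrow> \<gamma> t \<in> fst e \<Longrightarrow>
      \<exists>D. (snd e \<circ> \<gamma> has_vector_derivative D) (at t) \<and>
        (V e has_vector_derivative - \<Gamma> e (snd e (\<gamma> t)) D (V e t)) (at t)"
    using V by (rule transports_onE) (rule that)
  show ?thesis unfolding transports_on_def
  proof (intro conjI ballI impI exI[of _ F])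
    fix e f t assume "e \<in> A" "f \<in> A" and t: "t \<in> {a..b}" "\<gamma>' t \<in> fst e \<inter> fst f"
    then show "V' f t = dir_deriv (transition e f) (snd e (\<gamma>' t)) (V' e t)"
      using transports_onD(1)[OF V, of e f t] \<gamma>[OF t(1)] eq[of e t] eq[of f t] by simp
  next
    fix e assume e: "e \<in> A"
    have "{t \<in> {a..b}. \<gamma>' t \<in> fst e} = {t \<in> {a..b}. \<gamma> t \<in> fst e}" using \<gamma> by auto
    moreover have "continuous_on {t \<in> {a..b}. \<gamma> t \<in> fst e} (V' e)"
      by (rule continuous_on_eq[OF transports_onD(2)[OF V e]]) (simp add: eq e)
    ultimately show "continuous_on {t \<in> {a..b}. \<gamma>' t \<in> fst e} (V' e)" by simp
  next
    fix e t assume e: "e \<in> A" and t: "t \<in> {a<..<b} - F" "\<gamma>' t \<in> fst e"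
    then have "t \<in> {a..b}" "t \<in> {a<..<b}" by auto
    note eq_t = \<gamma>[OF this(1)] eq[OF e this(1)]
    obtain D where D: "(snd e \<circ> \<gamma> has_vector_derivative D) (at t)"
      "(V e has_vector_derivative - \<Gamma> e (snd e (\<gamma> t)) D (V e t)) (at t)"
      using F(2)[OF e t(1)] t(2) eq_t(1) by auto
    have "(snd e \<circ> \<gamma>' has_vector_derivative D) (at t)"
      by (rule has_vector_derivative_transform_within_open[OF D(1), of "{a<..<b}"])
        (use \<open>t \<in> {a<..<b}\<close> \<gamma> in auto)
    moreover have "(V' e has_vector_derivative - \<Gamma> e (snd e (\<gamma> t)) D (V e t)) (at t)"
      by (rule has_vector_derivative_transform_within_open[OF D(2), of "{a<..<b}"])
        (use \<open>t \<in> {a<..<b}\<close> eq[OF e] in auto)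
    ultimately show "\<exists>D. (snd e \<circ> \<gamma>' has_vector_derivative D) (at t) \<and>
        (V' e has_vector_derivative - \<Gamma> e (snd e (\<gamma>' t)) D (V' e t)) (at t)"
      using eq_t \<open>t \<in> {a<..<b}\<close> by auto
  qed (rule F(1))
qed

lemma transports_on_affine:
  assumes V: "transports_on A \<Gamma> \<gamma> V a b" and \<Gamma>: "linear_connection A \<Gamma>" and m: "m \<noteq> 0"
    and sub: "\<And>t. t \<in> {a'..b'} \<Longrightarrow> m * t + k \<in> {a..b}"
    and sub': "\<And>t. t \<in> {a'<..<b'} \<Longrightarrow> m * t + k \<in> {a<..<b}"
  shows "transports_on A \<Gamma> (\<lambda>t. \<gamma> (m * t + k)) (\<lambda>e t. V e (m * t + k)) a' b'"
proof -
  obtain F where F: "finite F" "\<And>e t. e \<in> A \<Longrightarrow> t \<in> {a<..<b} - F \<Longrightarrow> \<gamma> t \<in> fst e \<Longrightarrow>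
      \<exists>D. (snd e \<circ> \<gamma> has_vector_derivative D) (at t) \<and>
        (V e has_vector_derivative - \<Gamma> e (snd e (\<gamma> t)) D (V e t)) (at t)"
    using V by (rule transports_onE) (rule that)
  show ?thesis unfolding transports_on_def
  proof (intro conjI ballI impI exI[of _ "(\<lambda>t. m * t + k) -` F"])
    fix e f t assume "e \<in> A" "f \<in> A" "t \<in> {a'..b'}" "\<gamma> (m * t + k) \<in> fst e \<inter> fst f"
    then show "V f (m * t + k) = dir_deriv (transition e f) (snd e (\<gamma> (m * t + k))) (V e (m * t + k))"
      using transports_onD(1)[OF V, of e f "m * t + k"] sub by simp
  next
    fix e assume e: "e \<in> A"
    show "continuous_on {t \<in> {a'..b'}. \<gamma> (m * t + k) \<in> fst e} (\<lambda>t. V e (m * t + k))"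
      by (rule continuous_on_compose2[OF transports_onD(2)[OF V e]])
        (use sub in \<open>auto intro!: continuous_intros\<close>)
  next
    fix e t assume e: "e \<in> A" and t: "t \<in> {a'<..<b'} - (\<lambda>t. m * t + k) -` F" "\<gamma> (m * t + k) \<in> fst e"
    obtain D where D: "(snd e \<circ> \<gamma> has_vector_derivative D) (at (m * t + k))"
      "(V e has_vector_derivative - \<Gamma> e (snd e (\<gamma> (m * t + k))) D (V e (m * t + k))) (at (m * t + k))"
      using F(2)[OF e, of "m * t + k"] t sub' by auto
    have "snd e (\<gamma> (m * t + k)) \<in> codom e" using t(2) by (auto simp: codom_def)
    then have "bilinear (\<Gamma> e (snd e (\<gamma> (m * t + k))))"
      using \<Gamma> e unfolding linear_connection_def by blast
    note scale = bilinear_lmul[OF this]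
    have "(snd e \<circ> (\<lambda>t. \<gamma> (m * t + k)) has_vector_derivative m *\<^sub>R D) (at t)"
      using has_vector_derivative_affine[OF D(1), of UNIV] by (simp add: o_def)
    moreover have "((\<lambda>t. V e (m * t + k)) has_vector_derivative
        - \<Gamma> e (snd e (\<gamma> (m * t + k))) (m *\<^sub>R D) (V e (m * t + k))) (at t)"
      using has_vector_derivative_affine[OF D(2), of UNIV] by (simp add: scale)
    ultimately show "\<exists>D. (snd e \<circ> (\<lambda>t. \<gamma> (m * t + k)) has_vector_derivative D) (at t) \<and>
        ((\<lambda>t. V e (m * t + k)) has_vector_derivative
          - \<Gamma> e (snd e (\<gamma> (m * t + k))) D (V e (m * t + k))) (at t)" by blast
  next
    show "finite ((\<lambda>t. m * t + k) -` F)"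
      using F(1) by (rule finite_vimageI) (use m in \<open>auto simp: inj_on_def\<close>)
  qed
qed

lemma transports_on_glue:
  assumes V: "transports_on A \<Gamma> \<gamma> V a m" "transports_on A \<Gamma> \<gamma> V m b" and m: "a \<le> m" "m \<le> b"
  shows "transports_on A \<Gamma> \<gamma> V a b"
proof -
  obtain F where F: "finite F" "\<And>e t. e \<in> A \<Longrightarrow> t \<in> {a<..<m} - F \<Longrightarrow> \<gamma> t \<in> fst e \<Longrightarrow>
      \<exists>D. (snd e \<circ> \<gamma> has_vector_derivative D) (at t) \<and>
        (V e has_vector_derivative - \<Gamma> e (snd e (\<gamma> t)) D (V e t)) (at t)"
    using V(1) by (rule transports_onE) (rule that)
  obtain G where G: "finite G" "\<And>e t. e \<in> A \<Longrightarrow> t \<in> {m<..<b} - G \<Longrightarrow> \<gamma> t \<in> fst e \<Longrightarrow>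
      \<exists>D. (snd e \<circ> \<gamma> has_vector_derivative D) (at t) \<and>
        (V e has_vector_derivative - \<Gamma> e (snd e (\<gamma> t)) D (V e t)) (at t)"
    using V(2) by (rule transports_onE) (rule that)
  show ?thesis unfolding transports_on_def
  proof (intro conjI ballI impI exI[of _ "insert m (F \<union> G)"])
    fix e f t assume "e \<in> A" "f \<in> A" "t \<in> {a..b}" "\<gamma> t \<in> fst e \<inter> fst f"
    then show "V f t = dir_deriv (transition e f) (snd e (\<gamma> t)) (V e t)"
      using transports_onD(1)[OF V(1), of e f t] transports_onD(1)[OF V(2), of e f t]
      by (cases "t \<le> m") simp_all
  next
    fix e assume e: "e \<in> A"
    let ?S = "{t \<in> {a..m}. \<gamma> t \<in> fst e}" and ?T = "{t \<in> {m..b}. \<gamma> t \<in> fst e}"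
    have un: "{t \<in> {a..b}. \<gamma> t \<in> fst e} = ?S \<union> ?T" using m by auto
    have "?S = {t \<in> {a..b}. \<gamma> t \<in> fst e} \<inter> {..m}" "?T = {t \<in> {a..b}. \<gamma> t \<in> fst e} \<inter> {m..}"
      by (rule set_eqI, use m in simp, linarith)+
    then have "closedin (top_of_set (?S \<union> ?T)) ?S" "closedin (top_of_set (?S \<union> ?T)) ?T"
      unfolding un[symmetric] by (simp_all only: closedin_closed_Int closed_atMost closed_atLeast)
    from continuous_on_Un_local[OF this transports_onD(2)[OF V(1) e] transports_onD(2)[OF V(2) e]]
    show "continuous_on {t \<in> {a..b}. \<gamma> t \<in> fst e} (V e)" unfolding un .
  next
    fix e t assume "e \<in> A" "t \<in> {a<..<b} - insert m (F \<union> G)" "\<gamma> t \<in> fst e"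
    then show "\<exists>D. (snd e \<circ> \<gamma> has_vector_derivative D) (at t) \<and>
        (V e has_vector_derivative - \<Gamma> e (snd e (\<gamma> t)) D (V e t)) (at t)"
      using F(2)[of e t] G(2)[of e t] by (cases "t < m") auto
  qed (use F(1) G(1) in simp)
qed

text \<open>Some path from \<open>p\<close> to \<open>q\<close> has parallel transport \<open>P\<close>, with respect to the bases given by \<open>c\<close> and \<open>d\<close>.
The path itself is irrelevant for all that follows, so it is quantified away; join, reversal and
change of chart become the groupoid laws of this relation.\<close>

definition path_transport :: "('a::topological_space, 'n::finite) chart set \<Rightarrow> ('a, 'n) conn \<Rightarrow>
    'a \<Rightarrow> ('a, 'n) chart \<Rightarrow> 'a \<Rightarrow> ('a, 'n) chart \<Rightarrow> real ^ 'n ^ 'n \<Rightarrow> bool" where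
  "path_transport A \<Gamma> p c q d P \<longleftrightarrow> c \<in> A \<and> p \<in> fst c \<and> d \<in> A \<and> q \<in> fst d \<and>
     (\<exists>\<gamma>. pw_C1_on A \<gamma> 0 1 \<and> \<gamma> 0 = p \<and> \<gamma> 1 = q \<and>
        (\<forall>v. \<exists>V. transports_on A \<Gamma> \<gamma> V 0 1 \<and> V c 0 = v \<and> V d 1 = P *v v))"

lemma path_transportE:
  assumes "path_transport A \<Gamma> p c q d P"
  obtains \<gamma> where "c \<in> A" "p \<in> fst c" "d \<in> A" "q \<in> fst d" "pw_C1_on A \<gamma> 0 1" "\<gamma> 0 = p" "\<gamma> 1 = q"
    "\<And>v. \<exists>V. transports_on A \<Gamma> \<gamma> V 0 1 \<and> V c 0 = v \<and> V d 1 = P *v v"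
  using assms unfolding path_transport_def
  by (elim conjE exE) (rule that, assumption+, erule spec)

lemma path_transport_holonomy:
  assumes "path_transport A \<Gamma> p c p c P"
  shows "P \<in> holonomy_group A \<Gamma> p c"
proof -
  obtain \<gamma> where \<gamma>: "pw_C1_on A \<gamma> 0 1" "\<gamma> 0 = p" "\<gamma> 1 = p"
    "\<And>v. \<exists>V. transports_on A \<Gamma> \<gamma> V 0 1 \<and> V c 0 = v \<and> V c 1 = P *v v"
    using assms by (rule path_transportE) (rule that)
  have "piecewise_C1_path A \<gamma>"
    using \<gamma>(1) unfolding pw_C1_on_def piecewise_C1_path_def .
  moreover have "\<exists>V. parallel_along A \<Gamma> \<gamma> V \<and> V c 0 = v \<and> V c 1 = P *v v" for v
  proof -
    obtain V where V: "transports_on A \<Gamma> \<gamma> V 0 1" "V c 0 = v" "V c 1 = P *v v" using \<gamma>(4) by blast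
    then show ?thesis by (intro exI[of _ V] conjI transports_on_imp_parallel_along)
  qed
  ultimately show ?thesis
    unfolding holonomy_group_def mem_Collect_eq using \<gamma>(2,3) by (intro exI[of _ \<gamma>] conjI allI)
qed

lemma path_transport_join:
  assumes P: "path_transport A \<Gamma> p c q d P" and Q: "path_transport A \<Gamma> q d r e Q"
    and \<Gamma>: "linear_connection A \<Gamma>"
  shows "path_transport A \<Gamma> p c r e (Q ** P)"
proof -
  obtain \<gamma>1 where 1: "c \<in> A" "p \<in> fst c" "d \<in> A" "q \<in> fst d" "pw_C1_on A \<gamma>1 0 1" "\<gamma>1 0 = p" "\<gamma>1 1 = q"
    "\<And>v. \<exists>V. transports_on A \<Gamma> \<gamma>1 V 0 1 \<and> V c 0 = v \<and> V d 1 = P *v v"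
    using P by (rule path_transportE) (rule that)
  obtain \<gamma>2 where 2: "e \<in> A" "r \<in> fst e" "pw_C1_on A \<gamma>2 0 1" "\<gamma>2 0 = q" "\<gamma>2 1 = r"
    "\<And>v. \<exists>V. transports_on A \<Gamma> \<gamma>2 V 0 1 \<and> V d 0 = v \<and> V e 1 = Q *v v"
    using Q by (rule path_transportE) (rule that)
  define \<gamma> where "\<gamma> = (\<lambda>t. if t \<le> 1/2 then \<gamma>1 (2 * t + 0) else \<gamma>2 (2 * t + - 1))"
  have \<gamma>1: "\<gamma> t = \<gamma>1 (2 * t + 0)" if "t \<in> {0..1/2}" for t using that by (simp add: \<gamma>_def)
  have \<gamma>2: "\<gamma> t = \<gamma>2 (2 * t + - 1)" if "t \<in> {1/2..1}" for t
  proof (cases "t = 1/2")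
    case True
    show ?thesis unfolding True using 1(7) 2(4) by (simp add: \<gamma>_def)
  qed (use that in \<open>simp add: \<gamma>_def\<close>)
  have "pw_C1_on A (\<lambda>t. \<gamma>1 (2 * t + 0)) 0 (1/2)" by (rule pw_C1_on_affine[OF 1(5)]) auto
  then have p1: "pw_C1_on A \<gamma> 0 (1/2)" by (rule pw_C1_on_cong[OF _ \<gamma>1])
  have "pw_C1_on A (\<lambda>t. \<gamma>2 (2 * t + - 1)) (1/2) 1" by (rule pw_C1_on_affine[OF 2(3)]) auto
  then have p2: "pw_C1_on A \<gamma> (1/2) 1" by (rule pw_C1_on_cong[OF _ \<gamma>2])
  have "\<exists>V. transports_on A \<Gamma> \<gamma> V 0 1 \<and> V c 0 = v \<and> V e 1 = (Q ** P) *v v" for v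
  proof -
    obtain V1 where V1: "transports_on A \<Gamma> \<gamma>1 V1 0 1" "V1 c 0 = v" "V1 d 1 = P *v v" using 1(8) by blast
    obtain V2 where V2: "transports_on A \<Gamma> \<gamma>2 V2 0 1" "V2 d 0 = P *v v" "V2 e 1 = Q *v (P *v v)"
      using 2(6) by blast
    define V where "V = (\<lambda>f t. if t \<le> 1/2 then V1 f (2 * t + 0) else V2 f (2 * t + - 1))"
    \<comment> \<open>The two fields agree at the joint in the chart \<open>d\<close>, hence in every chart around \<open>q\<close>.\<close>
    have mid: "V1 f 1 = V2 f 0" if "f \<in> A" "q \<in> fst f" for f
      using transports_onD(1)[OF V1(1) 1(3) that(1), of 1] transports_onD(1)[OF V2(1) 1(3) that(1), of 0]
        that(2) V1(3) V2(2) 1(4,7) 2(4) by simp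
    have "transports_on A \<Gamma> (\<lambda>t. \<gamma>1 (2 * t + 0)) (\<lambda>f t. V1 f (2 * t + 0)) 0 (1/2)"
      by (rule transports_on_affine[OF V1(1) \<Gamma>]) auto
    then have "transports_on A \<Gamma> \<gamma> V 0 (1/2)"
      by (rule transports_on_cong[OF _ \<gamma>1]) (simp_all add: V_def)
    moreover have "transports_on A \<Gamma> (\<lambda>t. \<gamma>2 (2 * t + - 1)) (\<lambda>f t. V2 f (2 * t + - 1)) (1/2) 1"
      by (rule transports_on_affine[OF V2(1) \<Gamma>]) auto
    then have "transports_on A \<Gamma> \<gamma> V (1/2) 1"
    proof (rule transports_on_cong[OF _ \<gamma>2])
      fix f t assume f: "f \<in> A" "t \<in> {1/2..1::real}" "t \<in> {1/2<..<1} \<or> \<gamma>2 (2 * t + - 1) \<in> fst f"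
      show "V f t = V2 f (2 * t + - 1)"
      proof (cases "t = 1/2")
        case True
        with f(3) 2(4) have "q \<in> fst f" by simp
        from mid[OF f(1) this] show ?thesis unfolding True by (simp add: V_def)
      qed (use f(2) in \<open>simp add: V_def\<close>)
    qed simp
    ultimately have "transports_on A \<Gamma> \<gamma> V 0 1" by (rule transports_on_glue) simp_all
    moreover have "V c 0 = v" "V e 1 = (Q ** P) *v v"
      using V1(2) V2(3) by (simp_all add: V_def matrix_vector_mul_assoc)
    ultimately show ?thesis by blast
  qed
  moreover have "\<gamma> 0 = p" "\<gamma> 1 = r" using 1(6) 2(5) by (simp_all add: \<gamma>_def)
  moreover have "pw_C1_on A \<gamma> 0 1" using p1 p2 by (rule pw_C1_on_glue)
  ultimately show ?thesis
    unfolding path_transport_def using 1(1,2) 2(1,2) by (intro conjI exI[of _ \<gamma>] allI)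
qed

lemma path_transport_reverse:
  assumes P: "path_transport A \<Gamma> p c q d P" and Q: "P ** Q = mat 1" and \<Gamma>: "linear_connection A \<Gamma>"
  shows "path_transport A \<Gamma> q d p c Q"
proof -
  obtain \<gamma> where \<gamma>: "c \<in> A" "p \<in> fst c" "d \<in> A" "q \<in> fst d" "pw_C1_on A \<gamma> 0 1" "\<gamma> 0 = p" "\<gamma> 1 = q"
    "\<And>v. \<exists>V. transports_on A \<Gamma> \<gamma> V 0 1 \<and> V c 0 = v \<and> V d 1 = P *v v"
    using P by (rule path_transportE) (rule that)
  have "\<exists>V. transports_on A \<Gamma> (\<lambda>t. \<gamma> (- 1 * t + 1)) V 0 1 \<and> V d 0 = v \<and> V c 1 = Q *v v" for v
  proof -
    obtain V where V: "transports_on A \<Gamma> \<gamma> V 0 1" "V c 0 = Q *v v" "V d 1 = P *v (Q *v v)"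
      using \<gamma>(8) by blast
    have "transports_on A \<Gamma> (\<lambda>t. \<gamma> (- 1 * t + 1)) (\<lambda>e t. V e (- 1 * t + 1)) 0 1"
      by (rule transports_on_affine[OF V(1) \<Gamma>]) auto
    moreover have "V d (- 1 * 0 + 1) = v" "V c (- 1 * 1 + 1) = Q *v v"
      using V(2,3) by (simp_all add: matrix_vector_mul_assoc Q)
    ultimately show ?thesis by blast
  qed
  moreover have "pw_C1_on A (\<lambda>t. \<gamma> (- 1 * t + 1)) 0 1" by (rule pw_C1_on_affine[OF \<gamma>(5)]) auto
  ultimately show ?thesis
    unfolding path_transport_def using \<gamma>(1-4,6,7) by (intro conjI exI[of _ "\<lambda>t. \<gamma> (- 1 * t + 1)"] allI) simp_all
qed

lemma (in atlas) path_transport_change_chart: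
  assumes P: "path_transport A \<Gamma> p c q d P" and e: "e \<in> A" "q \<in> fst e"
  shows "path_transport A \<Gamma> p c q e (matrix (dir_deriv (transition d e) (snd d q)) ** P)"
proof -
  obtain \<gamma> where \<gamma>: "c \<in> A" "p \<in> fst c" "d \<in> A" "q \<in> fst d" "pw_C1_on A \<gamma> 0 1" "\<gamma> 0 = p" "\<gamma> 1 = q"
    "\<And>v. \<exists>V. transports_on A \<Gamma> \<gamma> V 0 1 \<and> V c 0 = v \<and> V d 1 = P *v v"
    using P by (rule path_transportE) (rule that)
  have "linear (dir_deriv (transition d e) (snd d q))"
    using differentiable_transition[OF \<gamma>(3) e(1) overlap_chart[OF \<gamma>(4) e(2)]] by (rule linear_dir_deriv)
  note D = matrix_vector_mul(2)[OF this, THEN fun_cong]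
  have "\<exists>V. transports_on A \<Gamma> \<gamma> V 0 1 \<and> V c 0 = v \<and>
      V e 1 = (matrix (dir_deriv (transition d e) (snd d q)) ** P) *v v" for v
  proof -
    obtain V where V: "transports_on A \<Gamma> \<gamma> V 0 1" "V c 0 = v" "V d 1 = P *v v" using \<gamma>(8) by blast
    with transports_onD(1)[OF V(1) \<gamma>(3) e(1), of 1] e(2) \<gamma>(4,7) show ?thesis
      by (intro exI[of _ V]) (simp add: matrix_vector_mul_assoc[symmetric] D del: matrix_vector_mul_assoc)
  qed
  then show ?thesis
    unfolding path_transport_def using \<gamma>(1,2,5-7) e by (intro conjI exI[of _ \<gamma>] allI)
qed

lemma (in atlas) transition_matrix_inverse:
  assumes "d \<in> A" "e \<in> A" "q \<in> fst d" "q \<in> fst e"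
  shows "matrix (dir_deriv (transition e d) (snd e q)) ** matrix (dir_deriv (transition d e) (snd d q)) = mat 1"
proof -
  have lin: "linear (dir_deriv (transition d e) (snd d q))" "linear (dir_deriv (transition e d) (snd e q))"
    using assms by (auto intro!: linear_dir_deriv differentiable_transition overlap_chart)
  have "dir_deriv (transition e d) (snd e q) \<circ> dir_deriv (transition d e) (snd d q) = id"
    using transition_cocycle[OF assms(1,2,1,3,4,3)] dir_deriv_transition_self[OF assms(1,3)] by auto
  then show ?thesis using matrix_compose[OF lin] by (simp add: matrix_id_mat_1)
qed

section \<open>Transport along coordinate segments\<close>

lemma bounded_bilinear_matrix_mult:
  "bounded_bilinear ((**) :: real ^ 'n ^ 'm \<Rightarrow> real ^ 'p ^ 'n \<Rightarrow> real ^ 'p ^ 'm)"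
proof -
  have "(r *\<^sub>R B) ** C = r *\<^sub>R (B ** C)" "B ** (r *\<^sub>R C) = r *\<^sub>R (B ** C)"
    for r and B :: "real ^ 'n ^ 'm" and C :: "real ^ 'p ^ 'n"
    by (simp_all add: vec_eq_iff matrix_matrix_mult_def sum_distrib_left mult_ac)
  moreover have "(B + B') ** C = B ** C + B' ** C" for B B' :: "real ^ 'n ^ 'm" and C :: "real ^ 'p ^ 'n"
    by (simp add: vec_eq_iff matrix_matrix_mult_def sum.distrib algebra_simps)
  ultimately have "bilinear ((**) :: real ^ 'n ^ 'm \<Rightarrow> real ^ 'p ^ 'n \<Rightarrow> real ^ 'p ^ 'm)"
    unfolding bilinear_def linear_iff
    by (simp add: matrix_add_ldistrib)
  then show ?thesis by (simp add: bilinear_conv_bounded_bilinear)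
qed

interpretation matrix_mult: bounded_bilinear
  "(**) :: real ^ 'n ^ 'm \<Rightarrow> real ^ 'p ^ 'n \<Rightarrow> real ^ 'p ^ 'm"
  by (rule bounded_bilinear_matrix_mult)

lemma matrix_linear: "linear f \<Longrightarrow> matrix f *v v = f (v :: real ^ 'n)"
  for f :: "real ^ 'n \<Rightarrow> real ^ 'm"
  using matrix_vector_mul(2)[THEN fun_cong] .

lemma matrix_has_vector_derivative:
  fixes f :: "real \<Rightarrow> real ^ 'n \<Rightarrow> real ^ 'm"
  assumes "\<And>v. ((\<lambda>t. f t v) has_vector_derivative f' v) (at t within S)"
  shows "((\<lambda>t. matrix (f t)) has_vector_derivative matrix f') (at t within S)"
proof -
  have "((\<lambda>t. f t (axis j 1) $ i) has_derivative (\<lambda>h. h * f' (axis j 1) $ i)) (at t within S)" for i j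
    using bounded_linear.has_derivative[OF bounded_linear_vec_nth assms[of "axis j 1", unfolded has_vector_derivative_def]]
    by simp
  then show ?thesis
    unfolding matrix_def has_vector_derivative_def
    by (subst has_derivative_componentwise_within) (auto simp: Basis_vec_def inner_axis)
qed

lemma matrix_continuous_on:
  fixes f :: "'x::topological_space \<Rightarrow> real ^ 'n \<Rightarrow> real ^ 'm"
  assumes "\<And>v. continuous_on S (\<lambda>x. f x v)"
  shows "continuous_on S (\<lambda>x. matrix (f x))"
  unfolding matrix_def by (intro continuous_on_vec_lambda continuous_on_component assms)

text \<open>\<open>Z\<close> solves the adjoint equation \<open>Z' = - Z A\<close>, so the derivative of \<open>Z U\<close> vanishes and \<open>Z\<close> is the inverse
of \<open>U\<close>. Obtaining the inverse in this way yields its differentiability in the parameter as well.\<close>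

proposition fundamental_matrix_C1_in_parameter:
  fixes A A' :: "real \<Rightarrow> real \<Rightarrow> real ^ 'n ^ 'n"
  assumes l: "0 \<le> l"
    and A: "continuous_on ({0..l} \<times> {a..b}) (\<lambda>(s, t). A s t)"
    and A': "continuous_on ({0..l} \<times> {a..b}) (\<lambda>(s, t). A' s t)"
    and der: "\<And>s t. s \<in> {0..l} \<Longrightarrow> t \<in> {a..b} \<Longrightarrow>
      ((\<lambda>t. A s t) has_vector_derivative A' s t) (at t within {a..b})"
  obtains U U' Z Z' where "\<And>t. t \<in> {a..b} \<Longrightarrow> U 0 t = mat 1" and "\<And>t. t \<in> {a..b} \<Longrightarrow> U' 0 t = 0"
    and "\<And>s t. s \<in> {0..l} \<Longrightarrow> t \<in> {a..b} \<Longrightarrow>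
      ((\<lambda>s. U s t) has_vector_derivative A s t ** U s t) (at s within {0..l})"
    and "\<And>s t. s \<in> {0..l} \<Longrightarrow> t \<in> {a..b} \<Longrightarrow>
      ((\<lambda>s. U' s t) has_vector_derivative A' s t ** U s t + A s t ** U' s t) (at s within {0..l})"
    and "\<And>s t. s \<in> {0..l} \<Longrightarrow> t \<in> {a..b} \<Longrightarrow>
      ((\<lambda>t. U s t) has_vector_derivative U' s t) (at t within {a..b})"
    and "\<And>s t. s \<in> {0..l} \<Longrightarrow> t \<in> {a..b} \<Longrightarrow>
      ((\<lambda>t. Z s t) has_vector_derivative Z' s t) (at t within {a..b})"
    and "\<And>s. s \<in> {0..l} \<Longrightarrow> continuous_on {a..b} (U' s)"
    and "\<And>s. s \<in> {0..l} \<Longrightarrow> continuous_on {a..b} (Z' s)"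
    and "\<And>s t. s \<in> {0..l} \<Longrightarrow> t \<in> {a..b} \<Longrightarrow> Z s t ** U s t = mat 1"
    and "\<And>s t. s \<in> {0..l} \<Longrightarrow> t \<in> {a..b} \<Longrightarrow> U s t ** Z s t = mat 1"
proof -
  obtain U U' where U: "continuous_on ({0..l} \<times> {a..b}) (\<lambda>(s, t). U' s t)"
    "\<And>t. t \<in> {a..b} \<Longrightarrow> U 0 t = mat 1" "\<And>t. t \<in> {a..b} \<Longrightarrow> U' 0 t = 0"
    "\<And>s t. s \<in> {0..l} \<Longrightarrow> t \<in> {a..b} \<Longrightarrow>
      ((\<lambda>s. U s t) has_vector_derivative A s t ** U s t) (at s within {0..l})"
    "\<And>s t. s \<in> {0..l} \<Longrightarrow> t \<in> {a..b} \<Longrightarrow>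
      ((\<lambda>s. U' s t) has_vector_derivative A' s t ** U s t + A s t ** U' s t) (at s within {0..l})"
    "\<And>s t. s \<in> {0..l} \<Longrightarrow> t \<in> {a..b} \<Longrightarrow>
      ((\<lambda>t. U s t) has_vector_derivative U' s t) (at t within {a..b})"
    by (rule linear_ode_C1_in_parameter[OF bounded_bilinear_matrix_mult l A A', where ?y0.0 = "mat 1"]) (rule der, assumption, assumption, rule that)
  have mA: "continuous_on ({0..l} \<times> {a..b}) (\<lambda>(s, t). - A s t)"
    "continuous_on ({0..l} \<times> {a..b}) (\<lambda>(s, t). - A' s t)"
    using continuous_on_minus[OF A] continuous_on_minus[OF A'] by (simp_all add: case_prod_unfold)
  have mder: "((\<lambda>t. - A s t) has_vector_derivative - A' s t) (at t within {a..b})"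
    if "s \<in> {0..l}" "t \<in> {a..b}" for s t
    using der[OF that] by (rule has_vector_derivative_minus)
  obtain Z Z' where Z: "continuous_on ({0..l} \<times> {a..b}) (\<lambda>(s, t). Z' s t)"
    "\<And>t. t \<in> {a..b} \<Longrightarrow> Z 0 t = mat 1"
    "\<And>s t. s \<in> {0..l} \<Longrightarrow> t \<in> {a..b} \<Longrightarrow>
      ((\<lambda>s. Z s t) has_vector_derivative Z s t ** - A s t) (at s within {0..l})"
    "\<And>s t. s \<in> {0..l} \<Longrightarrow> t \<in> {a..b} \<Longrightarrow>
      ((\<lambda>t. Z s t) has_vector_derivative Z' s t) (at t within {a..b})"
    by (rule linear_ode_C1_in_parameter[OF matrix_mult.flip l mA, where ?y0.0 = "mat 1"])
      (rule mder, assumption, assumption, rule that)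
  have inv: "Z s t ** U s t = mat 1" if s: "s \<in> {0..l}" and t: "t \<in> {a..b}" for s t
  proof -
    have d: "((\<lambda>s. Z s t ** U s t) has_vector_derivative 0) (at s within {0..l})" if "s \<in> {0..l}" for s
      using matrix_mult.has_vector_derivative[OF Z(3)[OF that t] U(4)[OF that t]]
      by (simp add: matrix_mul_assoc matrix_mult.minus_left matrix_mult.minus_right)
    obtain C where C: "\<And>s. s \<in> {0..l} \<Longrightarrow> Z s t ** U s t = C"
      by (rule has_vector_derivative_zero_constant[OF convex_real_interval(5) d]) (assumption, rule that)
    have "Z 0 t ** U 0 t = C" using C[of 0] l by simp
    with C[OF s] show ?thesis using Z(2)[OF t] U(2)[OF t] by simp
  qed
  show ?thesis
    by (rule that[OF U(2-6) Z(4)])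
      (assumption | rule continuous_on_section2[OF U(1)] continuous_on_section2[OF Z(1)] inv
        matrix_left_right_inverse[THEN iffD1, OF inv])+
qed


locale connection_atlas = atlas A for A :: "('a::topological_space, 'n::finite) chart set" +
  fixes \<Gamma> :: "('a, 'n) conn"
  assumes linear_connection: "linear_connection A \<Gamma>"
begin

lemma bilinear_Gamma: "c \<in> A \<Longrightarrow> x \<in> codom c \<Longrightarrow> bilinear (\<Gamma> c x)"
  and smooth_Gamma: "c \<in> A \<Longrightarrow> smooth_on (\<lambda>x. \<Gamma> c x u v) (codom c)"
  and Gamma_transition: "c \<in> A \<Longrightarrow> d \<in> A \<Longrightarrow> x \<in> overlap c d \<Longrightarrow>
    dir_deriv (transition c d) x (\<Gamma> c x u v) =
        \<Gamma> d (transition c d x) (dir_deriv (transition c d) x u) (dir_deriv (transition c d) x v)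
        + dir_deriv (\<lambda>y. dir_deriv (transition c d) y v) x u"
  using linear_connection unfolding linear_connection_def by blast+

lemma linear_Gamma: "c \<in> A \<Longrightarrow> x \<in> codom c \<Longrightarrow> linear (\<Gamma> c x u)"
  using bilinear_Gamma unfolding bilinear_def by blast

text \<open>A matrix solution of the transport equation in the chart \<open>d\<close> gives transport in the sense of all
charts: the transition map carries \<open>y\<close> to \<open>V e = D\<phi> y\<close>, and the inhomogeneous second-derivative term in the
transformation law of \<open>\<Gamma>\<close> is exactly the term that the derivative of \<open>D\<phi>\<close> along the path contributes.\<close>

lemma path_transport_unit_segment:
  assumes d: "d \<in> A" and x: "\<And>t. t \<in> {0..1} \<Longrightarrow> a + t *\<^sub>R b \<in> codom d"
    and Y: "\<And>t. t \<in> {0..1} \<Longrightarrow>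
      (Y has_vector_derivative - matrix (\<Gamma> d (a + t *\<^sub>R b) b) ** Y t) (at t within {0..1})"
    and Y0: "Y 0 = mat 1"
  shows "path_transport A \<Gamma> (point d a) d (point d (a + b)) d (Y 1)"
proof -
  define z where "z = (\<lambda>t. a + t *\<^sub>R b)"
  define \<gamma> where "\<gamma> = (\<lambda>t. point d (z t))"
  have z: "z t \<in> codom d" if "t \<in> {0..1}" for t using x[OF that] by (simp add: z_def)
  have chart_\<gamma>: "snd d (\<gamma> t) = z t" if "t \<in> {0..1}" for t
    using chart_point[OF d z[OF that]] by (simp add: \<gamma>_def)
  have \<gamma>_in: "\<gamma> t \<in> fst d" if "t \<in> {0..1}" for t
    using point_in[OF d z[OF that]] by (simp add: \<gamma>_def)
  have ov: "z t \<in> overlap d e" if "t \<in> {0..1}" "\<gamma> t \<in> fst e" for e t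
    using overlap_iff[OF d] z that by (simp add: \<gamma>_def)
  have zd: "(z has_vector_derivative b) (at t within S)" for t S
    unfolding z_def by (auto intro!: derivative_eq_intros)
  have zc: "continuous_on S z" for S unfolding z_def by (intro continuous_intros)
  have comp: "snd e \<circ> \<gamma> = transition d e \<circ> z" for e
    by (auto simp: \<gamma>_def transition_eq)
  have Dtr: "(transition d e has_derivative dir_deriv (transition d e) (z t)) (at (z t) within S)"
    if "e \<in> A" "t \<in> {0..1}" "\<gamma> t \<in> fst e" for e t S
    using differentiable_transition[OF d that(1) ov[OF that(2,3)]] frechet_derivative_works
      has_derivative_at_withinI by blast
  have chart_d: "(snd e \<circ> \<gamma> has_vector_derivative dir_deriv (transition d e) (z t) b) (at t within S)"
    if "e \<in> A" "t \<in> {0..1}" "\<gamma> t \<in> fst e" for e t S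
    unfolding comp by (rule vector_derivative_diff_chain_within[OF zd Dtr[OF that]])
  have cont_dd: "continuous_on {t \<in> {0..1}. \<gamma> t \<in> fst e} (\<lambda>t. dir_deriv (transition d e) (z t) u)"
    if "e \<in> A" for e u
  proof -
    have "z ` {t \<in> {0..1}. \<gamma> t \<in> fst e} \<subseteq> overlap d e"
      by (rule image_subsetI, rule ov) simp_all
    then show ?thesis
      by (rule continuous_on_compose2[OF smooth_onD(1)[OF smooth_onD(3)[OF smooth_transition[OF d that]]] zc])
  qed
  have "continuous_on {0..1} \<gamma>"
    unfolding \<gamma>_def by (rule continuous_on_compose2[OF continuous_on_point[OF d] zc]) (use z in auto)
  then have "C1_path_on A \<gamma> 0 1"
    unfolding C1_path_on_def using cont_dd chart_d by blast
  then have pw: "pw_C1_on A \<gamma> 0 1"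
    unfolding pw_C1_on_def by (intro exI[of _ "{0, 1}"]) auto
  have "\<exists>V. transports_on A \<Gamma> \<gamma> V 0 1 \<and> V d 0 = v \<and> V d 1 = Y 1 *v v" for v
  proof -
    define y where "y = (\<lambda>t. Y t *v v)"
    have yd: "(y has_vector_derivative - \<Gamma> d (z t) b (y t)) (at t within {0..1})" if t: "t \<in> {0..1}" for t
    proof -
      have "bounded_linear (\<lambda>M :: real ^ 'n ^ 'n. M *v v)"
        by (intro linear_conv_bounded_linear[THEN iffD1] linearI)
          (simp_all add: matrix_vector_mult_add_rdistrib scaleR_matrix_vector_assoc)
      from bounded_linear.has_vector_derivative[OF this Y[OF t]]
      have "(y has_vector_derivative (- matrix (\<Gamma> d (z t) b) ** Y t) *v v) (at t within {0..1})"
        by (simp add: y_def z_def)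
      also have "(- matrix (\<Gamma> d (z t) b) ** Y t) *v v = - (matrix (\<Gamma> d (z t) b) *v y t)"
        by (simp add: matrix_mult.minus_left y_def matrix_vector_mul_assoc)
          (metis add.inverse_inverse diff_0 matrix_vector_mult_0 matrix_vector_mult_diff_rdistrib)
      also have "\<dots> = - \<Gamma> d (z t) b (y t)"
        by (simp add: matrix_linear[OF linear_Gamma[OF d z[OF t]]])
      finally show ?thesis .
    qed
    then have yc: "continuous_on {0..1} y"
      by (rule continuous_on_vector_derivative)
    define V where "V = (\<lambda>e t. dir_deriv (transition d e) (z t) (y t))"
    have "transports_on A \<Gamma> \<gamma> V 0 1"
      unfolding transports_on_def
    proof (intro conjI ballI impI exI[of _ "{}"])
      fix e f t assume "e \<in> A" "f \<in> A" "t \<in> {0..1}" "\<gamma> t \<in> fst e \<inter> fst f"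
      then show "V f t = dir_deriv (transition e f) (snd e (\<gamma> t)) (V e t)"
        using transition_cocycle[OF d, of e f "\<gamma> t"] \<gamma>_in chart_\<gamma> by (simp add: V_def)
    next
      fix e assume e: "e \<in> A"
      show "continuous_on {t \<in> {0..1}. \<gamma> t \<in> fst e} (V e)"
        unfolding V_def
      proof (rule continuous_on_linear_family[where L = "\<lambda>t. dir_deriv (transition d e) (z t)"])
        show "linear (dir_deriv (transition d e) (z t))" if "t \<in> {t \<in> {0..1}. \<gamma> t \<in> fst e}" for t
          using differentiable_transition[OF d e] ov that by (intro linear_dir_deriv) blast
        show "continuous_on {t \<in> {0..1}. \<gamma> t \<in> fst e} y"
          using yc by (rule continuous_on_subset) auto
      qed (rule cont_dd[OF e])
    next
      fix e t assume e: "e \<in> A" and "t \<in> {0<..<1} - ({} :: real set)" and te: "\<gamma> t \<in> fst e"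
      then have t: "t \<in> {0<..<1}" "t \<in> {0..1}" by auto
      let ?\<phi> = "transition d e" and ?O = "overlap d e"
      have O: "open ?O" "z t \<in> ?O" using open_overlap[OF d e] ov[OF t(2) te] by auto
      note \<phi>' = smooth_onD(2)[OF smooth_onD(3)[OF smooth_transition[OF d e]] O(2)]
      let ?H = "\<lambda>u. dir_deriv (\<lambda>x. dir_deriv ?\<phi> x u) (z t) b"
      have S: "open (z -` ?O)"
        using zc[of UNIV] O(1) continuous_on_open_vimage[of UNIV z] by auto
      have y_at: "(y has_vector_derivative - \<Gamma> d (z t) b (y t)) (at t)"
        using yd[OF t(2)] t(1) by (simp add: at_within_Icc_at)
      have lin: "linear (dir_deriv ?\<phi> x)" if "x \<in> ?O" for x
        using differentiable_transition[OF d e that] by (rule linear_dir_deriv)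
      have linH: "linear ?H"
        by (rule linear_dir_deriv_family[OF O]) (use lin \<phi>' in auto)
      have "((\<lambda>t. dir_deriv ?\<phi> (z t) (y t)) has_derivative
          (\<lambda>h. h *\<^sub>R ?H (y t) + dir_deriv ?\<phi> (z t) (h *\<^sub>R - \<Gamma> d (z t) b (y t)))) (at t within z -` ?O)"
      proof (rule has_derivative_linear_family[where L = "\<lambda>t. dir_deriv ?\<phi> (z t)"])
        show "((\<lambda>t. dir_deriv ?\<phi> (z t) u) has_derivative (\<lambda>h. h *\<^sub>R ?H u)) (at t within z -` ?O)" for u
          using vector_derivative_diff_chain_within[OF zd has_derivative_at_withinI[OF
            frechet_derivative_works[THEN iffD1, OF \<phi>'[of u]]]]
          by (simp add: has_vector_derivative_def o_def)
        show "linear (\<lambda>u. h *\<^sub>R ?H u)" for h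
          using linH by (rule linear_compose_scale_right)
        show "(y has_derivative (\<lambda>h. h *\<^sub>R - \<Gamma> d (z t) b (y t))) (at t within z -` ?O)"
          using y_at by (auto simp: has_vector_derivative_def intro: has_derivative_at_withinI)
      qed (use lin O(2) in auto)
      then have "(V e has_derivative
          (\<lambda>h. h *\<^sub>R ?H (y t) + dir_deriv ?\<phi> (z t) (h *\<^sub>R - \<Gamma> d (z t) b (y t)))) (at t)"
        using S O(2) by (simp add: V_def at_within_open[OF _ S])
      moreover have "?H (y t) - dir_deriv ?\<phi> (z t) (\<Gamma> d (z t) b (y t))
          = - \<Gamma> e (?\<phi> (z t)) (dir_deriv ?\<phi> (z t) b) (V e t)"
        using Gamma_transition[OF d e O(2), of b "y t"] by (simp add: V_def)
      moreover have "h *\<^sub>R ?H (y t) + dir_deriv ?\<phi> (z t) (h *\<^sub>R - \<Gamma> d (z t) b (y t))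
          = h *\<^sub>R (?H (y t) - dir_deriv ?\<phi> (z t) (\<Gamma> d (z t) b (y t)))" for h
        using lin[OF O(2)] by (simp add: linear_scale linear_neg scaleR_diff_right)
      ultimately have "(V e has_vector_derivative - \<Gamma> e (?\<phi> (z t)) (dir_deriv ?\<phi> (z t) b) (V e t)) (at t)"
        by (simp add: has_vector_derivative_def)
      moreover have "?\<phi> (z t) = snd e (\<gamma> t)" using comp[of e] by (simp add: fun_eq_iff)
      ultimately show "\<exists>D. (snd e \<circ> \<gamma> has_vector_derivative D) (at t) \<and>
          (V e has_vector_derivative - \<Gamma> e (snd e (\<gamma> t)) D (V e t)) (at t)"
        using chart_d[OF e t(2) te, of UNIV] by auto
    qed simp
    moreover have "V d 0 = v" "V d 1 = Y 1 *v v"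
      using dir_deriv_transition_self[OF d \<gamma>_in, of 0] dir_deriv_transition_self[OF d \<gamma>_in, of 1]
        chart_\<gamma>[of 0] chart_\<gamma>[of 1] by (simp_all add: V_def y_def Y0)
    ultimately show ?thesis by blast
  qed
  with pw show ?thesis
    unfolding path_transport_def using d \<gamma>_in[of 0] \<gamma>_in[of 1]
    by (intro conjI exI[of _ \<gamma>] allI) (simp_all add: \<gamma>_def z_def)
qed

lemma path_transport_segment:
  assumes d: "d \<in> A" and l: "0 \<le> l" and x: "\<And>t. t \<in> {0..l} \<Longrightarrow> a + t *\<^sub>R b \<in> codom d"
    and Y: "\<And>t. t \<in> {0..l} \<Longrightarrow>
      (Y has_vector_derivative - matrix (\<Gamma> d (a + t *\<^sub>R b) b) ** Y t) (at t within {0..l})"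
    and Y0: "Y 0 = mat 1"
  shows "path_transport A \<Gamma> (point d a) d (point d (a + l *\<^sub>R b)) d (Y l)"
proof -
  have sub: "l * t \<in> {0..l}" if "t \<in> {0..1}" for t using that l by (auto simp: mult_left_le)
  have eq: "a + (l * t) *\<^sub>R b = a + t *\<^sub>R l *\<^sub>R b" for t by (simp add: mult.commute)
  have sc: "matrix (\<Gamma> d x (l *\<^sub>R b)) = l *\<^sub>R matrix (\<Gamma> d x b)" if "x \<in> codom d" for x
    using bilinear_lmul[OF bilinear_Gamma[OF d that]] by (simp add: matrix_def vec_eq_iff)
  have "path_transport A \<Gamma> (point d a) d (point d (a + l *\<^sub>R b)) d (Y (l * 1 + 0))"
  proof (rule path_transport_unit_segment[OF d, where Y = "\<lambda>t. Y (l * t + 0)"])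
    fix t :: real assume t: "t \<in> {0..1}"
    show "a + t *\<^sub>R l *\<^sub>R b \<in> codom d" using x[OF sub[OF t]] by (simp only: eq)
    have "((\<lambda>t. Y (l * t + 0)) has_vector_derivative l *\<^sub>R (- matrix (\<Gamma> d (a + (l * t) *\<^sub>R b) b) ** Y (l * t))) (at t within {0..1})"
      using Y[OF sub[OF t]] sub by (intro has_vector_derivative_affine[of _ _ _ _ _ "{0..l}"]) auto
    then show "((\<lambda>t. Y (l * t + 0)) has_vector_derivative
        - matrix (\<Gamma> d (a + t *\<^sub>R l *\<^sub>R b) (l *\<^sub>R b)) ** Y (l * t + 0)) (at t within {0..1})"
      using sc[OF x[OF sub[OF t]]] unfolding eq
      by (simp add: matrix_mult.minus_left matrix_mult.scaleR_left)
  qed (simp add: Y0)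
  then show ?thesis by simp
qed

end

section \<open>Curvature from small loops\<close>

context connection_atlas begin

definition Gamma_matrix :: "('a, 'n) chart \<Rightarrow> real ^ 'n \<Rightarrow> real ^ 'n \<Rightarrow> real ^ 'n ^ 'n" where
  "Gamma_matrix d u x = matrix (\<Gamma> d x u)"

definition dGamma_matrix :: "('a, 'n) chart \<Rightarrow> real ^ 'n \<Rightarrow> real ^ 'n \<Rightarrow> real ^ 'n \<Rightarrow> real ^ 'n ^ 'n" where
  "dGamma_matrix d u x v = matrix (\<lambda>w. dir_deriv (\<lambda>y. \<Gamma> d y u w) x v)"

lemma Gamma_matrix_apply: "d \<in> A \<Longrightarrow> x \<in> codom d \<Longrightarrow> Gamma_matrix d u x *v w = \<Gamma> d x u w"
  unfolding Gamma_matrix_def by (rule matrix_linear[OF linear_Gamma])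

lemma dGamma_matrix_apply:
  assumes d: "d \<in> A" and x: "x \<in> codom d"
  shows "dGamma_matrix d u x v *v w = dir_deriv (\<lambda>y. \<Gamma> d y u w) x v"
  unfolding dGamma_matrix_def
  by (rule matrix_linear[OF linear_dir_deriv_family[OF open_codom[OF d] x]])
    (use linear_Gamma[OF d] smooth_onD(2)[OF smooth_Gamma[OF d] x] in auto)

lemma Gamma_matrix_scaleR: "d \<in> A \<Longrightarrow> x \<in> codom d \<Longrightarrow> matrix (\<Gamma> d x (r *\<^sub>R u)) = r *\<^sub>R Gamma_matrix d u x"
  by (simp add: Gamma_matrix_def matrix_def vec_eq_iff bilinear_lmul[OF bilinear_Gamma])

lemma continuous_on_Gamma_matrix: "d \<in> A \<Longrightarrow> continuous_on (codom d) (Gamma_matrix d u)"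
  unfolding Gamma_matrix_def[abs_def]
  by (rule matrix_continuous_on[OF smooth_onD(1)[OF smooth_Gamma]])

lemma continuous_on_dGamma_matrix: "d \<in> A \<Longrightarrow> continuous_on (codom d) (\<lambda>x. dGamma_matrix d u x v)"
  unfolding dGamma_matrix_def[abs_def]
  by (rule matrix_continuous_on[OF smooth_onD(1)[OF smooth_onD(3)[OF smooth_Gamma]]])

lemma Gamma_matrix_along_line:
  assumes d: "d \<in> A" and z: "(z has_vector_derivative r *\<^sub>R v) (at t within S)" "z t \<in> codom d"
  shows "((\<lambda>t. Gamma_matrix d u (z t)) has_vector_derivative r *\<^sub>R dGamma_matrix d u (z t) v) (at t within S)"
proof -
  have D: "((\<lambda>y. \<Gamma> d y u w) has_derivative dir_deriv (\<lambda>y. \<Gamma> d y u w) (z t)) (at (z t))" for w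
    using smooth_onD(2)[OF smooth_Gamma[OF d] z(2)] frechet_derivative_works by blast
  have "((\<lambda>t. matrix (\<Gamma> d (z t) u)) has_vector_derivative
      matrix (\<lambda>w. dir_deriv (\<lambda>y. \<Gamma> d y u w) (z t) (r *\<^sub>R v))) (at t within S)"
    using vector_derivative_diff_chain_within[OF z(1) has_derivative_at_withinI[OF D]]
    by (intro matrix_has_vector_derivative) (simp add: o_def)
  moreover have "matrix (\<lambda>w. dir_deriv (\<lambda>y. \<Gamma> d y u w) (z t) (r *\<^sub>R v)) = r *\<^sub>R dGamma_matrix d u (z t) v"
    using linear_scale[OF has_derivative_linear[OF D]]
    by (simp add: dGamma_matrix_def matrix_def vec_eq_iff)
  ultimately show ?thesis by (simp add: Gamma_matrix_def)
qed

lemma path_transport_nearby: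
  assumes d: "d \<in> A" and b: "\<And>t. t \<in> {0..1} \<Longrightarrow> x + t *\<^sub>R b \<in> codom d"
  shows "\<exists>P Q. path_transport A \<Gamma> (point d x) d (point d (x + b)) d P \<and> Q ** P = mat 1 \<and> P ** Q = mat 1"
proof -
  \<comment> \<open>A single segment: the parameter \<open>t\<close> is a dummy that ranges over the degenerate interval \<open>{0..0}\<close>.\<close>
  let ?A = "\<lambda>s t. - Gamma_matrix d b (x + s *\<^sub>R b)"
  have "continuous_on {0..1} (\<lambda>s. Gamma_matrix d b (x + s *\<^sub>R b))"
    by (rule continuous_on_compose2[OF continuous_on_Gamma_matrix[OF d]])
      (use b in \<open>auto intro!: continuous_intros\<close>)
  then have c: "continuous_on ({0..1} \<times> {0..0 :: real}) (\<lambda>(s, t). ?A s t)"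
    unfolding case_prod_unfold
    by (intro continuous_on_minus, elim continuous_on_compose2) (auto intro!: continuous_intros)
  obtain U U' Z Z' where U: "\<And>t. t \<in> {0..0} \<Longrightarrow> U 0 t = mat 1" "\<And>t. t \<in> {0..0} \<Longrightarrow> U' 0 t = 0"
    "\<And>s t. s \<in> {0..1} \<Longrightarrow> t \<in> {0..0} \<Longrightarrow>
      ((\<lambda>s. U s t) has_vector_derivative ?A s t ** U s t) (at s within {0..1})"
    "\<And>s t. s \<in> {0..1} \<Longrightarrow> t \<in> {0..0} \<Longrightarrow>
      ((\<lambda>s. U' s t) has_vector_derivative 0 ** U s t + ?A s t ** U' s t) (at s within {0..1})"
    "\<And>s t. s \<in> {0..1} \<Longrightarrow> t \<in> {0..0} \<Longrightarrow> ((\<lambda>t. U s t) has_vector_derivative U' s t) (at t within {0..0})"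
    "\<And>s t. s \<in> {0..1} \<Longrightarrow> t \<in> {0..0} \<Longrightarrow> ((\<lambda>t. Z s t) has_vector_derivative Z' s t) (at t within {0..0})"
    "\<And>s. s \<in> {0..1} \<Longrightarrow> continuous_on {0..0} (U' s)" "\<And>s. s \<in> {0..1} \<Longrightarrow> continuous_on {0..0} (Z' s)"
    "\<And>s t. s \<in> {0..1} \<Longrightarrow> t \<in> {0..0} \<Longrightarrow> Z s t ** U s t = mat 1"
    "\<And>s t. s \<in> {0..1} \<Longrightarrow> t \<in> {0..0} \<Longrightarrow> U s t ** Z s t = mat 1"
    by (rule fundamental_matrix_C1_in_parameter[OF zero_le_one c, of "\<lambda>s t. 0"])
      (simp, simp, rule that)
  have "path_transport A \<Gamma> (point d x) d (point d (x + b)) d (U 1 0)"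
    by (rule path_transport_unit_segment[OF d b, of "\<lambda>s. U s 0"])
      (use U(1)[of 0] U(3)[of _ 0] in \<open>auto simp: Gamma_matrix_def\<close>)
  with U(9)[of 1 0] U(10)[of 1 0] show ?thesis by (intro exI[of _ "U 1 0"] exI[of _ "Z 1 0"]) simp
qed

text \<open>The side \<open>t v\<close> of a rectangle. Run over in unit time, its transport equation has coefficient
\<open>- t \<Gamma>\<^sub>v\<close>, which vanishes at \<open>t = 0\<close>; this determines the \<open>t\<close>-derivative there, for both signs of \<open>t\<close>.\<close>

lemma path_transport_short_edge:
  assumes d: "d \<in> A" and \<delta>: "0 < \<delta>" and x: "\<And>t. t \<in> {-\<delta>..\<delta>} \<Longrightarrow> x + t *\<^sub>R v \<in> codom d"
  obtains Y Y' X X' where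
    "\<And>t. t \<in> {-\<delta>..\<delta>} \<Longrightarrow> path_transport A \<Gamma> (point d x) d (point d (x + t *\<^sub>R v)) d (Y t)"
    "\<And>t. t \<in> {-\<delta>..\<delta>} \<Longrightarrow> X t ** Y t = mat 1" "\<And>t. t \<in> {-\<delta>..\<delta>} \<Longrightarrow> Y t ** X t = mat 1"
    "\<And>t. t \<in> {-\<delta>..\<delta>} \<Longrightarrow> (Y has_vector_derivative Y' t) (at t within {-\<delta>..\<delta>})"
    "\<And>t. t \<in> {-\<delta>..\<delta>} \<Longrightarrow> (X has_vector_derivative X' t) (at t within {-\<delta>..\<delta>})"
    "continuous_on {-\<delta>..\<delta>} Y'" "continuous_on {-\<delta>..\<delta>} X'"
    "Y 0 = mat 1" "Y' 0 = - Gamma_matrix d v x"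
proof -
  let ?z = "\<lambda>s t. x + (s * t) *\<^sub>R v" and ?I = "{-\<delta>..\<delta>}"
  let ?A = "\<lambda>s t. - (t *\<^sub>R Gamma_matrix d v (?z s t))"
  let ?A' = "\<lambda>s t. - (Gamma_matrix d v (?z s t) + t *\<^sub>R s *\<^sub>R dGamma_matrix d v (?z s t) v)"
  have z: "?z s t \<in> codom d" if "s \<in> {0..1}" "t \<in> ?I" for s t
  proof -
    have "s * \<bar>t\<bar> \<le> 1 * \<bar>t\<bar>" using that by (intro mult_right_mono) auto
    moreover have "\<bar>t\<bar> \<le> \<delta>" using that(2) by (auto simp: abs_le_iff)
    ultimately have "\<bar>s * t\<bar> \<le> \<delta>" using that(1) by (simp add: abs_mult)
    then show ?thesis by (intro x) auto
  qed
  have zc: "continuous_on ({0..1} \<times> ?I) (\<lambda>p. ?z (fst p) (snd p))" by (intro continuous_intros)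
  have "(\<lambda>p. ?z (fst p) (snd p)) ` ({0..1} \<times> ?I) \<subseteq> codom d" using z by auto
  note G = continuous_on_compose2[OF continuous_on_Gamma_matrix[OF d] zc this]
    and dG = continuous_on_compose2[OF continuous_on_dGamma_matrix[OF d] zc this]
  have cA: "continuous_on ({0..1} \<times> ?I) (\<lambda>(s, t). ?A s t)"
    and cA': "continuous_on ({0..1} \<times> ?I) (\<lambda>(s, t). ?A' s t)"
    unfolding case_prod_unfold by (intro continuous_intros G dG)+
  have der: "((\<lambda>t. ?A s t) has_vector_derivative ?A' s t) (at t within ?I)"
    if st: "s \<in> {0..1}" "t \<in> ?I" for s t
  proof -
    have zd: "((\<lambda>t. ?z s t) has_vector_derivative s *\<^sub>R v) (at t within ?I)"
      by (auto intro!: derivative_eq_intros simp: has_vector_derivative_def algebra_simps)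
    have "((\<lambda>t. t) has_vector_derivative 1) (at t within ?I)" by simp
    from bounded_bilinear.has_vector_derivative[OF bounded_bilinear_scaleR this
        Gamma_matrix_along_line[OF d zd z[OF st], of v]]
    have "((\<lambda>t. t *\<^sub>R Gamma_matrix d v (?z s t)) has_vector_derivative
        t *\<^sub>R s *\<^sub>R dGamma_matrix d v (?z s t) v + 1 *\<^sub>R Gamma_matrix d v (?z s t)) (at t within ?I)" .
    from has_vector_derivative_minus[OF this] show ?thesis by (simp add: add.commute)
  qed
  obtain U U' Z Z' where U: "\<And>t. t \<in> ?I \<Longrightarrow> U 0 t = mat 1" "\<And>t. t \<in> ?I \<Longrightarrow> U' 0 t = 0"
    "\<And>s t. s \<in> {0..1} \<Longrightarrow> t \<in> ?I \<Longrightarrow>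
      ((\<lambda>s. U s t) has_vector_derivative ?A s t ** U s t) (at s within {0..1})"
    "\<And>s t. s \<in> {0..1} \<Longrightarrow> t \<in> ?I \<Longrightarrow>
      ((\<lambda>s. U' s t) has_vector_derivative ?A' s t ** U s t + ?A s t ** U' s t) (at s within {0..1})"
    "\<And>s t. s \<in> {0..1} \<Longrightarrow> t \<in> ?I \<Longrightarrow> ((\<lambda>t. U s t) has_vector_derivative U' s t) (at t within ?I)"
    "\<And>s t. s \<in> {0..1} \<Longrightarrow> t \<in> ?I \<Longrightarrow> ((\<lambda>t. Z s t) has_vector_derivative Z' s t) (at t within ?I)"
    "\<And>s. s \<in> {0..1} \<Longrightarrow> continuous_on ?I (U' s)" "\<And>s. s \<in> {0..1} \<Longrightarrow> continuous_on ?I (Z' s)"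
    "\<And>s t. s \<in> {0..1} \<Longrightarrow> t \<in> ?I \<Longrightarrow> Z s t ** U s t = mat 1"
    "\<And>s t. s \<in> {0..1} \<Longrightarrow> t \<in> ?I \<Longrightarrow> U s t ** Z s t = mat 1"
    by (rule fundamental_matrix_C1_in_parameter[OF zero_le_one cA cA'])
      (rule der, assumption, assumption, rule that)
  have 0: "0 \<in> ?I" and 1: "(1 :: real) \<in> {0..1}" using \<delta> by auto
  have d0: "((\<lambda>s. U s 0) has_vector_derivative 0) (at s within {0..1})" if "s \<in> {0..1}" for s
    using U(3)[OF that 0] by simp
  obtain C where C: "\<And>s. s \<in> {0..1} \<Longrightarrow> U s 0 = C"
    by (rule has_vector_derivative_zero_constant[OF convex_real_interval(5) d0]) (assumption, rule that)
  have U0: "U s 0 = mat 1" if "s \<in> {0..1}" for s using C[OF that] C[of 0] U(1)[OF 0] by simp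
  have d1: "((\<lambda>s. U' s 0 + s *\<^sub>R Gamma_matrix d v x) has_vector_derivative 0) (at s within {0..1})"
    if "s \<in> {0..1}" for s
    using U(4)[OF that 0] U0[OF that]
    by (auto intro!: derivative_eq_intros simp: matrix_mult.minus_left)
  obtain C' where C': "\<And>s. s \<in> {0..1} \<Longrightarrow> U' s 0 + s *\<^sub>R Gamma_matrix d v x = C'"
    by (rule has_vector_derivative_zero_constant[OF convex_real_interval(5) d1]) (assumption, rule that)
  have U'0: "U' 1 0 = - Gamma_matrix d v x"
    using C'[of 0] C'[of 1] U(2)[OF 0] by (simp add: eq_neg_iff_add_eq_0)
  show ?thesis
  proof (rule that[of "U 1" "Z 1" "U' 1" "Z' 1"])
    fix t assume t: "t \<in> ?I"
    show "path_transport A \<Gamma> (point d x) d (point d (x + t *\<^sub>R v)) d (U 1 t)"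
    proof (rule path_transport_unit_segment[OF d, of _ _ "\<lambda>s. U s t"])
      fix s :: real assume s: "s \<in> {0..1}"
      show zz: "x + s *\<^sub>R t *\<^sub>R v \<in> codom d" using z[OF s t] by simp
      show "((\<lambda>s. U s t) has_vector_derivative
          - matrix (\<Gamma> d (x + s *\<^sub>R t *\<^sub>R v) (t *\<^sub>R v)) ** U s t) (at s within {0..1})"
        using U(3)[OF s t] unfolding Gamma_matrix_scaleR[OF d zz] by simp
    qed (rule U(1)[OF t])
  qed (use U(5-10)[OF 1] U0[OF 1] U'0 in auto)
qed

text \<open>The loop \<open>E t\<close> runs from \<open>x\<close> to \<open>x + s u\<close>, then along \<open>t v\<close>, back along \<open>- s u\<close>, and back along \<open>- t v\<close>. With
\<open>U s t\<close> the transport from \<open>x + t v\<close> to \<open>x + t v + s u\<close>, the condition \<open>E' 0 = 0\<close> reads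
\<open>U \<Gamma>\<^sub>v(x) = \<partial>\<^sub>t U + \<Gamma>\<^sub>v(x + s u) U\<close> at \<open>t = 0\<close>. All its terms satisfy known differential equations in \<open>s\<close>;
their derivatives at \<open>s = 0\<close> combine to the curvature.\<close>

lemma curvature_zero_of_trivial_loops:
  assumes d: "d \<in> A" and x: "x \<in> codom d"
    and loops: "\<And>\<delta> E E'. 0 < \<delta> \<Longrightarrow>
      (\<And>t. t \<in> {-\<delta><..<\<delta>} \<Longrightarrow> path_transport A \<Gamma> (point d x) d (point d x) d (E t)) \<Longrightarrow>
      (\<And>t. t \<in> {-\<delta><..<\<delta>} \<Longrightarrow> (E has_vector_derivative E' t) (at t)) \<Longrightarrow>
      continuous_on {-\<delta><..<\<delta>} E' \<Longrightarrow> E 0 = mat 1 \<Longrightarrow> E' 0 = 0"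
  shows "curvature \<Gamma> d x u v w = 0"
proof -
  obtain r where r: "r > 0" "cball x r \<subseteq> codom d"
    using open_contains_cball[THEN iffD1, OF open_codom[OF d]] x by blast
  \<comment> \<open>This bound keeps all rectangles with sides at most \<open>\<delta>\<close> inside the ball; the summand \<open>1\<close> covers \<open>u = v = 0\<close>.\<close>
  define \<delta> where "\<delta> = r / (norm u + norm v + 1)"
  have \<delta>: "\<delta> > 0" using r(1) by (simp add: \<delta>_def add_nonneg_pos)
  let ?I = "{-\<delta>..\<delta>}" and ?J = "{0..\<delta>}"
  let ?z = "\<lambda>s t. x + t *\<^sub>R v + s *\<^sub>R u"
  have z: "?z s t \<in> codom d" if "s \<in> ?J" "t \<in> ?I" for s t
  proof -
    have "norm (t *\<^sub>R v + s *\<^sub>R u) \<le> \<bar>t\<bar> * norm v + \<bar>s\<bar> * norm u"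
      by (rule order_trans[OF norm_triangle_ineq]) simp
    also have "\<dots> \<le> \<delta> * norm v + \<delta> * norm u"
      using that by (intro add_mono mult_right_mono) auto
    also have "\<dots> \<le> \<delta> * (norm u + norm v + 1)" using \<delta> by (simp add: algebra_simps)
    also have "\<dots> = r" unfolding \<delta>_def
      using norm_ge_zero[of u] norm_ge_zero[of v] by (simp add: add_nonneg_eq_0_iff)
    finally have "dist x (?z s t) \<le> r"
      by (subst dist_commute) (simp add: dist_norm add.assoc)
    then show ?thesis using r(2) by (meson mem_cball subsetD)
  qed
  let ?A = "\<lambda>s t. - Gamma_matrix d u (?z s t)"
  let ?A' = "\<lambda>s t. - dGamma_matrix d u (?z s t) v"
  have zc: "continuous_on (?J \<times> ?I) (\<lambda>p. ?z (fst p) (snd p))" by (intro continuous_intros)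
  have "(\<lambda>p. ?z (fst p) (snd p)) ` (?J \<times> ?I) \<subseteq> codom d" using z by auto
  note G = continuous_on_compose2[OF continuous_on_Gamma_matrix[OF d] zc this]
    and dG = continuous_on_compose2[OF continuous_on_dGamma_matrix[OF d] zc this]
  have cA: "continuous_on (?J \<times> ?I) (\<lambda>(s, t). ?A s t)"
    and cA': "continuous_on (?J \<times> ?I) (\<lambda>(s, t). ?A' s t)"
    unfolding case_prod_unfold by (intro continuous_intros G dG)+
  have der: "((\<lambda>t. ?A s t) has_vector_derivative ?A' s t) (at t within ?I)"
    if st: "s \<in> ?J" "t \<in> ?I" for s t
  proof -
    have zd: "((\<lambda>t. ?z s t) has_vector_derivative 1 *\<^sub>R v) (at t within ?I)"
      by (auto intro!: derivative_eq_intros)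
    from has_vector_derivative_minus[OF Gamma_matrix_along_line[OF d zd z[OF st], of u]]
    show ?thesis by simp
  qed
  obtain U U' Z Z' where U: "\<And>t. t \<in> ?I \<Longrightarrow> U 0 t = mat 1" "\<And>t. t \<in> ?I \<Longrightarrow> U' 0 t = 0"
    "\<And>s t. s \<in> ?J \<Longrightarrow> t \<in> ?I \<Longrightarrow>
      ((\<lambda>s. U s t) has_vector_derivative ?A s t ** U s t) (at s within ?J)"
    "\<And>s t. s \<in> ?J \<Longrightarrow> t \<in> ?I \<Longrightarrow>
      ((\<lambda>s. U' s t) has_vector_derivative ?A' s t ** U s t + ?A s t ** U' s t) (at s within ?J)"
    "\<And>s t. s \<in> ?J \<Longrightarrow> t \<in> ?I \<Longrightarrow> ((\<lambda>t. U s t) has_vector_derivative U' s t) (at t within ?I)"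
    "\<And>s t. s \<in> ?J \<Longrightarrow> t \<in> ?I \<Longrightarrow> ((\<lambda>t. Z s t) has_vector_derivative Z' s t) (at t within ?I)"
    "\<And>s. s \<in> ?J \<Longrightarrow> continuous_on ?I (U' s)" "\<And>s. s \<in> ?J \<Longrightarrow> continuous_on ?I (Z' s)"
    "\<And>s t. s \<in> ?J \<Longrightarrow> t \<in> ?I \<Longrightarrow> Z s t ** U s t = mat 1"
    "\<And>s t. s \<in> ?J \<Longrightarrow> t \<in> ?I \<Longrightarrow> U s t ** Z s t = mat 1"
    by (rule fundamental_matrix_C1_in_parameter[OF less_imp_le[OF \<delta>] cA cA'])
      (rule der, assumption, assumption, rule that)
  have 0: "0 \<in> ?I" "0 \<in> ?J" using \<delta> by auto
  have transport_U: "path_transport A \<Gamma> (point d (x + t *\<^sub>R v)) d (point d (?z s t)) d (U s t)"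
    if s: "s \<in> ?J" and t: "t \<in> ?I" for s t
  proof (rule path_transport_segment[OF d, of s _ _ "\<lambda>s. U s t"])
    fix \<sigma> assume \<sigma>: "\<sigma> \<in> {0..s}"
    then have \<sigma>': "\<sigma> \<in> ?J" using s by auto
    show "?z \<sigma> t \<in> codom d" by (rule z[OF \<sigma>' t])
    show "((\<lambda>s. U s t) has_vector_derivative - matrix (\<Gamma> d (?z \<sigma> t) u) ** U \<sigma> t) (at \<sigma> within {0..s})"
      using has_vector_derivative_within_subset[OF U(3)[OF \<sigma>' t], of "{0..s}"] s
      by (auto simp: Gamma_matrix_def)
  qed (use s U(1)[OF t] in auto)
  have key: "U s 0 ** Gamma_matrix d v x = U' s 0 + Gamma_matrix d v (x + s *\<^sub>R u) ** U s 0"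
    if s: "s \<in> ?J" for s
  proof -
    have xs: "x + s *\<^sub>R u + t *\<^sub>R v \<in> codom d" if "t \<in> ?I" for t
      using z[OF s that] by (simp add: algebra_simps)
    have x0: "x + t *\<^sub>R v \<in> codom d" if "t \<in> ?I" for t
      using z[OF 0(2) that] by simp
    obtain Y Y' X X' where Y:
      "\<And>t. t \<in> ?I \<Longrightarrow> path_transport A \<Gamma> (point d x) d (point d (x + t *\<^sub>R v)) d (Y t)"
      "\<And>t. t \<in> ?I \<Longrightarrow> X t ** Y t = mat 1" "\<And>t. t \<in> ?I \<Longrightarrow> Y t ** X t = mat 1"
      "\<And>t. t \<in> ?I \<Longrightarrow> (Y has_vector_derivative Y' t) (at t within ?I)"
      "\<And>t. t \<in> ?I \<Longrightarrow> (X has_vector_derivative X' t) (at t within ?I)"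
      "continuous_on ?I Y'" "continuous_on ?I X'" "Y 0 = mat 1" "Y' 0 = - Gamma_matrix d v x"
      by (rule path_transport_short_edge[OF d \<delta> x0]) (assumption, rule that)
    obtain W W' where W:
      "\<And>t. t \<in> ?I \<Longrightarrow> path_transport A \<Gamma> (point d (x + s *\<^sub>R u)) d (point d (x + s *\<^sub>R u + t *\<^sub>R v)) d (W t)"
      "\<And>t. t \<in> ?I \<Longrightarrow> (W has_vector_derivative W' t) (at t within ?I)"
      "continuous_on ?I W'" "W 0 = mat 1" "W' 0 = - Gamma_matrix d v (x + s *\<^sub>R u)"
      by (rule path_transport_short_edge[OF d \<delta> xs]) (assumption, rule that)
    \<comment> \<open>Read from right to left: the four sides of the rectangle in the order in which the loop runs.\<close>
    define E where "E = (\<lambda>t. ((X t ** Z s t) ** W t) ** U s 0)"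
    define E' where "E' = (\<lambda>t. ((X t ** Z s t) ** W' t + (X t ** Z' s t + X' t ** Z s t) ** W t) ** U s 0)"
    have E: "(E has_vector_derivative E' t) (at t within ?I)" if t: "t \<in> ?I" for t
      using matrix_mult.has_vector_derivative[OF matrix_mult.has_vector_derivative[OF
          matrix_mult.has_vector_derivative[OF Y(5)[OF t] U(6)[OF s t]] W(2)[OF t]]
          has_vector_derivative_const[of "U s 0"]]
      unfolding E_def E'_def by simp
    have cont: "continuous_on ?I X" "continuous_on ?I (Z s)" "continuous_on ?I W"
      by (rule continuous_on_vector_derivative[OF Y(5)] continuous_on_vector_derivative[OF U(6)[OF s]]
          continuous_on_vector_derivative[OF W(2)], assumption)+
    have cE': "continuous_on ?I E'"
      unfolding E'_def by (intro continuous_on_add matrix_mult.continuous_on cont W(3) Y(7) U(8)[OF s] continuous_on_const)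
    have X0: "X 0 = mat 1" using Y(2)[OF 0(1)] Y(8) by simp
    have ZU: "Z s 0 ** U s 0 = mat 1" "U s 0 ** Z s 0 = mat 1" using U(9,10)[OF s 0(1)] .
    have "E' 0 = 0"
    proof (rule loops[OF \<delta>])
      fix t assume t: "t \<in> {-\<delta><..<\<delta>}"
      then have t': "t \<in> ?I" by auto
      show "(E has_vector_derivative E' t) (at t)"
        using E[OF t'] t by (simp add: at_within_Icc_at)
      have comm: "x + s *\<^sub>R u + t *\<^sub>R v = ?z s t" by (simp add: algebra_simps)
      have "path_transport A \<Gamma> (point d x) d (point d (x + s *\<^sub>R u)) d (U s 0)"
        using transport_U[OF s 0(1)] by simp
      from path_transport_join[OF this W(1)[OF t'] linear_connection]
      have 1: "path_transport A \<Gamma> (point d x) d (point d (?z s t)) d (W t ** U s 0)" unfolding comm .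
      have 2: "path_transport A \<Gamma> (point d (?z s t)) d (point d (x + t *\<^sub>R v)) d (Z s t)"
        by (rule path_transport_reverse[OF transport_U[OF s t'] U(10)[OF s t'] linear_connection])
      have 3: "path_transport A \<Gamma> (point d (x + t *\<^sub>R v)) d (point d x) d (X t)"
        by (rule path_transport_reverse[OF Y(1)[OF t'] Y(3)[OF t'] linear_connection])
      have "path_transport A \<Gamma> (point d x) d (point d x) d (X t ** (Z s t ** (W t ** U s 0)))"
        by (rule path_transport_join[OF path_transport_join[OF 1 2 linear_connection] 3 linear_connection])
      then show "path_transport A \<Gamma> (point d x) d (point d x) d (E t)"
        by (simp add: E_def matrix_mul_assoc)
    next
      show "continuous_on {-\<delta><..<\<delta>} E'" using cE' by (rule continuous_on_subset) auto
      show "E 0 = mat 1" by (simp add: E_def X0 W(4) ZU)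
    qed
    then have eq: "(X' 0 ** Z s 0 + Z' s 0 - Z s 0 ** Gamma_matrix d v (x + s *\<^sub>R u)) ** U s 0 = 0"
      by (simp add: E'_def X0 W(4,5) matrix_mult.minus_right algebra_simps)
    have triv: "at 0 within ?I \<noteq> bot" using \<delta> by (simp add: at_within_Icc_at)
    \<comment> \<open>The derivatives of the inverses \<open>X\<close> and \<open>Z\<close> come from differentiating \<open>X Y = 1\<close> and \<open>Z U = 1\<close>.\<close>
    have "((\<lambda>t. X t ** Y t) has_vector_derivative X 0 ** Y' 0 + X' 0 ** Y 0) (at 0 within ?I)"
      by (rule matrix_mult.has_vector_derivative[OF Y(5)[OF 0(1)] Y(4)[OF 0(1)]])
    moreover have "((\<lambda>t. X t ** Y t) has_vector_derivative 0) (at 0 within ?I)"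
      by (rule has_vector_derivative_transform[OF 0(1) _ has_vector_derivative_const[of "mat 1"]]) (rule Y(2))
    ultimately have X'0: "X' 0 = Gamma_matrix d v x"
      using vector_derivative_unique_within[OF triv] Y(8,9) X0 by fastforce
    have "((\<lambda>t. Z s t ** U s t) has_vector_derivative Z s 0 ** U' s 0 + Z' s 0 ** U s 0) (at 0 within ?I)"
      by (rule matrix_mult.has_vector_derivative[OF U(6)[OF s 0(1)] U(5)[OF s 0(1)]])
    moreover have "((\<lambda>t. Z s t ** U s t) has_vector_derivative 0) (at 0 within ?I)"
      by (rule has_vector_derivative_transform[OF 0(1) _ has_vector_derivative_const[of "mat 1"]]) (rule U(9)[OF s])
    ultimately have Z'0: "Z' s 0 ** U s 0 = - (Z s 0 ** U' s 0)"
      using vector_derivative_unique_within[OF triv] by (metis add.commute add_eq_0_iff)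
    have "Gamma_matrix d v x = Z s 0 ** (U' s 0 + Gamma_matrix d v (x + s *\<^sub>R u) ** U s 0)"
      using eq by (simp add: X'0 matrix_mult.add_left matrix_mult.diff_left matrix_mult.add_right Z'0
          matrix_mul_assoc[symmetric] ZU algebra_simps)
    then have "U s 0 ** Gamma_matrix d v x
        = (U s 0 ** Z s 0) ** (U' s 0 + Gamma_matrix d v (x + s *\<^sub>R u) ** U s 0)"
      by (simp add: matrix_mul_assoc)
    then show ?thesis by (simp add: ZU)
  qed
  let ?M = "Gamma_matrix d" and ?D = "dGamma_matrix d"
  have "((\<lambda>s. U s 0 ** ?M v x) has_vector_derivative
      U 0 0 ** 0 + (?A 0 0 ** U 0 0) ** ?M v x) (at 0 within ?J)"
    by (rule matrix_mult.has_vector_derivative[OF U(3)[OF 0(2,1)] has_vector_derivative_const])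
  then have lhs: "((\<lambda>s. U s 0 ** ?M v x) has_vector_derivative - ?M u x ** ?M v x) (at 0 within ?J)"
    by (simp add: U(1)[OF 0(1)])
  have "((\<lambda>s. x + s *\<^sub>R u) has_vector_derivative 1 *\<^sub>R u) (at 0 within ?J)"
    by (auto intro!: derivative_eq_intros)
  from Gamma_matrix_along_line[OF d this, of v] x
  have "((\<lambda>s. ?M v (x + s *\<^sub>R u)) has_vector_derivative ?D v x u) (at 0 within ?J)" by simp
  from has_vector_derivative_add[OF U(4)[OF 0(2,1)] matrix_mult.has_vector_derivative[OF this U(3)[OF 0(2,1)]]]
  have "((\<lambda>s. U' s 0 + ?M v (x + s *\<^sub>R u) ** U s 0) has_vector_derivative
      - ?D u x v + (?M v x ** - ?M u x + ?D v x u)) (at 0 within ?J)"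
    by (simp add: U(1,2)[OF 0(1)])
  then have rhs: "((\<lambda>s. U s 0 ** ?M v x) has_vector_derivative
      - ?D u x v + (?M v x ** - ?M u x + ?D v x u)) (at 0 within ?J)"
    by (rule has_vector_derivative_transform[OF 0(2), rotated]) (rule key)
  have "at 0 within ?J \<noteq> bot" using \<delta> by (simp add: at_within_Icc_at_right trivial_limit_at_right_real)
  from vector_derivative_unique_within[OF this lhs rhs]
  have "?D v x u - ?D u x v + ?M u x ** ?M v x - ?M v x ** ?M u x = 0"
    by (simp add: matrix_mult.minus_left matrix_mult.minus_right algebra_simps)
  then have "(?D v x u - ?D u x v + ?M u x ** ?M v x - ?M v x ** ?M u x) *v w = 0" by simp
  then show ?thesis
    by (simp add: curvature_def matrix_vector_mult_add_rdistrib matrix_vector_mult_diff_rdistrib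
        matrix_vector_mul_assoc[symmetric] Gamma_matrix_apply[OF d x] dGamma_matrix_apply[OF d x]
        del: matrix_vector_mul_assoc)
qed

end

section \<open>Discrete holonomy forces flatness\<close>

context connection_atlas begin

text \<open>Transport with an explicit inverse, since the reversed path is needed to close up loops.\<close>

definition reachable :: "'a \<Rightarrow> ('a, 'n) chart \<Rightarrow> 'a \<Rightarrow> ('a, 'n) chart \<Rightarrow> bool" where
  "reachable p c q d \<longleftrightarrow>
     (\<exists>P Q. path_transport A \<Gamma> p c q d P \<and> Q ** P = mat 1 \<and> P ** Q = mat 1)"

lemma reachable_trans: "reachable p c q d \<Longrightarrow> reachable q d r e \<Longrightarrow> reachable p c r e"
proof -
  assume "reachable p c q d" "reachable q d r e"
  then obtain P Q P' Q' where P: "path_transport A \<Gamma> p c q d P" "Q ** P = mat 1" "P ** Q = mat 1"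
    and P': "path_transport A \<Gamma> q d r e P'" "Q' ** P' = mat 1" "P' ** Q' = mat 1"
    unfolding reachable_def by (elim exE conjE)
  have "(Q ** Q') ** (P' ** P) = Q ** (Q' ** P') ** P" "(P' ** P) ** (Q ** Q') = P' ** (P ** Q) ** Q'"
    by (simp_all add: matrix_mul_assoc)
  then show ?thesis
    unfolding reachable_def using path_transport_join[OF P(1) P'(1) linear_connection] P P'
    by (intro exI[of _ "P' ** P"] exI[of _ "Q ** Q'"]) simp
qed

lemma reachable_sym: "reachable p c q d \<Longrightarrow> reachable q d p c"
  unfolding reachable_def using path_transport_reverse linear_connection by blast

lemma reachable_nearby:
  assumes d: "d \<in> A" and q: "q \<in> fst d"
  obtains N where "open N" "q \<in> N" "N \<subseteq> fst d" "\<And>q'. q' \<in> N \<Longrightarrow> reachable q d q' d"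
proof -
  obtain r where r: "r > 0" "ball (snd d q) r \<subseteq> codom d"
    using open_contains_ball[THEN iffD1, OF open_codom[OF d]] chart_in[OF q] by blast
  show ?thesis
  proof (rule that[of "fst d \<inter> snd d -` ball (snd d q) r"])
    have "continuous_on (fst d) (snd d)" using homeo[OF d] by (simp add: homeomorphism_def)
    then show "open (fst d \<inter> snd d -` ball (snd d q) r)"
      by (rule continuous_open_preimage[OF _ open_chart[OF d] open_ball])
    fix q' assume q': "q' \<in> fst d \<inter> snd d -` ball (snd d q) r"
    have "snd d q + t *\<^sub>R (snd d q' - snd d q) \<in> codom d" if "t \<in> {0..1}" for t
    proof -
      have "(1 - t) *\<^sub>R snd d q + t *\<^sub>R snd d q' \<in> ball (snd d q) r"
        by (rule convexD_alt[OF convex_ball]) (use q' r(1) that in auto)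
      then show ?thesis using r(2) by (auto simp: algebra_simps)
    qed
    from path_transport_nearby[OF d this] show "reachable q d q' d"
      unfolding reachable_def using point_chart[OF d] q q' by simp
  qed (use q r(1) in auto)
qed

lemma reachable_refl: "d \<in> A \<Longrightarrow> q \<in> fst d \<Longrightarrow> reachable q d q d"
  using reachable_nearby by metis

lemma reachable_change_chart:
  assumes "reachable p c q d" "d \<in> A" "q \<in> fst d" "e \<in> A" "q \<in> fst e"
  shows "reachable p c q e"
proof -
  obtain P Q where "path_transport A \<Gamma> q d q d P" "Q ** P = mat 1" "P ** Q = mat 1"
    using reachable_refl[OF assms(2,3)] unfolding reachable_def by blast
  note P = path_transport_change_chart[OF this(1) assms(4,5)] this(2,3)
  let ?T = "matrix (dir_deriv (transition d e) (snd d q))" and ?S = "matrix (dir_deriv (transition e d) (snd e q))"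
  have "?S ** ?T = mat 1" "?T ** ?S = mat 1"
    using transition_matrix_inverse assms(2-5) by blast+
  moreover have "(Q ** ?S) ** (?T ** P) = Q ** (?S ** ?T) ** P" "(?T ** P) ** (Q ** ?S) = ?T ** (P ** Q) ** ?S"
    by (simp_all add: matrix_mul_assoc)
  ultimately have "reachable q d q e"
    unfolding reachable_def using P by (intro exI[of _ "?T ** P"] exI[of _ "Q ** ?S"]) simp
  with assms(1) show ?thesis by (rule reachable_trans)
qed

text \<open>Near any point, all points are reachable from it along coordinate segments. By transitivity and
symmetry the set of points reachable from \<open>p\<close> and its complement are both open.\<close>

proposition reachable_everywhere:
  assumes conn: "connected (UNIV :: 'a set)" and c: "c \<in> A" "p \<in> fst c" and d: "d \<in> A" "q \<in> fst d"
  shows "reachable p c q d"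
proof -
  define R where "R = {q. \<exists>d\<in>A. q \<in> fst d \<and> reachable p c q d}"
  have any: "reachable p c q d" if "q \<in> R" "d \<in> A" "q \<in> fst d" for q d
    using that reachable_change_chart unfolding R_def by blast
  have "open R"
  proof (subst open_subopen, intro ballI)
    fix q assume "q \<in> R"
    then obtain d where d: "d \<in> A" "q \<in> fst d" "reachable p c q d" unfolding R_def by blast
    obtain N where N: "open N" "q \<in> N" "N \<subseteq> fst d" "\<And>q'. q' \<in> N \<Longrightarrow> reachable q d q' d"
      by (rule reachable_nearby[OF d(1,2)]) (rule that)
    have "N \<subseteq> R" using N(3,4) d reachable_trans unfolding R_def by blast
    with N(1,2) show "\<exists>T. open T \<and> q \<in> T \<and> T \<subseteq> R" by blast
  qed
  moreover have "open (- R)"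
  proof (subst open_subopen, intro ballI)
    fix q assume q: "q \<in> - R"
    obtain d where d: "d \<in> A" "q \<in> fst d" using covered by blast
    obtain N where N: "open N" "q \<in> N" "N \<subseteq> fst d" "\<And>q'. q' \<in> N \<Longrightarrow> reachable q d q' d"
      by (rule reachable_nearby[OF d]) (rule that)
    have "q' \<notin> R" if q': "q' \<in> N" for q'
    proof
      assume "q' \<in> R"
      then have "reachable p c q' d" using any d(1) N(3) q' by blast
      then have "reachable p c q d" using reachable_trans reachable_sym[OF N(4)[OF q']] by blast
      with q d show False unfolding R_def by blast
    qed
    with N(1,2) show "\<exists>T. open T \<and> q \<in> T \<and> T \<subseteq> - R" by blast
  qed
  moreover have "p \<in> R" using reachable_refl[OF c] c unfolding R_def by blast
  ultimately have "R = UNIV"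
    using connectedD[OF conn, of R "- R"] by blast
  then show ?thesis using any d by blast
qed

text \<open>Conjugation by the transport \<open>P\<close> from \<open>p\<close> carries a family of loops at any point to a curve in the
holonomy group at \<open>p\<close>; its velocity at \<open>0\<close> lies in the Lie algebra, which is trivial.\<close>

theorem flat_of_discrete_holonomy:
  assumes conn: "connected (UNIV :: 'a set)" and c: "c \<in> A" "p \<in> fst c"
    and dim: "lie_group_dim (holonomy_group A \<Gamma> p c) = 0"
  shows "flat_connection A \<Gamma>"
  unfolding flat_connection_def
proof (intro ballI allI)
  fix d x u v w assume d: "d \<in> A" and x: "x \<in> codom d"
  have triv: "lie_algebra (holonomy_group A \<Gamma> p c) \<subseteq> {0}"
    using dim by (simp add: lie_group_dim_def)
  obtain P Q where P: "path_transport A \<Gamma> p c (point d x) d P" "Q ** P = mat 1" "P ** Q = mat 1"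
    using reachable_everywhere[OF conn c d point_in[OF d x]] unfolding reachable_def by blast
  show "curvature \<Gamma> d x u v w = 0"
  proof (rule curvature_zero_of_trivial_loops[OF d x])
    fix \<delta> :: real and E E' :: "real \<Rightarrow> real ^ 'n ^ 'n"
    assume \<delta>: "0 < \<delta>" and loop: "\<And>t. t \<in> {-\<delta><..<\<delta>} \<Longrightarrow> path_transport A \<Gamma> (point d x) d (point d x) d (E t)"
      and E': "\<And>t. t \<in> {-\<delta><..<\<delta>} \<Longrightarrow> (E has_vector_derivative E' t) (at t)"
      and cont: "continuous_on {-\<delta><..<\<delta>} E'" and E0: "E 0 = mat 1"
    define \<alpha> where "\<alpha> = (\<lambda>t. Q ** (E t ** P))"
    have hol: "\<alpha> t \<in> holonomy_group A \<Gamma> p c" if "t \<in> {-\<delta><..<\<delta>}" for t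
      unfolding \<alpha>_def
      by (intro path_transport_holonomy path_transport_join[OF path_transport_join[OF P(1) loop[OF that]]
            path_transport_reverse[OF P(1,3)]] linear_connection)
    have \<alpha>': "(\<alpha> has_vector_derivative Q ** (E' t ** P)) (at t)" if "t \<in> {-\<delta><..<\<delta>}" for t
      using matrix_mult.has_vector_derivative[OF has_vector_derivative_const[of Q]
          matrix_mult.has_vector_derivative[OF E'[OF that] has_vector_derivative_const[of P]]]
      by (simp add: \<alpha>_def)
    have "\<alpha> C1_differentiable_on {-\<delta><..<\<delta>}"
      unfolding C1_differentiable_on_def using \<alpha>'
      by (intro exI[of _ "\<lambda>t. Q ** (E' t ** P)"] conjI ballI matrix_mult.continuous_on cont continuous_on_const)
    moreover have "\<alpha> 0 = mat 1" by (simp add: \<alpha>_def E0 P)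
    ultimately have "vector_derivative \<alpha> (at 0) \<in> lie_algebra (holonomy_group A \<Gamma> p c)"
      unfolding lie_algebra_def using \<delta> hol by blast
    with triv have "vector_derivative \<alpha> (at 0) = 0" by blast
    then have "Q ** (E' 0 ** P) = 0"
      using vector_derivative_at[OF \<alpha>'[of 0]] \<delta> by simp
    then have "(P ** Q) ** E' 0 ** (P ** Q) = 0"
      by (metis matrix_mul_assoc times0_left times0_right)
    then show "E' 0 = 0" by (simp add: P)
  qed
qed

end

section \<open>Hermitian linear algebra\<close>

locale inner_form =
  fixes g :: "'v::euclidean_space \<Rightarrow> 'v \<Rightarrow> real"
  assumes bilinear: "bilinear g" and sym: "g u v = g v u" and pos: "u \<noteq> 0 \<Longrightarrow> g u u > 0"
begin

lemmas g_simps = bilinear_ladd[OF bilinear] bilinear_radd[OF bilinear] bilinear_lmul[OF bilinear]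
  bilinear_rmul[OF bilinear] bilinear_lneg[OF bilinear] bilinear_rneg[OF bilinear]
  bilinear_lsub[OF bilinear] bilinear_rsub[OF bilinear] bilinear_lzero[OF bilinear] bilinear_rzero[OF bilinear]

lemma g_sum_left: "g (sum f S) w = (\<Sum>i\<in>S. g (f i) w)"
  using bilinear linear_sum unfolding bilinear_def by blast

lemma nondegenerate: "(\<And>w. g u w = 0) \<Longrightarrow> u = 0"
  using pos by force

definition orthonormal :: "'v set \<Rightarrow> bool" where
  "orthonormal B \<longleftrightarrow> finite B \<and> (\<forall>e\<in>B. \<forall>f\<in>B. g e f = (if e = f then 1 else 0))"

definition orthonormal_basis :: "'v set \<Rightarrow> bool" where
  "orthonormal_basis B \<longleftrightarrow> orthonormal B \<and> (\<forall>v. v = (\<Sum>e\<in>B. g v e *\<^sub>R e))"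

lemma orthonormal_coefficient:
  assumes "orthonormal B" "f \<in> B"
  shows "g (\<Sum>e\<in>B. c e *\<^sub>R e) f = c f"
proof -
  have "c e * g e f = (if e = f then c e else 0)" if "e \<in> B" for e
    using assms that by (simp add: orthonormal_def)
  then have "g (\<Sum>e\<in>B. c e *\<^sub>R e) f = (\<Sum>e\<in>B. if e = f then c e else 0)"
    by (simp add: g_sum_left g_simps)
  also have "\<dots> = c f" using assms by (simp add: orthonormal_def)
  finally show ?thesis .
qed

lemma card_orthonormal_le:
  assumes "orthonormal B"
  shows "card B \<le> DIM('v)"
proof -
  have "independent B"
  proof (rule independent_if_scalars_zero)
    show "finite B" using assms by (simp add: orthonormal_def)
    fix c e assume "(\<Sum>e\<in>B. c e *\<^sub>R e) = 0" "e \<in> B"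
    with orthonormal_coefficient[OF assms, of e c] show "c e = 0" by (simp add: g_simps)
  qed
  then show ?thesis using independent_bound by blast
qed

text \<open>An orthonormal set of maximal cardinality is a basis, since the normalised remainder of a vector
outside its span could be added to it.\<close>

lemma ex_orthonormal_basis: "\<exists>B. orthonormal_basis B"
proof -
  have "orthonormal {}" by (simp add: orthonormal_def)
  moreover have "\<forall>C. orthonormal C \<longrightarrow> card C < Suc DIM('v)"
    using card_orthonormal_le by (simp add: less_Suc_eq_le)
  ultimately obtain B where B: "orthonormal B" "\<And>C. orthonormal C \<Longrightarrow> card C \<le> card B"
    using ex_has_greatest_nat[of orthonormal "{}" card "Suc DIM('v)"] by blast
  have "v = (\<Sum>e\<in>B. g v e *\<^sub>R e)" for v
  proof (rule ccontr)
    let ?s = "\<Sum>e\<in>B. g v e *\<^sub>R e"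
    assume "v \<noteq> ?s"
    define w where "w = v - ?s"
    have "w \<noteq> 0" using \<open>v \<noteq> ?s\<close> by (simp add: w_def)
    then have gw: "g w w > 0" by (rule pos)
    define n where "n = (1 / sqrt (g w w)) *\<^sub>R w"
    have "g w e = 0" if "e \<in> B" for e
      using orthonormal_coefficient[OF B(1) that] by (simp add: w_def g_simps)
    then have n: "g n e = 0" "g e n = 0" if "e \<in> B" for e
      using that by (simp_all add: n_def g_simps sym[of e])
    have "sqrt (g w w) * sqrt (g w w) = g w w" "sqrt (g w w) \<noteq> 0" using gw by simp_all
    then have nn: "g n n = 1" by (simp add: n_def g_simps field_simps)
    have "n \<notin> B" using n nn by force
    have "orthonormal (insert n B)"
      using B(1) n nn by (auto simp: orthonormal_def)
    from B(2)[OF this] \<open>n \<notin> B\<close> B(1) show False by (simp add: orthonormal_def)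
  qed
  with B(1) show ?thesis unfolding orthonormal_basis_def by blast
qed

lemma orthonormal_basisD:
  assumes "orthonormal_basis B"
  shows "finite B" "(\<Sum>e\<in>B. g v e *\<^sub>R e) = v"
  using assms unfolding orthonormal_basis_def orthonormal_def by auto

lemma parseval:
  assumes "orthonormal_basis B"
  shows "(\<Sum>e\<in>B. g u e * g v e) = g u v"
proof -
  have "g (\<Sum>e\<in>B. g u e *\<^sub>R e) v = (\<Sum>e\<in>B. g u e * g v e)"
    by (simp add: g_sum_left g_simps sym[of v])
  then show ?thesis using orthonormal_basisD(2)[OF assms, of u] by simp
qed

lemma trace_basis_independent:
  assumes B: "orthonormal_basis B" and C: "orthonormal_basis C" and h: "bilinear h"
  shows "(\<Sum>e\<in>B. h e e) = (\<Sum>e\<in>C. h e e :: real)"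
proof -
  have l: "linear (\<lambda>x. h x y)" and r: "linear (h x)" for x y using h by (auto simp: bilinear_def)
  have "(\<Sum>e\<in>B. h e e) = (\<Sum>e\<in>B. \<Sum>f\<in>C. g e f * h f e)"
  proof (rule sum.cong)
    fix e assume "e \<in> B"
    have "h e e = h (\<Sum>f\<in>C. g e f *\<^sub>R f) e" using orthonormal_basisD(2)[OF C] by simp
    also have "\<dots> = (\<Sum>f\<in>C. g e f * h f e)"
      using linear_sum[OF l, of "\<lambda>f. g e f *\<^sub>R f" C e] by (simp add: bilinear_lmul[OF h])
    finally show "h e e = (\<Sum>f\<in>C. g e f * h f e)" .
  qed simp
  also have "\<dots> = (\<Sum>f\<in>C. \<Sum>e\<in>B. g f e * h f e)"
    by (subst sum.swap) (simp add: sym)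
  also have "\<dots> = (\<Sum>f\<in>C. h f f)"
  proof (rule sum.cong)
    fix f assume "f \<in> C"
    have "h f f = h f (\<Sum>e\<in>B. g f e *\<^sub>R e)" using orthonormal_basisD(2)[OF B] by simp
    also have "\<dots> = (\<Sum>e\<in>B. g f e * h f e)"
      using linear_sum[OF r, of f "\<lambda>e. g f e *\<^sub>R e" B] by (simp add: bilinear_rmul[OF h])
    finally show "(\<Sum>e\<in>B. g f e * h f e) = h f f" by simp
  qed simp
  finally show ?thesis .
qed

end

locale hermitian_form = inner_form g for g :: "'v::euclidean_space \<Rightarrow> 'v \<Rightarrow> real" +
  fixes J :: "'v \<Rightarrow> 'v"
  assumes linear_J: "linear J" and J_J: "J (J u) = - u" and g_J: "g (J u) (J v) = g u v"
begin

lemmas J_simps = linear_add[OF linear_J] linear_diff[OF linear_J] linear_neg[OF linear_J]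
  linear_0[OF linear_J] linear_scale[OF linear_J] J_J

lemma g_J_left: "g (J u) v = - g u (J v)"
  using g_J[of u "J v"] by (simp add: J_J g_simps)

text \<open>The image of an orthonormal basis under \<open>J\<close> is another one.\<close>

lemma trace_J:
  assumes B: "orthonormal_basis B" and h: "bilinear h"
  shows "(\<Sum>e\<in>B. h (J e) (J e)) = (\<Sum>e\<in>B. h e e :: real)"
proof -
  have inj: "inj J" by (rule injI) (metis J_J minus_equation_iff)
  have "orthonormal_basis (J ` B)"
    unfolding orthonormal_basis_def orthonormal_def
  proof (intro conjI ballI allI)
    show "finite (J ` B)" using orthonormal_basisD(1)[OF B] by simp
    fix e f assume "e \<in> J ` B" "f \<in> J ` B"
    then show "g e f = (if e = f then 1 else 0)"
      using B inj by (auto simp: g_J orthonormal_basis_def orthonormal_def inj_eq)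
  next
    fix v
    have "(\<Sum>e\<in>J ` B. g v e *\<^sub>R e) = (\<Sum>e\<in>B. g v (J e) *\<^sub>R J e)"
      by (subst sum.reindex) (use inj in \<open>auto intro: inj_on_subset\<close>)
    also have "\<dots> = J (\<Sum>e\<in>B. g (- J v) e *\<^sub>R e)"
      by (simp add: linear_sum[OF linear_J] J_simps g_simps g_J_left)
    also have "\<dots> = v" by (simp only: orthonormal_basisD(2)[OF B]) (simp add: J_simps)
    finally show "v = (\<Sum>e\<in>J ` B. g v e *\<^sub>R e)" by simp
  qed
  from trace_basis_independent[OF this B h] show ?thesis
    by (subst (asm) sum.reindex) (use inj in \<open>auto intro: inj_on_subset\<close>)
qed

text \<open>The heart of the algebra. Think of \<open>T\<close> as the bracket of a Lie algebra with invariant inner product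
and compatible complex structure \<open>J\<close>; the balanced condition makes it abelian.\<close>

theorem lie_bracket_vanishes:
  assumes T: "bilinear T"
    and skew12: "\<And>u v. T u v = - T v u" and skew23: "\<And>u v w. g (T u v) w = - g (T u w) v"
    and type: "\<And>u v. T u v = T (J u) (J v) - J (T (J u) v) - J (T u (J v))"
    and jacobi: "\<And>u v w. T (T u v) w + T (T v w) u + T (T w u) v = 0"
    and B: "orthonormal_basis B" and balanced: "\<And>w. (\<Sum>e\<in>B. g (T e (J e)) w) = 0"
  shows "T u v = 0"
proof -
  note T_simps = bilinear_ladd[OF T] bilinear_radd[OF T] bilinear_lmul[OF T] bilinear_rmul[OF T]
    bilinear_lneg[OF T] bilinear_rneg[OF T] bilinear_lzero[OF T]
  have Tl: "linear (\<lambda>x. T x y)" for y using T by (simp add: bilinear_def)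
  have "(\<Sum>e\<in>B. T e (J e)) = 0"
    by (rule nondegenerate) (simp add: g_sum_left balanced)
  then have tr0: "(\<Sum>e\<in>B. T (T e (J e)) w) = 0" for w
    using linear_sum[OF Tl, of "\<lambda>e. T e (J e)" B w] by (simp add: T_simps)
  \<comment> \<open>In the Jacobi identity for \<open>e\<close>, \<open>J e\<close>, \<open>w\<close> the first term sums to zero, and by invariance of the trace
  under \<open>J\<close> the other two have the same sum.\<close>
  have trace: "(\<Sum>e\<in>B. g (T e z) (T (J e) w)) = 0" for z w
  proof -
    define h where "h = (\<lambda>x y. g (T (T w x) (J y)) z)"
    have h: "bilinear h"
      unfolding h_def bilinear_def by (auto intro!: linearI simp: T_simps g_simps J_simps)
    have swap: "g (T a e) z = g (T e z) a" for a e
      using skew12[of a e] skew23[of e a z] by (simp add: g_simps)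
    have "h (J e) (J e) = g (T e z) (T (J e) w)" for e
      using swap[of "T (J e) w" e] skew12[of w "J e"] by (simp add: h_def J_simps T_simps g_simps)
    with trace_J[OF B h] have S: "(\<Sum>e\<in>B. h e e) = (\<Sum>e\<in>B. g (T e z) (T (J e) w))" by simp
    have "0 = (\<Sum>e\<in>B. g (T (T e (J e)) w + T (T (J e) w) e + T (T w e) (J e)) z)"
      by (simp add: jacobi g_simps)
    also have "\<dots> = g (\<Sum>e\<in>B. T (T e (J e)) w) z + (\<Sum>e\<in>B. g (T (T (J e) w) e) z) + (\<Sum>e\<in>B. h e e)"
      by (simp add: g_simps g_sum_left sum.distrib h_def)
    also have "\<dots> = 2 * (\<Sum>e\<in>B. g (T e z) (T (J e) w))"
      by (simp add: tr0 g_simps S swap)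
    finally show ?thesis by simp
  qed
  have first: "(\<Sum>e\<in>B. \<Sum>f\<in>B. g (T e f) (T (J e) (J f))) = 0"
    by (subst sum.swap) (simp add: trace)
  \<comment> \<open>In an orthonormal expansion, the skewness of \<open>T\<close> in its last two arguments moves \<open>J\<close> from the value of
  \<open>T a\<close> to its argument.\<close>
  have move: "(\<Sum>f\<in>B. g (T e f) (J (T a f))) = - (\<Sum>f\<in>B. g (T e f) (T a (J f)))" for e a
  proof -
    have "(\<Sum>f\<in>B. g (T e f) (J (T a f))) = (\<Sum>f\<in>B. \<Sum>k\<in>B. g (T e f) k * g (J (T a f)) k)"
      by (simp add: parseval[OF B])
    also have "\<dots> = (\<Sum>f\<in>B. \<Sum>k\<in>B. - (g (T e k) f * g (T a (J k)) f))"
    proof (intro sum.cong refl)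
      fix f k
      have "g (T e f) k * g (J (T a f)) k = - (g (T e f) k * g (T a f) (J k))"
        by (simp add: g_J_left)
      also have "\<dots> = - (g (T e k) f * g (T a (J k)) f)"
        using skew23[of e f k] skew23[of a f "J k"] by simp
      finally show "g (T e f) k * g (J (T a f)) k = - (g (T e k) f * g (T a (J k)) f)" .
    qed
    also have "\<dots> = (\<Sum>k\<in>B. - (\<Sum>f\<in>B. g (T e k) f * g (T a (J k)) f))"
      by (subst sum.swap) (simp add: sum_negf)
    also have "\<dots> = - (\<Sum>f\<in>B. g (T e f) (T a (J f)))"
      by (simp add: parseval[OF B] sum_negf)
    finally show ?thesis .
  qed
  have second: "(\<Sum>e\<in>B. \<Sum>f\<in>B. g (T e f) (J (T (J e) f))) = 0"
    using first by (simp add: move sum_negf)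
  have "(\<Sum>e\<in>B. \<Sum>f\<in>B. g (T e f) (J (T e (J f)))) = (\<Sum>e\<in>B. \<Sum>f\<in>B. g (T f e) (J (T (J f) e)))"
  proof (intro sum.cong refl)
    fix e f show "g (T e f) (J (T e (J f))) = g (T f e) (J (T (J f) e))"
      using skew12[of e f] skew12[of e "J f"] by (simp add: g_simps J_simps)
  qed
  also have "\<dots> = (\<Sum>f\<in>B. \<Sum>e\<in>B. g (T f e) (J (T (J f) e)))" by (rule sum.swap)
  finally have third: "(\<Sum>e\<in>B. \<Sum>f\<in>B. g (T e f) (J (T e (J f)))) = 0" using second by simp
  have "(\<Sum>e\<in>B. \<Sum>f\<in>B. g (T e f) (T e f)) = (\<Sum>e\<in>B. \<Sum>f\<in>B.
      g (T e f) (T (J e) (J f)) - g (T e f) (J (T (J e) f)) - g (T e f) (J (T e (J f))))"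
  proof (intro sum.cong refl)
    fix e f
    show "g (T e f) (T e f) = g (T e f) (T (J e) (J f)) - g (T e f) (J (T (J e) f)) - g (T e f) (J (T e (J f)))"
      using arg_cong[OF type[of e f], of "g (T e f)"] by (simp add: g_simps)
  qed
  also have "\<dots> = 0" by (simp add: sum_subtractf first second third)
  finally have zero: "(\<Sum>e\<in>B. \<Sum>f\<in>B. g (T e f) (T e f)) = 0" .
  have nonneg: "g x x \<ge> 0" for x using pos[of x] by (cases "x = 0") (auto simp: g_simps)
  have fin: "finite B" by (rule orthonormal_basisD(1)[OF B])
  have "T e f = 0" if "e \<in> B" "f \<in> B" for e f
  proof -
    have "(\<Sum>f\<in>B. g (T e f) (T e f)) = 0"
      using zero that(1) fin by (subst (asm) sum_nonneg_eq_0_iff) (auto intro: sum_nonneg nonneg)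
    then have "g (T e f) (T e f) = 0"
      using that(2) fin by (subst (asm) sum_nonneg_eq_0_iff) (auto intro: nonneg)
    then show ?thesis using pos[of "T e f"] by fastforce
  qed
  moreover have "T u v = (\<Sum>(e, f)\<in>B \<times> B. g u e *\<^sub>R g v f *\<^sub>R T e f)"
    using bilinear_sum[OF T, of "\<lambda>e. g u e *\<^sub>R e" B "\<lambda>f. g v f *\<^sub>R f" B] orthonormal_basisD[OF B]
    by (simp add: T_simps case_prod_unfold mult.commute)
  ultimately show ?thesis by (auto simp: case_prod_unfold intro!: sum.neutral)
qed

end

section \<open>Geometry of the characteristic connection\<close>

locale hermitian_connection = connection_atlas A \<Gamma>
  for A :: "('a::topological_space, 'n::finite) chart set" and \<Gamma> :: "('a, 'n) conn" +
  fixes g :: "('a, 'n) form2" and J :: "('a, 'n) endo"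
  assumes almost_hermitian: "almost_hermitian A g J"
    and characteristic: "characteristic_connection A g J \<Gamma>"
begin

lemma hermitian_form:
  assumes "c \<in> A" "x \<in> codom c"
  shows "hermitian_form (g c x) (J c x)"
proof -
  have rm: "riemannian_metric A g" and ef: "endomorphism_field A J"
    and "\<forall>c\<in>A. \<forall>x\<in>codom c. (\<forall>u. J c x (J c x u) = - u) \<and> (\<forall>u v. g c x (J c x u) (J c x v) = g c x u v)"
    using almost_hermitian unfolding almost_hermitian_def by simp_all
  note * = this(3)[THEN bspec, OF assms(1), THEN bspec, OF assms(2)]
  have bf: "bilinear_form_field A g"
    and "\<forall>c\<in>A. \<forall>x\<in>codom c. (\<forall>u v. g c x u v = g c x v u) \<and> (\<forall>u. u \<noteq> 0 \<longrightarrow> g c x u u > 0)"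
    using rm unfolding riemannian_metric_def by - (elim conjE, assumption)+
  note ** = this(2)[THEN bspec, OF assms(1), THEN bspec, OF assms(2)]
  have "bilinear (g c x)" using bf assms unfolding bilinear_form_field_def by (elim conjE) blast
  moreover have "linear (J c x)" using ef assms unfolding endomorphism_field_def by (elim conjE) blast
  ultimately show ?thesis
    using * ** by (intro hermitian_form.intro inner_form.intro hermitian_form_axioms.intro) blast+
qed

lemma smooth_g: "c \<in> A \<Longrightarrow> smooth_on (\<lambda>x. g c x u v) (codom c)"
  using almost_hermitian
  unfolding almost_hermitian_def riemannian_metric_def bilinear_form_field_def by blast

lemma smooth_J: "c \<in> A \<Longrightarrow> smooth_on (\<lambda>x. J c x v) (codom c)"
  using almost_hermitian unfolding almost_hermitian_def endomorphism_field_def by blast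

lemma differentiable_Gamma: "c \<in> A \<Longrightarrow> x \<in> codom c \<Longrightarrow> (\<lambda>y. \<Gamma> c y u v) differentiable (at x)"
  using smooth_onD(2)[OF smooth_Gamma] .

lemma dir_deriv_g:
  assumes "c \<in> A" "x \<in> codom c"
  shows "dir_deriv (\<lambda>y. g c y v w) x u = g c x (\<Gamma> c x u v) w + g c x v (\<Gamma> c x u w)"
proof -
  have "nabla_form \<Gamma> g c x u v w = 0"
    using characteristic assms unfolding characteristic_connection_def parallel_form_def by blast
  then show ?thesis by (simp add: nabla_form_def)
qed

lemma dir_deriv_J:
  assumes "c \<in> A" "x \<in> codom c"
  shows "dir_deriv (\<lambda>y. J c y v) x u = J c x (\<Gamma> c x u v) - \<Gamma> c x u (J c x v)"
proof -
  have "nabla_endo \<Gamma> J c x u v = 0"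
    using characteristic assms unfolding characteristic_connection_def parallel_endo_def by blast
  then show ?thesis unfolding nabla_endo_def by (simp add: algebra_simps add_eq_0_iff)
qed

lemma dir_deriv_g_field:
  assumes c: "c \<in> A" and x: "x \<in> codom c" and V: "V differentiable (at x)"
  shows "dir_deriv (\<lambda>y. g c y (V y) w) x u =
    g c x (\<Gamma> c x u (V x)) w + g c x (V x) (\<Gamma> c x u w) + g c x (dir_deriv V x u) w"
proof -
  have lin: "linear (\<lambda>v. g c y v w)" if "y \<in> codom c" for y
    using hermitian_form[OF c that] by (simp add: hermitian_form_def inner_form_def bilinear_def)
  note diff = smooth_onD(2)[OF smooth_g[OF c] x]
  have "((\<lambda>y. g c y (V y) w) has_derivative
      (\<lambda>h. dir_deriv (\<lambda>y. g c y (V x) w) x h + g c x (dir_deriv V x h) w)) (at x within codom c)"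
  proof (rule has_derivative_linear_family[where L = "\<lambda>y v. g c y v w"])
    show "((\<lambda>y. g c y v w) has_derivative dir_deriv (\<lambda>y. g c y v w) x) (at x within codom c)" for v
      using frechet_derivative_works[THEN iffD1, OF diff] by (rule has_derivative_at_withinI)
    show "(V has_derivative dir_deriv V x) (at x within codom c)"
      using frechet_derivative_works[THEN iffD1, OF V] by (rule has_derivative_at_withinI)
    show "linear (\<lambda>v. dir_deriv (\<lambda>y. g c y v w) x h)" for h
      by (rule linear_dir_deriv_family[OF open_codom[OF c] x]) (use lin diff in auto)
  qed (use lin x in auto)
  then have "((\<lambda>y. g c y (V y) w) has_derivative
      (\<lambda>h. dir_deriv (\<lambda>y. g c y (V x) w) x h + g c x (dir_deriv V x h) w)) (at x)"
    by (simp add: at_within_open[OF x open_codom[OF c]])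
  then show ?thesis by (simp add: dir_deriv_eq dir_deriv_g[OF c x])
qed

lemma
  assumes "c \<in> A" "x \<in> codom c"
  shows bilinear_torsion: "bilinear (torsion \<Gamma> c x)"
    and torsion_skew: "torsion \<Gamma> c x u v = - torsion \<Gamma> c x v u"
    and torsion_skew_form: "g c x (torsion \<Gamma> c x u v) w = - g c x (torsion \<Gamma> c x u w) v"
proof -
  show "bilinear (torsion \<Gamma> c x)"
    using bilinear_Gamma[OF assms] unfolding bilinear_def linear_iff torsion_def by (simp add: algebra_simps)
  show "torsion \<Gamma> c x u v = - torsion \<Gamma> c x v u" by (simp add: torsion_def)
  show "g c x (torsion \<Gamma> c x u v) w = - g c x (torsion \<Gamma> c x u w) v"
    using characteristic assms
    unfolding characteristic_connection_def skew_torsion_def torsion_form_def by blast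
qed

text \<open>The Koszul argument: \<open>e u v w\<close>, the difference of the two sides paired with \<open>w\<close>, is skew in \<open>v, w\<close> because
both connections are metric and the torsion is a \<open>3\<close>-form, and symmetric in \<open>u, v\<close> because the torsions
agree. A trilinear form with both symmetries is zero.\<close>

lemma levi_civita_eq:
  assumes LC: "levi_civita A g LC" and c: "c \<in> A" and x: "x \<in> codom c"
  shows "LC c x u v = \<Gamma> c x u v - (1/2) *\<^sub>R torsion \<Gamma> c x u v"
proof -
  interpret hermitian_form "g c x" "J c x" by (rule hermitian_form[OF c x])
  let ?T = "torsion \<Gamma> c x"
  define e where "e = (\<lambda>u v w. g c x (\<Gamma> c x u v - LC c x u v - (1/2) *\<^sub>R ?T u v) w)"
  have LC': "nabla_form LC g c x u v w = 0" "torsion LC c x u v = 0" for u v w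
    using LC c x unfolding levi_civita_def parallel_form_def by blast+
  have "g c x (LC c x u v) w + g c x v (LC c x u w) = g c x (\<Gamma> c x u v) w + g c x v (\<Gamma> c x u w)" for u v w
    using LC'(1)[of u v w] by (simp add: nabla_form_def dir_deriv_g[OF c x])
  note metric = this
  have skew: "e u v w = - e u w v" for u v w
    using metric[of u v w] torsion_skew_form[OF c x, of u v w] sym[of v "\<Gamma> c x u w"] sym[of v "LC c x u w"]
    unfolding e_def g_simps real_scaleR_def by linarith
  have "\<Gamma> c x u v - LC c x u v - (1/2) *\<^sub>R ?T u v = \<Gamma> c x v u - LC c x v u - (1/2) *\<^sub>R ?T v u" for u v
  proof -
    have "LC c x u v = LC c x v u" using LC'(2)[of u v] by (simp add: torsion_def)
    moreover have "\<Gamma> c x u v = \<Gamma> c x v u + (1/2) *\<^sub>R ?T u v - (1/2) *\<^sub>R ?T v u"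
      unfolding torsion_def by (simp add: algebra_simps scaleR_add_left[symmetric])
    ultimately show ?thesis by simp
  qed
  then have symm: "e u v w = e v u w" for u v w
    unfolding e_def by (rule arg_cong[where f = "\<lambda>y. g c x y w"])
  have "e u v w = 0" for u v w
    using skew[of u v w] symm[of u w v] skew[of w u v] symm[of w v u] skew[of v w u] symm[of v u w] by linarith
  then have "\<Gamma> c x u v - LC c x u v - (1/2) *\<^sub>R ?T u v = 0"
    unfolding e_def by (rule nondegenerate)
  then show ?thesis by (simp add: algebra_simps)
qed

lemma dir_deriv_fundamental_form:
  assumes c: "c \<in> A" and x: "x \<in> codom c"
  shows "dir_deriv (\<lambda>y. fundamental_form g J c y v w) x u
    = g c x (J c x (\<Gamma> c x u v)) w + g c x (J c x v) (\<Gamma> c x u w)"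
proof -
  interpret hermitian_form "g c x" "J c x" by (rule hermitian_form[OF c x])
  have "(\<lambda>y. J c y v) differentiable (at x)" by (rule smooth_onD(2)[OF smooth_J[OF c] x])
  from dir_deriv_g_field[OF c x this] show ?thesis
    by (simp add: fundamental_form_def dir_deriv_J[OF c x] g_simps)
qed

text \<open>For a \<open>g\<close>-orthonormal basis \<open>B\<close> the inverse Gram matrix is \<open>\<Sum>\<^sub>e e\<^sub>i e\<^sub>j\<close>.\<close>

lemma trace_inverse_metric:
  assumes c: "c \<in> A" and x: "x \<in> codom c" and B: "inner_form.orthonormal_basis (g c x) B" and h: "bilinear h"
  shows "(\<Sum>i\<in>UNIV. \<Sum>j\<in>UNIV. inverse_metric g c x $ i $ j * h (axis i 1) (axis j 1)) = (\<Sum>e\<in>B. h e e)"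
proof -
  interpret hermitian_form "g c x" "J c x" by (rule hermitian_form[OF c x])
  let ?G = "(\<chi> i j. g c x (axis i 1) (axis j 1)) :: real ^ 'n ^ 'n"
  let ?K = "(\<chi> i j. \<Sum>e\<in>B. e $ i * e $ j) :: real ^ 'n ^ 'n"
  have expand: "h' e = (\<Sum>j\<in>UNIV. e $ j * h' (axis j 1))" if "linear h'" for h' :: "real ^ 'n \<Rightarrow> real" and e
  proof -
    have "h' e = h' (\<Sum>j\<in>UNIV. e $ j *\<^sub>R axis j 1)" by (simp add: basis_expansion scalar_mult_eq_scaleR[symmetric])
    then show ?thesis using that by (simp add: linear_sum linear_scale)
  qed
  have KG: "(\<Sum>j\<in>UNIV. (\<Sum>e\<in>B. e $ i * e $ j) * g c x (axis j 1) (axis k 1)) = (if i = k then 1 else 0)" for i k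
  proof -
    have lin: "linear (\<lambda>e. g c x e (axis k 1))" using bilinear by (simp add: bilinear_def)
    have "(\<Sum>j\<in>UNIV. (\<Sum>e\<in>B. e $ i * e $ j) * g c x (axis j 1) (axis k 1))
        = (\<Sum>e\<in>B. e $ i * (\<Sum>j\<in>UNIV. e $ j * g c x (axis j 1) (axis k 1)))"
      by (simp add: sum_distrib_left sum_distrib_right mult_ac) (rule sum.swap)
    also have "\<dots> = (\<Sum>e\<in>B. e $ i * g c x e (axis k 1))"
      by (simp only: expand[OF lin, symmetric])
    also have "\<dots> = (\<Sum>e\<in>B. g c x (axis k 1) e *\<^sub>R e) $ i"
      by (simp add: sym mult.commute)
    also have "\<dots> = axis k 1 $ i" by (simp only: orthonormal_basisD(2)[OF B])
    finally show ?thesis by (simp add: axis_def)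
  qed
  have "?K ** ?G = mat 1" by (simp add: vec_eq_iff matrix_matrix_mult_def mat_def KG)
  then have KG1: "?K ** ?G = mat 1" "?G ** ?K = mat 1"
    using matrix_left_right_inverse by blast+
  then have "\<exists>K. ?G ** K = mat 1 \<and> K ** ?G = mat 1" by blast
  then have "matrix_inv ?G ** ?G = mat 1" unfolding matrix_inv_def by (rule someI2_ex) (rule conjunct2)
  then have "matrix_inv ?G ** (?G ** ?K) = mat 1 ** ?K" unfolding matrix_mul_assoc by (rule arg_cong)
  then have "matrix_inv ?G = ?K" unfolding KG1(2) by (simp only: matrix_mul_lid matrix_mul_rid)
  then have "inverse_metric g c x = ?K" unfolding inverse_metric_def .
  then have "(\<Sum>i\<in>UNIV. \<Sum>j\<in>UNIV. inverse_metric g c x $ i $ j * h (axis i 1) (axis j 1))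
      = (\<Sum>i\<in>UNIV. \<Sum>j\<in>UNIV. \<Sum>e\<in>B. e $ i * (e $ j * h (axis i 1) (axis j 1)))"
    by (simp add: sum_distrib_left sum_distrib_right mult_ac)
  also have "\<dots> = (\<Sum>i\<in>UNIV. \<Sum>e\<in>B. \<Sum>j\<in>UNIV. e $ i * (e $ j * h (axis i 1) (axis j 1)))"
    by (rule sum.cong[OF refl], rule sum.swap)
  also have "\<dots> = (\<Sum>e\<in>B. \<Sum>i\<in>UNIV. \<Sum>j\<in>UNIV. e $ i * (e $ j * h (axis i 1) (axis j 1)))"
    by (rule sum.swap)
  also have "\<dots> = (\<Sum>e\<in>B. h e e)"
  proof (rule sum.cong[OF refl])
    fix e
    have l: "linear (\<lambda>u. h u e)" and r: "linear (h u)" for u using h by (simp_all add: bilinear_def)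
    show "(\<Sum>i\<in>UNIV. \<Sum>j\<in>UNIV. e $ i * (e $ j * h (axis i 1) (axis j 1))) = h e e"
      by (simp add: sum_distrib_left[symmetric] expand[OF r, symmetric] expand[OF l, symmetric])
  qed
  finally show ?thesis .
qed

text \<open>\<open>\<Omega>\<close> is parallel for the characteristic connection, so its Levi-Civita derivative is algebraic in the
torsion, and \<open>\<delta>\<Omega>\<close> is half the trace of \<open>T\<close> with \<open>J\<close>, up to sign.\<close>

lemma torsion_trace:
  assumes LC: "levi_civita A g LC" and W3: "type_W3 A g J LC" and c: "c \<in> A" and x: "x \<in> codom c"
    and B: "inner_form.orthonormal_basis (g c x) B"
  shows "(\<Sum>e\<in>B. g c x (torsion \<Gamma> c x e (J c x e)) w) = 0"
proof -
  interpret hermitian_form "g c x" "J c x" by (rule hermitian_form[OF c x])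
  let ?T = "torsion \<Gamma> c x" and ?J = "J c x"
  note T = bilinear_torsion[OF c x]
  note T_simps = bilinear_ladd[OF T] bilinear_radd[OF T] bilinear_lmul[OF T] bilinear_rmul[OF T]
  let ?h = "\<lambda>u v. (g c x (?J (?T u v)) w + g c x (?J v) (?T u w)) / 2"
  have nabla: "nabla_form LC (fundamental_form g J) c x u v w = ?h u v" for u v
    unfolding nabla_form_def dir_deriv_fundamental_form[OF c x]
    by (simp add: fundamental_form_def levi_civita_eq[OF LC c x] J_simps g_simps field_simps)
  have h: "bilinear ?h"
    unfolding bilinear_def by (auto intro!: linearI simp: T_simps J_simps g_simps field_simps)
  have "codifferential2 g LC (fundamental_form g J) c x w = 0"
    using W3 c x unfolding type_W3_def by blast
  then have "0 = (\<Sum>e\<in>B. ?h e e)"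
    using trace_inverse_metric[OF c x B h] by (simp add: codifferential2_def nabla)
  also have "\<dots> = (\<Sum>e\<in>B. - g c x (?T e (?J e)) w / 2)"
  proof (rule sum.cong[OF refl])
    fix e
    have "?T e e = 0" by (simp add: torsion_def)
    then show "?h e e = - g c x (?T e (?J e)) w / 2"
      using torsion_skew_form[OF c x, of e w "?J e"] sym[of "?J e" "?T e w"] by (simp add: J_simps g_simps)
  qed
  finally show ?thesis by (simp add: sum_negf sum_divide_distrib[symmetric])
qed

text \<open>As \<open>J\<close> is parallel, its derivatives in the Nijenhuis tensor can be expressed by \<open>\<Gamma>\<close>, and the terms
combine to values of the torsion. For a \<open>3\<close>-form this says that its type is \<open>(2,1) + (1,2)\<close>.\<close>

lemma torsion_type:
  assumes "integrable_structure A J" and c: "c \<in> A" and x: "x \<in> codom c"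
  shows "torsion \<Gamma> c x u v = torsion \<Gamma> c x (J c x u) (J c x v)
    - J c x (torsion \<Gamma> c x (J c x u) v) - J c x (torsion \<Gamma> c x u (J c x v))"
proof -
  interpret hermitian_form "g c x" "J c x" by (rule hermitian_form[OF c x])
  have z: "dir_deriv (\<lambda>_. a) x b = 0" for a b :: "real ^ 'n"
    by (rule dir_deriv_eq[OF has_derivative_const])
  have "nijenhuis J c x u v = 0" using assms unfolding integrable_structure_def by blast
  then show ?thesis
    by (simp add: nijenhuis_def lie_bracket_def dir_deriv_J[OF c x] z J_simps torsion_def algebra_simps)
qed

text \<open>The definition of a parallel torsion form, with the index raised by means of \<open>\<nabla>g = 0\<close>.\<close>

lemma torsion_parallel:
  assumes "parallel_torsion A g \<Gamma>" and c: "c \<in> A" and x: "x \<in> codom c"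
  shows "dir_deriv (\<lambda>y. \<Gamma> c y v w) x u - dir_deriv (\<lambda>y. \<Gamma> c y w v) x u + \<Gamma> c x u (torsion \<Gamma> c x v w)
    = torsion \<Gamma> c x (\<Gamma> c x u v) w + torsion \<Gamma> c x v (\<Gamma> c x u w)"
proof -
  interpret hermitian_form "g c x" "J c x" by (rule hermitian_form[OF c x])
  let ?D = "\<lambda>u. dir_deriv (\<lambda>y. \<Gamma> c y v w) x u - dir_deriv (\<lambda>y. \<Gamma> c y w v) x u"
  note D = frechet_derivative_works[THEN iffD1, OF differentiable_Gamma[OF c x]]
  have dT: "((\<lambda>y. torsion \<Gamma> c y v w) has_derivative ?D) (at x)"
    unfolding torsion_def by (rule has_derivative_diff[OF D D])
  then have diff: "(\<lambda>y. torsion \<Gamma> c y v w) differentiable (at x)" by (rule differentiableI)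
  have "g c x (?D u + \<Gamma> c x u (torsion \<Gamma> c x v w) - torsion \<Gamma> c x (\<Gamma> c x u v) w - torsion \<Gamma> c x v (\<Gamma> c x u w)) z = 0" for z
  proof -
    have "dir_deriv (\<lambda>y. torsion_form g \<Gamma> c y v w z) x u
     - torsion_form g \<Gamma> c x (\<Gamma> c x u v) w z - torsion_form g \<Gamma> c x v (\<Gamma> c x u w) z
     - torsion_form g \<Gamma> c x v w (\<Gamma> c x u z) = 0"
      using assms unfolding parallel_torsion_def by blast
    then show ?thesis
      by (simp add: torsion_form_def dir_deriv_g_field[OF c x diff] dir_deriv_eq[OF dT] g_simps)
  qed
  from nondegenerate[OF this] show ?thesis by (simp add: algebra_simps)
qed

text \<open>The first Bianchi identity of a connection with torsion: the cyclic sum of \<open>R(u, v) w\<close> differs from that of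
\<open>T(T(u, v), w)\<close> by the cyclic sum of \<open>\<nabla>T\<close>.\<close>

lemma torsion_jacobi:
  assumes par: "parallel_torsion A g \<Gamma>" and flat: "flat_connection A \<Gamma>" and c: "c \<in> A" and x: "x \<in> codom c"
  defines "T \<equiv> torsion \<Gamma> c x"
  shows "T (T u v) w + T (T v w) u + T (T w u) v = 0"
proof -
  let ?\<Gamma> = "\<Gamma> c x" and ?d = "\<lambda>u v w. dir_deriv (\<lambda>y. \<Gamma> c y v w) x u"
  have lin: "?\<Gamma> u (a - b) = ?\<Gamma> u a - ?\<Gamma> u b" for u a b by (rule linear_diff[OF linear_Gamma[OF c x]])
  have Tl: "T (a - b) w = T a w - T b w" for a b w
    unfolding T_def by (rule bilinear_lsub[OF bilinear_torsion[OF c x]])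
  have R: "?d u v w - ?d v u w + ?\<Gamma> u (?\<Gamma> v w) - ?\<Gamma> v (?\<Gamma> u w) = 0" for u v w
    using flat c x unfolding flat_connection_def curvature_def by blast
  have P: "?d u v w - ?d u w v + ?\<Gamma> u (?\<Gamma> v w - ?\<Gamma> w v) - T (?\<Gamma> u v) w + T (?\<Gamma> u w) v = 0" for u v w
    using torsion_parallel[OF par c x, where u = u and v = v and w = w] torsion_skew[OF c x, of v "?\<Gamma> u w"]
    by (simp add: T_def torsion_def)
  have "T (T u v) w + T (T v w) u + T (T w u) v =
      T (?\<Gamma> u v) w - T (?\<Gamma> v u) w + (T (?\<Gamma> v w) u - T (?\<Gamma> w v) u) + (T (?\<Gamma> w u) v - T (?\<Gamma> u w) v)"
    by (simp only: Tl[symmetric]) (simp add: T_def torsion_def)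
  also have "\<dots> = (?d u v w - ?d v u w + ?\<Gamma> u (?\<Gamma> v w) - ?\<Gamma> v (?\<Gamma> u w))
      + (?d v w u - ?d w v u + ?\<Gamma> v (?\<Gamma> w u) - ?\<Gamma> w (?\<Gamma> v u))
      + (?d w u v - ?d u w v + ?\<Gamma> w (?\<Gamma> u v) - ?\<Gamma> u (?\<Gamma> w v))"
  proof -
    have Q: "T (?\<Gamma> a b) e = T (?\<Gamma> a e) b + (?d a b e - ?d a e b + (?\<Gamma> a (?\<Gamma> b e) - ?\<Gamma> a (?\<Gamma> e b)))" for a b e
      using P[where u = a and v = b and w = e] unfolding lin by (simp add: algebra_simps)
    show ?thesis by (simp add: Q[of u v w] Q[of v w u] Q[of w u v] algebra_simps)
  qed
  also have "\<dots> = 0" by (simp only: R add_0_left)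
  finally show ?thesis .
qed

theorem flat_parallel_W3_torsion_zero:
  assumes LC: "levi_civita A g LC" and W3: "type_W3 A g J LC"
    and par: "parallel_torsion A g \<Gamma>" and flat: "flat_connection A \<Gamma>" and c: "c \<in> A" and x: "x \<in> codom c"
  shows "torsion \<Gamma> c x u v = 0"
proof -
  interpret hermitian_form "g c x" "J c x" by (rule hermitian_form[OF c x])
  obtain B where B: "orthonormal_basis B" using ex_orthonormal_basis by blast
  have int: "integrable_structure A J" using W3 by (simp add: type_W3_def)
  show ?thesis
    by (rule lie_bracket_vanishes[OF bilinear_torsion[OF c x] torsion_skew[OF c x] torsion_skew_form[OF c x]
          torsion_type[OF int c x] torsion_jacobi[OF par flat c x] B torsion_trace[OF LC W3 c x B]])
qed

theorem kaehler_of_zero_torsion: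
  assumes int: "integrable_structure A J" and T: "\<And>c x u v. c \<in> A \<Longrightarrow> x \<in> codom c \<Longrightarrow> torsion \<Gamma> c x u v = 0"
  shows "kaehler A g J"
  unfolding kaehler_def
proof (intro conjI ballI allI)
  fix c x u v w assume c: "c \<in> A" and x: "x \<in> codom c"
  interpret hermitian_form "g c x" "J c x" by (rule hermitian_form[OF c x])
  have s: "\<Gamma> c x a b = \<Gamma> c x b a" for a b using T[OF c x, of a b] by (simp add: torsion_def)
  have k: "g c x (J c x a) b = - g c x (J c x b) a" for a b
    using g_J_left[of a b] sym[of a "J c x b"] by simp
  show "ext_deriv2 (fundamental_form g J) c x u v w = 0"
    unfolding ext_deriv2_def dir_deriv_fundamental_form[OF c x]
    using k[of v "\<Gamma> c x u w"] k[of w "\<Gamma> c x v u"] k[of u "\<Gamma> c x w v"] s[of u w] s[of u v] s[of v w] by simp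
qed (use almost_hermitian int in simp_all)

theorem levi_civita_flat_of_zero_torsion:
  assumes LC: "levi_civita A g LC" and flat: "flat_connection A \<Gamma>"
    and T: "\<And>c x u v. c \<in> A \<Longrightarrow> x \<in> codom c \<Longrightarrow> torsion \<Gamma> c x u v = 0"
  shows "flat_connection A LC"
  unfolding flat_connection_def
proof (intro ballI allI)
  fix c x u v w assume c: "c \<in> A" and x: "x \<in> codom c"
  have eq: "LC c y a b = \<Gamma> c y a b" if "y \<in> codom c" for y a b
    using levi_civita_eq[OF LC c that] T[OF c that] by simp
  have d: "dir_deriv (\<lambda>y. LC c y a b) x h = dir_deriv (\<lambda>y. \<Gamma> c y a b) x h" for a b h
  proof (rule dir_deriv_eq)
    show "((\<lambda>y. LC c y a b) has_derivative dir_deriv (\<lambda>y. \<Gamma> c y a b) x) (at x)"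
      by (rule has_derivative_transform_within_open[OF
            frechet_derivative_works[THEN iffD1, OF differentiable_Gamma[OF c x]] open_codom[OF c] x])
        (simp add: eq)
  qed
  have "curvature \<Gamma> c x u v w = 0" using flat c x unfolding flat_connection_def by blast
  then show "curvature LC c x u v w = 0" by (simp add: curvature_def d eq[OF x])
qed

end

section \<open>Flatness and vanishing torsion\<close>

theorem theorem4p7:
  fixes A :: "('a::{t2_space,second_countable_topology}, 6) chart set"
    and g :: "('a, 6) form2" and J :: "('a, 6) endo"
    and LC \<Gamma> :: "('a, 6) conn"
    and p :: 'a and c :: "('a, 6) chart"
  assumes "smooth_atlas A" and "connected (UNIV :: 'a set)"
    and "almost_hermitian A g J" and "complete_metric A g"
    and "levi_civita A g LC" and "type_W3 A g J LC"
    and "characteristic_connection A g J \<Gamma>"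
    and "parallel_torsion A g \<Gamma>"
    and "c \<in> A" and "p \<in> fst c" and "lie_group_dim (holonomy_group A \<Gamma> p c) = 0"
  shows "kaehler A g J \<and> flat_connection A LC \<and> zero_torsion A g \<Gamma>"
proof -
  interpret hermitian_connection A \<Gamma> g J
    using assms(1,3,7) by unfold_locales (simp_all add: characteristic_connection_def)
  have flat: "flat_connection A \<Gamma>"
    by (rule flat_of_discrete_holonomy[OF assms(2,9,10,11)])
  have T: "torsion \<Gamma> c x u v = 0" if "c \<in> A" "x \<in> codom c" for c x u v
    by (rule flat_parallel_W3_torsion_zero[OF assms(5,6,8) flat that])
  have "zero_torsion A g \<Gamma>"
    unfolding zero_torsion_def torsion_form_def
  proof (intro ballI allI)
    fix c x u v w assume "c \<in> A" "x \<in> codom c"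
    then interpret hermitian_form "g c x" "J c x" by (rule hermitian_form)
    show "g c x (torsion \<Gamma> c x u v) w = 0"
      using T[OF \<open>c \<in> A\<close> \<open>x \<in> codom c\<close>] by (simp add: g_simps)
  qed
  moreover have "kaehler A g J"
    using assms(6) T by (intro kaehler_of_zero_torsion) (simp_all add: type_W3_def)
  moreover have "flat_connection A LC"
    by (rule levi_civita_flat_of_zero_torsion[OF assms(5) flat T])
  ultimately show ?thesis by blast
qed

end
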